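(* Let $m$ be a positive integer. The inverse $B^{-1}$ of the Bargmann transform is bounded from the Fock-Sobolev space $F^{2,m}$ to the Sobolev space $W^{2,m}(dx)$. However, if $m\ge1$, the image $B(W^{2,m}(dx))$ is not contained in $F^{2,m}$.
   Context: Let $d\lambda(z)=\pi^{-n}e^{-|z|^2}dv(z)$ on $\mathbb{C}^n$. The Fock space $F^2$ is the space of entire functions $f$ on $\mathbb{C}^n$ with $\|f\|_{F^2}=(\int_{\mathbb{C}^n}|f|^2d\lambda)^{1/2}<\infty$. The Fock-Sobolev space $F^{2,m}$ is the space of entire functions $f$ on $\mathbb{C}^n$ with $\|f\|_{F^{2,m}}=\sum_{|\alpha|\le m}\|\partial^\alpha f\|_{F^2}<\infty$. $W^{2,m}(dx)$ is the classical $L^2$-based Sobolev space of order $m$ on $\mathbb{R}^n$ with Lebesgue measure. The Bargmann transform is the isometry $B$ from $L^2(\mathbb{R}^n,dx)$ onto $F^2$ given by $Bf(z)=\left(\frac{2}{\pi}\right)^{n/4}\int_{\mathbb{R}^n}f(x)e^{2x\cdot z-x^2-z^2/2}dx$, where $z^2=z_1^2+\dots+z_n^2$, $x^2=x_1^2+\dots+x_n^2$ and $x\cdot z=x_1z_1+\dots+x_nz_n$. *)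

theory Defs
  imports "HOL-Analysis.Analysis"
begin

section \<open>Multi-indices and iterated partial derivatives\<close>

definition multi_indices :: "nat \<Rightarrow> ('n::finite \<Rightarrow> nat) set"
  where "multi_indices m = {\<alpha>. (\<Sum>i\<in>UNIV. \<alpha> i) \<le> m}"

lemma finite_multi_indices: "finite (multi_indices m :: ('n::finite \<Rightarrow> nat) set)"
proof (rule finite_subset)
  show "multi_indices m \<subseteq> (PiE UNIV (\<lambda>_. {..m}) :: ('n \<Rightarrow> nat) set)"
  proof
    fix \<alpha> :: "'n \<Rightarrow> nat" assume "\<alpha> \<in> multi_indices m"
    moreover have "\<alpha> i \<le> (\<Sum>i\<in>UNIV. \<alpha> i)" for i
      by (rule member_le_sum) auto
    ultimately show "\<alpha> \<in> PiE UNIV (\<lambda>_. {..m})"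
      by (auto simp: multi_indices_def intro: order_trans)
  qed
qed (simp add: finite_PiE)

text \<open>
  The index type carries no order, so a list of the coordinates is fixed in which the partial
  derivatives of a multi-index are taken. Partial derivatives commute on the entire functions
  and on the test functions below, so the choice is immaterial there.
\<close>

definition coords :: "'n::finite list"
  where "coords = (SOME is. distinct is \<and> set is = UNIV)"

lemma coords: "distinct (coords :: 'n::finite list)" "set (coords :: 'n list) = UNIV"
proof -
  have "\<exists>is :: 'n list. distinct is \<and> set is = UNIV"
    using finite_distinct_list[of "UNIV :: 'n set"] by auto
  then have "distinct (coords :: 'n list) \<and> set (coords :: 'n list) = UNIV"
    unfolding coords_def by (rule someI_ex)
  then show "distinct (coords :: 'n list)" "set (coords :: 'n list) = UNIV"
    by auto
qed

definition multi_deriv :: "('n::finite \<Rightarrow> 'f \<Rightarrow> 'f) \<Rightarrow> ('n \<Rightarrow> nat) \<Rightarrow> 'f \<Rightarrow> 'f"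
  where "multi_deriv D \<alpha> f = foldr (\<lambda>i. D i ^^ \<alpha> i) coords f"

definition complex_partial :: "'n::finite \<Rightarrow> (complex ^ 'n \<Rightarrow> complex) \<Rightarrow> complex ^ 'n \<Rightarrow> complex"
  where "complex_partial i f z = deriv (\<lambda>t. f (z + t *s axis i 1)) 0"

definition real_partial :: "'n::finite \<Rightarrow> (real ^ 'n \<Rightarrow> complex) \<Rightarrow> real ^ 'n \<Rightarrow> complex"
  where "real_partial i f x = vector_derivative (\<lambda>t. f (x + t *\<^sub>R axis i 1)) (at 0)"


section \<open>Fock and Fock-Sobolev spaces\<close>

text \<open>Complex differentiability means that the real Frechet derivative is complex-linear.\<close>

definition entire :: "(complex ^ 'n \<Rightarrow> complex) \<Rightarrow> bool"
  where "entire f \<longleftrightarrow>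
    (\<forall>z. \<exists>f'. (f has_derivative f') (at z) \<and> (\<forall>c v. f' (c *s v) = c * f' v))"

definition fock_measure :: "(complex ^ 'n) measure"
  where "fock_measure = density lborel (\<lambda>z. ennreal (exp (- (norm z)\<^sup>2) / pi ^ CARD('n)))"

definition fock :: "(complex ^ 'n \<Rightarrow> complex) set"
  where "fock = {f. entire f \<and> integrable fock_measure (\<lambda>z. (cmod (f z))\<^sup>2)}"

definition fock_norm :: "(complex ^ 'n \<Rightarrow> complex) \<Rightarrow> real"
  where "fock_norm f = sqrt (LINT z|fock_measure. (cmod (f z))\<^sup>2)"

definition fock_sobolev :: "nat \<Rightarrow> (complex ^ 'n \<Rightarrow> complex) set"
  where "fock_sobolev m =
    {f. entire f \<and> (\<forall>\<alpha>\<in>multi_indices m. multi_deriv complex_partial \<alpha> f \<in> fock)}"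

definition fock_sobolev_norm :: "nat \<Rightarrow> (complex ^ 'n \<Rightarrow> complex) \<Rightarrow> real"
  where "fock_sobolev_norm m f =
    (\<Sum>\<alpha>\<in>multi_indices m. fock_norm (multi_deriv complex_partial \<alpha> f))"


section \<open>Lebesgue and Sobolev spaces on the real side\<close>

definition L2 :: "(real ^ 'n \<Rightarrow> complex) set"
  where "L2 = {f \<in> borel_measurable lborel. integrable lborel (\<lambda>x. (cmod (f x))\<^sup>2)}"

definition L2_norm :: "(real ^ 'n \<Rightarrow> complex) \<Rightarrow> real"
  where "L2_norm f = sqrt (LINT x|lborel. (cmod (f x))\<^sup>2)"

definition L2_class :: "(real ^ 'n \<Rightarrow> complex) \<Rightarrow> (real ^ 'n \<Rightarrow> complex) set"
  where "L2_class f = {g \<in> L2. AE x in lborel. g x = f x}"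

text \<open>
  Smoothness: every iterated partial derivative, in whatever order, is differentiable everywhere
  (and hence continuous).
\<close>

definition test_functions :: "(real ^ 'n \<Rightarrow> complex) set"
  where "test_functions =
    {\<phi>. (\<forall>is x. foldr real_partial is \<phi> differentiable at x) \<and> compact (closure {x. \<phi> x \<noteq> 0})}"

definition has_weak_deriv ::
    "('n::finite \<Rightarrow> nat) \<Rightarrow> (real ^ 'n \<Rightarrow> complex) \<Rightarrow> (real ^ 'n \<Rightarrow> complex) \<Rightarrow> bool"
  where "has_weak_deriv \<alpha> f g \<longleftrightarrow>
    (\<forall>\<phi>\<in>test_functions.
      (LINT x|lborel. f x * multi_deriv real_partial \<alpha> \<phi> x) =
      (-1) ^ (\<Sum>i\<in>UNIV. \<alpha> i) * (LINT x|lborel. g x * \<phi> x))"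

definition sobolev :: "nat \<Rightarrow> (real ^ 'n \<Rightarrow> complex) set"
  where "sobolev m = {f \<in> L2. \<forall>\<alpha>\<in>multi_indices m. \<exists>g\<in>L2. has_weak_deriv \<alpha> f g}"

text \<open>Weak derivatives in \<open>L2\<close> are unique up to null sets, so their norm does not depend on the choice.\<close>

definition weak_deriv :: "('n::finite \<Rightarrow> nat) \<Rightarrow> (real ^ 'n \<Rightarrow> complex) \<Rightarrow> real ^ 'n \<Rightarrow> complex"
  where "weak_deriv \<alpha> f = (SOME g. g \<in> L2 \<and> has_weak_deriv \<alpha> f g)"

definition sobolev_norm :: "nat \<Rightarrow> (real ^ 'n \<Rightarrow> complex) \<Rightarrow> real"
  where "sobolev_norm m f = sqrt (\<Sum>\<alpha>\<in>multi_indices m. (L2_norm (weak_deriv \<alpha> f))\<^sup>2)"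


section \<open>The Bargmann transform\<close>

definition bargmann :: "(real ^ 'n \<Rightarrow> complex) \<Rightarrow> complex ^ 'n \<Rightarrow> complex"
  where "bargmann f z =
    of_real ((2 / pi) powr (real CARD('n) / 4)) *
    (LINT x|lborel. f x *
      exp (2 * (\<Sum>i\<in>UNIV. of_real (x $ i) * z $ i)
           - (\<Sum>i\<in>UNIV. (of_real (x $ i))\<^sup>2)
           - (\<Sum>i\<in>UNIV. (z $ i)\<^sup>2) / 2))"

text \<open>
  Elements of the Lebesgue space are classes modulo null sets, so the inverse transform of \<open>F\<close>
  is the set of all functions representing it.
\<close>

definition bargmann_inv :: "(complex ^ 'n \<Rightarrow> complex) \<Rightarrow> (real ^ 'n \<Rightarrow> complex) set"
  where "bargmann_inv F = {f \<in> L2. bargmann f = F}"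

end

theory Submission
  imports Defs "HOL-Complex_Analysis.Complex_Analysis" "HOL-Probability.Distributions"
begin

text \<open>
  The transform intertwines the structures on both sides. Completing the square in its kernel
  shows that \<open>\<integral> k(x, z) cnj (k(x, w)) dx\<close> is a multiple of the reproducing kernel \<open>exp \<langle>z, w\<rangle>\<close>, and
  that a translation by \<open>t\<close> along the \<open>j\<close>-th axis becomes the Weyl operator
  \<open>F z \<mapsto> F (z + t e\<^sub>j) exp (- t z\<^sub>j - t\<^sup>2/2)\<close>. The derivative of the latter at \<open>t = 0\<close> is
  \<open>\<partial>\<^sub>j F - z\<^sub>j F\<close>, so this operator represents the partial derivative of the preimage.

  Boundedness of the inverse. The first fact and the reproducing formula of the Fock space
  (\<open>fock_reproducing\<close>, from the mean value property on circles) give every Fock function a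
  preimage with a norm bound (\<open>bargmann_surjective\<close>): the adjoint of the transform inverts it on
  truncations, and Schur's test bounds the adjoint. The preimage is unique up to null sets
  (\<open>bargmann_injective\<close>), because on imaginary arguments the transform is a Fourier transform. If
  \<open>F\<close> and \<open>\<partial>\<^sub>j F\<close> are Fock functions, then so is \<open>z\<^sub>j F\<close>, with a bound: integration by parts against
  the Gaussian gives \<open>\<parallel>z\<^sub>j F\<parallel> \<le> 2 (\<parallel>F\<parallel> + \<parallel>\<partial>\<^sub>j F\<parallel>)\<close> (\<open>fock_multiply_coordinate\<close>). Hence
  \<open>\<partial>\<^sub>j F - z\<^sub>j F\<close> lies in the Fock-Sobolev space of one order less and has a preimage \<open>g\<close>; uniqueness
  applied to differences of translates identifies \<open>g\<close> as the weak derivative of the preimage of \<open>F\<close>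
  (\<open>weak_derivative_bargmann\<close>). Induction on the order gives all weak derivatives with bounds
  (\<open>weak_derivatives_of_preimage\<close>).

  Failure of the converse. Being a Sobolev function is invariant under translations, whereas the
  norm of \<open>\<partial>\<^sub>j F\<close> grows linearly with the translation. So in \<open>\<Sum>k. 2\<^sup>-\<^sup>k f\<^sub>0 (x - 4\<^sup>k e\<^sub>j)\<close> the weights
  make the series converge in the Sobolev space, but not the series of the derivatives of the
  transforms. To avoid computing norms, \<open>f\<^sub>0\<close> is the preimage of the constant \<open>1\<close>; then the
  derivative of the transform violates at the points \<open>4\<^sup>k e\<^sub>j\<close> the growth bound
  \<open>C exp (|z|\<^sup>2/2)\<close> of Fock functions (\<open>sobolev_image_not_fock_sobolev\<close>).
\<close>

(* The symbol $ is reserved for the components of vectors. *)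
unbundle no Formal_Power_Series.fps_syntax

section \<open>Gaussian weights\<close>

lemma integrable_gaussian:
  fixes c :: real
  assumes "c > 0"
  shows "integrable lborel (\<lambda>x::'a::euclidean_space. exp (- c * (norm x)\<^sup>2))"
proof -
  define \<sigma> where "\<sigma> = 1 / sqrt (2 * c)"
  have \<sigma>: "\<sigma> > 0" "2 * \<sigma>\<^sup>2 = 1 / c"
    using assms by (auto simp: \<sigma>_def power_divide)
  have "integrable lborel (\<lambda>t::real. sqrt (2 * pi * \<sigma>\<^sup>2) * normal_density 0 \<sigma> t)"
    using \<sigma> by (intro integrable_mult_right integrable_normal_density) auto
  also have "(\<lambda>t::real. sqrt (2 * pi * \<sigma>\<^sup>2) * normal_density 0 \<sigma> t) = (\<lambda>t. exp (- c * t\<^sup>2))"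
    using \<sigma> by (auto simp: normal_density_def)
  finally have 1: "(\<integral>\<^sup>+t. ennreal (exp (- c * (t::real)\<^sup>2)) \<partial>lborel) < \<infinity>"
    by (simp add: integrable_iff_bounded)
  have eq: "exp (- c * (norm x)\<^sup>2) = (\<Prod>b\<in>Basis. exp (- c * (x \<bullet> b)\<^sup>2))" for x :: 'a
    unfolding power2_norm_eq_inner
    by (subst euclidean_inner) (simp add: exp_sum sum_distrib_left power2_eq_square flip: sum_negf)
  have "(\<integral>\<^sup>+x. ennreal (exp (- c * (norm (x::'a))\<^sup>2)) \<partial>lborel)
      = (\<Prod>b\<in>(Basis :: 'a set). \<integral>\<^sup>+t. ennreal (exp (- c * t\<^sup>2)) \<partial>lborel)"
    unfolding eq prod_ennreal[OF exp_ge_zero, symmetric]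
    by (rule nn_integral_lborel_prod) auto
  also have "\<dots> < \<infinity>"
    using 1 by (simp add: power_less_top_ennreal)
  finally show ?thesis
    by (intro integrableI_bounded) auto
qed

lemma integrable_exp_linear_gaussian:
  fixes c R :: real
  assumes "c > 0"
  shows "integrable lborel (\<lambda>x::'a::euclidean_space. exp (R * norm x - c * (norm x)\<^sup>2))"
proof (rule Bochner_Integration.integrable_bound)
  show "integrable lborel (\<lambda>x::'a. exp (R\<^sup>2 / (2 * c)) * exp (- (c / 2) * (norm x)\<^sup>2))"
    using assms by (intro integrable_mult_right integrable_gaussian) auto
  have "R * t - c * t\<^sup>2 \<le> R\<^sup>2 / (2 * c) - (c / 2) * t\<^sup>2" for t
  proof -
    have "0 \<le> (R - c * t)\<^sup>2 / (2 * c)" using assms by simp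
    also have "\<dots> = R\<^sup>2 / (2 * c) - R * t + c * t\<^sup>2 / 2"
      using assms by (simp add: field_simps power2_eq_square)
    finally show ?thesis by simp
  qed
  then show "AE x::'a in lborel. norm (exp (R * norm x - c * (norm x)\<^sup>2)) \<le>
      norm (exp (R\<^sup>2 / (2 * c)) * exp (- (c / 2) * (norm x)\<^sup>2))"
    by (auto simp flip: exp_add)
qed auto

lemma lborel_translation:
  fixes f :: "'a::euclidean_space \<Rightarrow> 'b::{banach,second_countable_topology}"
  shows integrable_translation: "integrable lborel f \<Longrightarrow> integrable lborel (\<lambda>x. f (x + a))"
    and integral_translation:
      "f \<in> borel_measurable borel \<Longrightarrow> (LINT x|lborel. f (x + a)) = (LINT x|lborel. f x)"
proof -
  have d: "distr lborel borel ((+) a) = (lborel :: 'a measure)"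
    using lborel_distr_plus[of a] by simp
  show "integrable lborel f \<Longrightarrow> integrable lborel (\<lambda>x. f (x + a))"
    using integrable_distr_eq[of "(+) a" lborel borel f] d
    by (auto simp: add.commute dest: borel_measurable_integrable)
  show "f \<in> borel_measurable borel \<Longrightarrow> (LINT x|lborel. f (x + a)) = (LINT x|lborel. f x)"
    using integral_distr[of "(+) a" lborel borel f] d by (auto simp: add.commute)
qed

section \<open>Square-integrable functions\<close>

text \<open>The two square-integrability conditions in play differ only in the measure.\<close>

definition l2 :: "'a measure \<Rightarrow> ('a \<Rightarrow> complex) set"
  where "l2 M = {f \<in> borel_measurable M. integrable M (\<lambda>x. (cmod (f x))\<^sup>2)}"

definition l2_norm :: "'a measure \<Rightarrow> ('a \<Rightarrow> complex) \<Rightarrow> real"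
  where "l2_norm M f = sqrt (LINT x|M. (cmod (f x))\<^sup>2)"

lemma L2_eq_l2: "L2 = l2 lborel" "L2_norm = l2_norm lborel"
  by (auto simp: L2_def l2_def L2_norm_def l2_norm_def fun_eq_iff)

lemma l2_measurable: "f \<in> l2 M \<Longrightarrow> f \<in> borel_measurable M"
  and l2_integrable: "f \<in> l2 M \<Longrightarrow> integrable M (\<lambda>x. (cmod (f x))\<^sup>2)"
  by (auto simp: l2_def)

lemma l2_norm_nonneg: "0 \<le> l2_norm M f"
  by (simp add: l2_norm_def)

lemma l2_norm_power2: "(l2_norm M f)\<^sup>2 = (LINT x|M. (cmod (f x))\<^sup>2)"
  by (simp add: l2_norm_def)

lemma l2_bound:
  assumes "g \<in> l2 M" "f \<in> borel_measurable M" "AE x in M. cmod (f x) \<le> cmod (g x)"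
  shows "f \<in> l2 M"
  unfolding l2_def
proof (safe intro!: assms)
  have "AE x in M. (cmod (f x))\<^sup>2 \<le> (cmod (g x))\<^sup>2"
    using assms(3) by eventually_elim (auto intro: power_mono)
  then show "integrable M (\<lambda>x. (cmod (f x))\<^sup>2)"
    using assms(2) by (intro Bochner_Integration.integrable_bound[OF l2_integrable[OF assms(1)]]) auto
qed

lemma l2_cmult: "f \<in> l2 M \<Longrightarrow> (\<lambda>x. c * f x) \<in> l2 M"
  and l2_norm_cmult: "l2_norm M (\<lambda>x. c * f x) = cmod c * l2_norm M f"
  by (auto simp: l2_def l2_norm_def norm_mult power_mult_distrib real_sqrt_mult)

lemma cmod_mult_le: "cmod (a * b) \<le> ((cmod a)\<^sup>2 + (cmod b)\<^sup>2) / 2"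
  using sum_squares_bound[of "cmod a" "cmod b"] by (simp add: norm_mult)

lemma l2_mult_integrable:
  assumes "f \<in> l2 M" "g \<in> l2 M"
  shows "integrable M (\<lambda>x. f x * g x)"
proof (rule Bochner_Integration.integrable_bound)
  show "integrable M (\<lambda>x. ((cmod (f x))\<^sup>2 + (cmod (g x))\<^sup>2) / 2)"
    using assms by (intro integrable_divide Bochner_Integration.integrable_add l2_integrable)
  show "(\<lambda>x. f x * g x) \<in> borel_measurable M"
    using assms by (auto simp: l2_def)
  show "AE x in M. norm (f x * g x) \<le> norm (((cmod (f x))\<^sup>2 + (cmod (g x))\<^sup>2) / 2)"
    using cmod_mult_le by (auto simp: abs_of_nonneg)
qed

lemma l2_hoelder:
  assumes "f \<in> l2 M" "g \<in> l2 M"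
  shows "integrable M (\<lambda>x. cmod (f x) * cmod (g x))"
    and "(LINT x|M. cmod (f x) * cmod (g x)) \<le> l2_norm M f * l2_norm M g"
proof -
  have m: "f \<in> borel_measurable M" "g \<in> borel_measurable M"
    using assms by (auto simp: l2_measurable)
  show i: "integrable M (\<lambda>x. cmod (f x) * cmod (g x))"
    using integrable_norm[OF l2_mult_integrable[OF assms]] by (simp add: norm_mult)
  have "(\<integral>\<^sup>+x. ennreal (cmod (f x)) * ennreal (cmod (g x)) \<partial>M)\<^sup>2
      \<le> (\<integral>\<^sup>+x. (ennreal (cmod (f x)))\<^sup>2 \<partial>M) * (\<integral>\<^sup>+x. (ennreal (cmod (g x)))\<^sup>2 \<partial>M)"
    by (rule Cauchy_Schwarz_nn_integral) (use m in measurable)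
  also have "\<dots> = ennreal ((l2_norm M f)\<^sup>2 * (l2_norm M g)\<^sup>2)"
    using assms by (simp add: ennreal_power nn_integral_eq_integral l2_integrable l2_norm_power2
        ennreal_mult)
  also have "(\<integral>\<^sup>+x. ennreal (cmod (f x)) * ennreal (cmod (g x)) \<partial>M)
      = ennreal (LINT x|M. cmod (f x) * cmod (g x))"
    using i by (subst nn_integral_eq_integral[symmetric]) (auto simp: ennreal_mult)
  finally have "(LINT x|M. cmod (f x) * cmod (g x))\<^sup>2 \<le> (l2_norm M f * l2_norm M g)\<^sup>2"
    by (simp add: ennreal_power integral_nonneg_AE power_mult_distrib)
  then show "(LINT x|M. cmod (f x) * cmod (g x)) \<le> l2_norm M f * l2_norm M g"
    by (rule power2_le_imp_le) (simp add: l2_norm_nonneg)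
qed

lemma l2_Cauchy_Schwarz:
  assumes "f \<in> l2 M" "g \<in> l2 M"
  shows "cmod (LINT x|M. f x * g x) \<le> l2_norm M f * l2_norm M g"
  using l2_hoelder[OF assms] integral_norm_bound[of M "\<lambda>x. f x * g x"] by (simp add: norm_mult)

lemma l2_add:
  assumes "f \<in> l2 M" "g \<in> l2 M"
  shows "(\<lambda>x. f x + g x) \<in> l2 M"
    and "l2_norm M (\<lambda>x. f x + g x) \<le> l2_norm M f + l2_norm M g"
proof -
  have m: "f \<in> borel_measurable M" "g \<in> borel_measurable M"
    using assms by (auto simp: l2_measurable)
  note i = l2_hoelder(1)[OF assms]
  have i': "integrable M (\<lambda>x. (cmod (f x) + cmod (g x))\<^sup>2)"
    unfolding power2_sum using i assms
    by (intro Bochner_Integration.integrable_add) (auto simp: l2_integrable mult.assoc)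
  show fg: "(\<lambda>x. f x + g x) \<in> l2 M"
    unfolding l2_def
  proof (safe, use m in measurable)
    show "integrable M (\<lambda>x. (cmod (f x + g x))\<^sup>2)"
      using m by (intro Bochner_Integration.integrable_bound[OF i'])
        (auto intro!: AE_I2 power_mono norm_triangle_ineq)
  qed
  have "(l2_norm M (\<lambda>x. f x + g x))\<^sup>2 \<le> (LINT x|M. (cmod (f x) + cmod (g x))\<^sup>2)"
    unfolding l2_norm_power2
    by (intro integral_mono l2_integrable[OF fg] i' power_mono norm_triangle_ineq) auto
  also have "\<dots> = (l2_norm M f)\<^sup>2 + (l2_norm M g)\<^sup>2 + 2 * (LINT x|M. cmod (f x) * cmod (g x))"
    unfolding power2_sum using i assms by (simp add: l2_integrable l2_norm_power2 mult.assoc)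
  also have "\<dots> \<le> (l2_norm M f + l2_norm M g)\<^sup>2"
    using l2_hoelder(2)[OF assms] by (simp add: power2_sum)
  finally show "l2_norm M (\<lambda>x. f x + g x) \<le> l2_norm M f + l2_norm M g"
    by (rule power2_le_imp_le) (simp add: l2_norm_nonneg)
qed

lemma l2_uminus: "f \<in> l2 M \<Longrightarrow> (\<lambda>x. - f x) \<in> l2 M" "l2_norm M (\<lambda>x. - f x) = l2_norm M f"
  by (auto simp: l2_def l2_norm_def)

lemma l2_diff:
  assumes "f \<in> l2 M" "g \<in> l2 M"
  shows "(\<lambda>x. f x - g x) \<in> l2 M"
    and "l2_norm M (\<lambda>x. f x - g x) \<le> l2_norm M f + l2_norm M g"
  using l2_add[OF assms(1) l2_uminus(1)[OF assms(2)]] by (auto simp: l2_uminus)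

text \<open>Jensen's inequality for the weights \<open>2\<^sup>-\<^sup>k\<close>, whose total mass is \<open>2\<close>.\<close>

lemma weighted_sum_square_le:
  fixes a :: "nat \<Rightarrow> real"
  assumes "\<And>k. 0 \<le> a k" "summable (\<lambda>k. (1/2)^k * (a k)\<^sup>2)"
  shows "summable (\<lambda>k. (1/2)^k * a k)"
    and "(\<Sum>k. (1/2)^k * a k)\<^sup>2 \<le> 2 * (\<Sum>k. (1/2)^k * (a k)\<^sup>2)"
proof -
  have g: "summable (\<lambda>k. (1/2::real)^k)" "(\<Sum>k. (1/2::real)^k) = 2"
    using suminf_geometric[of "1/2::real"] by (auto simp: summable_geometric)
  show s: "summable (\<lambda>k. (1/2)^k * a k)"
  proof (rule summable_comparison_test')
    show "summable (\<lambda>k. (1/2)^k * (a k)\<^sup>2 + (1/2::real)^k)"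
      by (intro summable_add assms g)
    have "a k \<le> (a k)\<^sup>2 + 1" for k
      using sum_squares_bound[of "a k" 1] assms(1)[of k] by simp
    then have "(1/2)^k * a k \<le> (1/2)^k * ((a k)\<^sup>2 + 1)" for k
      by (intro mult_left_mono) auto
    then show "norm ((1/2)^k * a k) \<le> (1/2)^k * (a k)\<^sup>2 + (1/2)^k" for k
      using assms(1)[of k] by (simp add: algebra_simps)
  qed
  let ?S = "\<Sum>k. (1/2)^k * a k"
  \<comment> \<open>\<open>2 S a - S\<^sup>2 / 2 \<le> 2 a\<^sup>2\<close>, summed against weights of total mass 2\<close>
  have "(\<lambda>k. 2 * ?S * ((1/2)^k * a k) - ?S\<^sup>2 / 2 * (1/2)^k) sums (2 * ?S * ?S - ?S\<^sup>2 / 2 * 2)"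
    using s g by (intro sums_diff sums_mult) (auto simp: sums_iff)
  then have "2 * ?S * ?S - ?S\<^sup>2 / 2 * 2 = (\<Sum>k. 2 * ?S * ((1/2)^k * a k) - ?S\<^sup>2 / 2 * (1/2)^k)"
    by (simp add: sums_iff)
  also have "\<dots> \<le> (\<Sum>k. 2 * ((1/2)^k * (a k)\<^sup>2))"
  proof (intro suminf_le summable_mult summable_diff s g assms)
    fix k
    have "2 * ?S * a k - ?S\<^sup>2 / 2 \<le> 2 * (a k)\<^sup>2"
      using zero_le_power2[of "?S - 2 * a k"] by (simp add: power2_diff)
    then have "(1/2)^k * (2 * ?S * a k - ?S\<^sup>2 / 2) \<le> (1/2)^k * (2 * (a k)\<^sup>2)"
      by (intro mult_left_mono) auto
    then show "2 * ?S * ((1/2)^k * a k) - ?S\<^sup>2 / 2 * (1/2)^k \<le> 2 * ((1/2)^k * (a k)\<^sup>2)"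
      by (simp add: algebra_simps)
  qed
  also have "\<dots> = 2 * (\<Sum>k. (1/2)^k * (a k)\<^sup>2)"
    using assms by (simp add: suminf_mult)
  finally show "?S\<^sup>2 \<le> 2 * (\<Sum>k. (1/2)^k * (a k)\<^sup>2)"
    by (simp add: power2_eq_square)
qed

text \<open>
  The geometric weights replace completeness of \<open>L\<^sup>2\<close>: the square of the pointwise sum is dominated
  by twice the weighted sum of the squares, which is integrable by monotone convergence. The sum is
  characterised through its pairings, which is the form in which transforms and weak derivatives
  are expressed.
\<close>

lemma l2_weighted_series:
  assumes v: "\<And>k. v k \<in> l2 M" and C: "\<And>k. l2_norm M (v k) \<le> C"
  obtains f where "f \<in> l2 M" "l2_norm M f \<le> 2 * C"
    "\<And>h. h \<in> l2 M \<Longrightarrow> (\<lambda>k. (1/2)^k * (LINT x|M. v k x * h x)) sums (LINT x|M. f x * h x)"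
proof -
  define f where "f x = (\<Sum>k. (1/2)^k * v k x)" for x
  have [measurable]: "v k \<in> borel_measurable M" for k
    using v by (rule l2_measurable)
  have C0: "0 \<le> C"
    using C[of 0] l2_norm_nonneg[of M "v 0"] by linarith
  have g: "summable (\<lambda>k. (1/2::real)^k)" "(\<Sum>k. (1/2::real)^k) = 2"
    using suminf_geometric[of "1/2::real"] by (auto simp: summable_geometric)
  define q where "q k x = (1/2)^k * (cmod (v k x))\<^sup>2" for k x
  have qi: "integrable M (q k)" for k
    unfolding q_def by (intro integrable_mult_right l2_integrable v)
  have qI: "(LINT x|M. q k x) \<le> (1/2)^k * C\<^sup>2" for k
    using C[of k] unfolding q_def
    by (auto simp flip: l2_norm_power2 intro!: mult_left_mono power_mono l2_norm_nonneg)
  have "(\<integral>\<^sup>+x. (\<Sum>k. ennreal (q k x)) \<partial>M) = (\<Sum>k. \<integral>\<^sup>+x. ennreal (q k x) \<partial>M)"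
    by (intro nn_integral_suminf) (auto simp: q_def)
  also have "\<dots> = (\<Sum>k. ennreal (LINT x|M. q k x))"
    by (intro suminf_cong nn_integral_eq_integral qi) (auto simp: q_def)
  also have "\<dots> \<le> (\<Sum>k. ennreal ((1/2)^k * C\<^sup>2))"
    by (intro suminf_le ennreal_leI qI) auto
  also have "\<dots> = ennreal (\<Sum>k. (1/2)^k * C\<^sup>2)"
    by (intro suminf_ennreal2 summable_mult2 g) auto
  also have "(\<Sum>k. (1/2)^k * C\<^sup>2) = 2 * C\<^sup>2"
    using g by (simp flip: suminf_mult2)
  finally have Q: "(\<integral>\<^sup>+x. (\<Sum>k. ennreal (q k x)) \<partial>M) \<le> ennreal (2 * C\<^sup>2)" .
  have "AE x in M. (\<Sum>k. ennreal (q k x)) \<noteq> \<infinity>"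
    by (intro nn_integral_PInf_AE) (use Q in \<open>auto simp: q_def top_unique\<close>)
  then have s: "AE x in M. summable (\<lambda>k. q k x)"
    by eventually_elim (auto intro!: summable_suminf_not_top simp: q_def)
  have fq: "AE x in M. (cmod (f x))\<^sup>2 \<le> 2 * (\<Sum>k. q k x) \<and> summable (\<lambda>k. (1/2)^k * cmod (v k x))"
    using s
  proof eventually_elim
    case (elim x)
    note w = weighted_sum_square_le[of "\<lambda>k. cmod (v k x)", OF _ elim[unfolded q_def]]
    have "cmod (f x) \<le> (\<Sum>k. cmod ((1/2)^k * v k x))"
      unfolding f_def using w(1) by (intro summable_norm) (auto simp: norm_mult norm_power)
    then have "(cmod (f x))\<^sup>2 \<le> (\<Sum>k. (1/2)^k * cmod (v k x))\<^sup>2"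
      by (intro power_mono) (auto simp: norm_mult norm_power)
    then show ?case
      using w by (auto simp: q_def)
  qed
  have qn: "(\<lambda>x. \<Sum>k. q k x) \<in> borel_measurable M"
    unfolding q_def by measurable
  have Qe: "AE x in M. (\<Sum>k. ennreal (q k x)) = ennreal (\<Sum>k. q k x) \<and> 0 \<le> (\<Sum>k. q k x)"
    using s by eventually_elim (auto intro!: suminf_ennreal2 suminf_nonneg simp: q_def)
  have QQ: "(\<integral>\<^sup>+x. ennreal (\<Sum>k. q k x) \<partial>M) \<le> ennreal (2 * C\<^sup>2)"
    using Q Qe by (subst nn_integral_cong_AE[of _ "\<lambda>x. \<Sum>k. ennreal (q k x)"]) (auto elim: eventually_mono)
  have Qi: "integrable M (\<lambda>x. \<Sum>k. q k x)"
    using Qe qn QQ by (intro integrableI_nonneg) (auto simp: less_top[symmetric] top_unique elim: eventually_mono)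
  have Qb: "(LINT x|M. (\<Sum>k. q k x)) \<le> 2 * C\<^sup>2"
    using Qe QQ by (subst (asm) nn_integral_eq_integral[OF Qi]) (auto elim: eventually_mono simp: C0)
  have fm: "f \<in> borel_measurable M"
    unfolding f_def by measurable
  have fi: "integrable M (\<lambda>x. (cmod (f x))\<^sup>2)"
  proof (rule Bochner_Integration.integrable_bound)
    show "integrable M (\<lambda>x. 2 * (\<Sum>k. q k x))"
      using Qi by simp
    show "AE x in M. norm ((cmod (f x))\<^sup>2) \<le> norm (2 * (\<Sum>k. q k x))"
      using fq by eventually_elim (auto intro: order_trans[OF _ abs_ge_self])
  qed (use fm in measurable)
  show thesis
  proof
    show f: "f \<in> l2 M"
      using fm fi by (simp add: l2_def)
    have "(l2_norm M f)\<^sup>2 \<le> (LINT x|M. 2 * (\<Sum>k. q k x))"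
      unfolding l2_norm_power2 using fq Qi fi
      by (intro integral_mono_AE) (auto elim: eventually_mono)
    also have "\<dots> \<le> (2 * C)\<^sup>2"
      using Qb by (simp add: power2_eq_square)
    finally show "l2_norm M f \<le> 2 * C"
      by (rule power2_le_imp_le) (use C0 in simp)
    fix h assume h: "h \<in> l2 M"
    have "(\<lambda>k. LINT x|M. (1/2)^k * v k x * h x) sums (LINT x|M. (\<Sum>k. (1/2)^k * v k x * h x))"
    proof (rule sums_integral)
      show "integrable M (\<lambda>x. (1/2)^k * v k x * h x)" for k
        unfolding mult.assoc by (intro integrable_mult_right l2_mult_integrable v h)
      show "AE x in M. summable (\<lambda>k. cmod ((1/2)^k * v k x * h x))"
        using fq by eventually_elim (auto simp: norm_mult norm_power intro: summable_mult2)
      show "summable (\<lambda>k. LINT x|M. cmod ((1/2)^k * v k x * h x))"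
      proof (rule summable_comparison_test')
        show "summable (\<lambda>k. (1/2)^k * (C * l2_norm M h))"
          by (intro summable_mult2 g)
        fix k
        have "(LINT x|M. cmod ((1/2)^k * v k x * h x)) = (1/2)^k * (LINT x|M. cmod (v k x) * cmod (h x))"
          by (simp add: norm_mult norm_power mult.assoc)
        also have "\<dots> \<le> (1/2)^k * (C * l2_norm M h)"
          by (intro mult_left_mono order_trans[OF l2_hoelder(2)[OF v h]] mult_right_mono C l2_norm_nonneg) auto
        finally show "norm (LINT x|M. cmod ((1/2)^k * v k x * h x)) \<le> (1/2)^k * (C * l2_norm M h)"
          by (simp add: integral_nonneg_AE)
      qed
    qed
    moreover have "(LINT x|M. (\<Sum>k. (1/2)^k * v k x * h x)) = (LINT x|M. f x * h x)"
    proof (rule integral_cong_AE)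
      show "AE x in M. (\<Sum>k. (1/2)^k * v k x * h x) = f x * h x"
        using fq
      proof eventually_elim
        case (elim x)
        then have "summable (\<lambda>k. (1/2)^k * v k x)"
          by (auto intro!: summable_norm_cancel[of "\<lambda>k. (1/2)^k * v k x"] simp: norm_mult norm_power)
        then show ?case
          by (simp add: f_def suminf_mult2)
      qed
    qed (use fm l2_measurable[OF h] in measurable)
    ultimately show "(\<lambda>k. (1/2)^k * (LINT x|M. v k x * h x)) sums (LINT x|M. f x * h x)"
      by (simp add: mult.assoc)
  qed
qed

section \<open>Measure-preserving motions\<close>

text \<open>
  Up to a null set, an open set is a disjoint union of balls, and an isometry moves balls to balls
  of the same radius; hence it does not decrease the measure of open sets. The same holds for its
  inverse.
\<close>

lemma emeasure_orthogonal_image_ge: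
  fixes S :: "'a::euclidean_space \<Rightarrow> 'a"
  assumes S: "orthogonal_transformation S" and U: "open U"
  shows "emeasure lborel U \<le> emeasure lborel (S ` U)"
proof -
  define K where "K = {(a, r). 0 < r \<and> ball a r \<subseteq> U}"
  have K: "\<exists>i. i \<in> K \<and> x \<in> ball (fst i) (snd i) \<and> snd i < d" if "x \<in> U" "0 < d" for x d
  proof -
    obtain e where e: "0 < e" "ball x e \<subseteq> U"
      using U \<open>x \<in> U\<close> open_contains_ball by blast
    then have "(x, min e (d/2)) \<in> K"
      using that by (auto simp: K_def)
    moreover have "x \<in> ball x (min e (d/2))" "min e (d/2) < d"
      using that e by auto
    ultimately show ?thesis
      by (metis fst_conv snd_conv)
  qed
  obtain C where C: "countable C" "C \<subseteq> K"
    "pairwise (\<lambda>i j. disjnt (ball (fst i) (snd i)) (ball (fst j) (snd j))) C"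
    "negligible (U - (\<Union>i\<in>C. ball (fst i) (snd i)))"
    by (rule Vitali_covering_theorem_balls[of U K fst snd]) (use K in blast)+
  let ?B = "\<lambda>i. ball (fst i) (snd i)"
  have disj: "disjoint_family_on ?B C"
    using C(3) by (auto simp: disjoint_family_on_def pairwise_def disjnt_def)
  have inj: "inj S"
    by (rule orthogonal_transformation_inj[OF S])
  have disj': "disjoint_family_on (\<lambda>i. S ` ?B i) C"
    using disj unfolding disjoint_family_on_def by (metis image_Int[OF inj] image_empty)
  have img: "S ` ?B i = ball (S (fst i)) (snd i)" for i
    by (rule image_orthogonal_transformation_ball[OF S])
  have sub: "(\<Union>i\<in>C. ?B i) \<subseteq> U"
    using C(2) by (fastforce simp: K_def)
  have null: "emeasure lborel (U - (\<Union>i\<in>C. ?B i)) = 0"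
  proof -
    have "U - (\<Union>i\<in>C. ?B i) \<in> sets borel"
      using U by (intro sets.Diff sets.countable_UN'' C(1)) auto
    with C(4) show ?thesis
      by (simp add: negligible_iff_null_sets null_sets_completion_iff null_sets_def)
  qed
  have meas: "?B i \<in> sets lborel" for i by simp
  have "emeasure lborel U = emeasure lborel ((\<Union>i\<in>C. ?B i) \<union> (U - (\<Union>i\<in>C. ?B i)))"
    using sub by (intro arg_cong[where f="emeasure lborel"]) auto
  also have "\<dots> = emeasure lborel (\<Union>i\<in>C. ?B i)"
    using U C(1) null by (subst emeasure_Un_null_set) (auto simp: null_sets_def intro!: sets.countable_UN'')
  also have "\<dots> = (\<integral>\<^sup>+i. emeasure lborel (?B i) \<partial>count_space C)"
    by (rule emeasure_UN_countable[OF _ C(1) disj]) simp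
  also have "\<dots> = (\<integral>\<^sup>+i. emeasure lborel (S ` ?B i) \<partial>count_space C)"
    using C(2) by (intro nn_integral_cong) (auto simp: img emeasure_ball K_def)
  also have "\<dots> = emeasure lborel (\<Union>i\<in>C. S ` ?B i)"
    by (rule emeasure_UN_countable[symmetric, OF _ C(1) disj']) (simp add: img)
  also have "\<dots> \<le> emeasure lborel (S ` U)"
  proof (rule emeasure_mono)
    show "(\<Union>i\<in>C. S ` ?B i) \<subseteq> S ` U" using sub by blast
    have "open (S ` U)"
      using S U by (intro open_surjective_linear_image orthogonal_transformation_linear
          orthogonal_transformation_surj) auto
    then show "S ` U \<in> sets lborel" by simp
  qed
  finally show ?thesis .
qed

lemma lborel_distr_orthogonal:
  fixes T :: "'a::euclidean_space \<Rightarrow> 'a"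
  assumes T: "orthogonal_transformation T"
  shows "distr lborel borel T = lborel"
proof (rule lborel_eqI[symmetric])
  have lin: "linear T"
    by (rule orthogonal_transformation_linear[OF T])
  have [measurable]: "T \<in> borel_measurable borel"
    by (intro borel_measurable_continuous_onI linear_continuous_on linear_conv_bounded_linear[THEN iffD1] lin)
  fix l u :: 'a assume lu: "\<And>b. b \<in> Basis \<Longrightarrow> l \<bullet> b \<le> u \<bullet> b"
  have bij: "bij T"
    by (rule orthogonal_transformation_bij[OF T])
  have T': "orthogonal_transformation (inv T)"
    by (rule orthogonal_transformation_inv[OF T])
  have op: "open (T -` box l u)"
    using continuous_open_vimage[OF open_box, of T l u] lin
    by (auto intro: linear_continuous_at simp: linear_conv_bounded_linear)
  have vi: "T -` box l u = inv T ` box l u"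
    using bij by (simp add: bij_vimage_eq_inv_image)
  have "emeasure lborel (T -` box l u) \<le> emeasure lborel (T ` (T -` box l u))"
    by (rule emeasure_orthogonal_image_ge[OF T op])
  also have "T ` (T -` box l u) = box l u"
    using bij by (simp add: bij_is_surj surj_image_vimage_eq)
  finally have "emeasure lborel (T -` box l u) = emeasure lborel (box l u)"
    using emeasure_orthogonal_image_ge[OF T' open_box, of l u] vi by (simp add: order_antisym)
  then show "emeasure (distr lborel borel T) (box l u) = (\<Prod>b\<in>Basis. (u - l) \<bullet> b)"
    using lu by (simp add: emeasure_distr emeasure_lborel_box_eq)
qed simp

text \<open>
  Averages over a one-parameter family of measure-preserving maps; the maps will be translations
  along a line or rotations of the phase.
\<close>

lemma integrable_orbit:
  fixes u :: "'a::euclidean_space \<Rightarrow> 'b::{banach,second_countable_topology}"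
  assumes u: "integrable lborel u"
    and T: "\<And>s::real. distr lborel borel (T s) = lborel"
    and m: "(\<lambda>p. T (fst p) (snd p)) \<in> borel_measurable borel"
  shows "integrable (lborel \<Otimes>\<^sub>M lborel) (\<lambda>(s, x). indicator {a..b} s *\<^sub>R u (T s x))"
proof -
  have u_m[measurable]: "u \<in> borel_measurable borel"
    using u by (simp add: borel_measurable_integrable)
  have m'[measurable]: "(\<lambda>p. T (fst p) (snd p)) \<in> borel_measurable (lborel \<Otimes>\<^sub>M lborel)"
    using m by (simp add: lborel_prod)
  have Tm[measurable]: "T s \<in> borel_measurable borel" for s
    using measurable_compose[OF _ m, of "\<lambda>x. (s, x)" borel] by simp
  have i: "integrable lborel (\<lambda>x. u (T s x))" for s
    using integrable_distr_eq[of "T s" lborel borel u] T[of s] u by simp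
  have n: "(LINT x|lborel. norm (u (T s x))) = (LINT x|lborel. norm (u x))" for s
    using integral_distr[of "T s" lborel borel "\<lambda>x. norm (u x)"] T[of s] by simp
  show ?thesis
  proof (rule lborel_pair.Fubini_integrable)
    show "(\<lambda>(s, x). indicator {a..b} s *\<^sub>R u (T s x)) \<in> borel_measurable (lborel \<Otimes>\<^sub>M lborel)"
      using measurable_compose[OF m' u_m] by (auto simp: case_prod_beta)
    show "integrable lborel (\<lambda>s. LINT y|lborel. norm (case (s, y) of (s, x) \<Rightarrow> indicator {a..b} s *\<^sub>R u (T s x)))"
      by (simp add: n integrable_indicator_iff emeasure_lborel_Icc_eq)
    show "AE s in lborel. integrable lborel (\<lambda>y. case (s, y) of (s, x) \<Rightarrow> indicator {a..b} s *\<^sub>R u (T s x))"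
      using i by (auto intro!: AE_I2 integrable_scaleR_right)
  qed
qed

lemma integral_orbit:
  fixes u :: "'a::euclidean_space \<Rightarrow> 'b::{banach,second_countable_topology}"
  assumes u: "integrable lborel u"
    and T: "\<And>s::real. distr lborel borel (T s) = lborel"
    and m: "(\<lambda>p. T (fst p) (snd p)) \<in> borel_measurable borel"
    and ab: "a \<le> b"
  shows "(LINT x|lborel. (LINT s|lborel. indicator {a..b} s *\<^sub>R u (T s x))) = (b - a) *\<^sub>R (LINT x|lborel. u x)"
proof -
  have [measurable]: "u \<in> borel_measurable borel"
    using u by (simp add: borel_measurable_integrable)
  have [measurable]: "T s \<in> borel_measurable borel" for s
    using measurable_compose[OF _ m, of "\<lambda>x. (s, x)" borel] by simp
  have n: "(LINT x|lborel. u (T s x)) = (LINT x|lborel. u x)" for s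
    using integral_distr[of "T s" lborel borel u] T[of s] by simp
  have "(LINT x|lborel. (LINT s|lborel. indicator {a..b} s *\<^sub>R u (T s x)))
      = (LINT s|lborel. (LINT x|lborel. indicator {a..b} s *\<^sub>R u (T s x)))"
    by (rule lborel_pair.Fubini_integral[OF integrable_orbit[OF u T m]])
  also have "\<dots> = (LINT s|lborel. indicator {a..b} s *\<^sub>R (LINT x|lborel. u x))"
    by (simp add: n)
  also have "\<dots> = (b - a) *\<^sub>R (LINT x|lborel. u x)"
    using ab by simp
  finally show ?thesis .
qed

lemma translation_orbit:
  fixes e :: "'a::euclidean_space"
  shows "distr lborel borel (\<lambda>x. x + s *\<^sub>R e) = lborel"
    and "(\<lambda>p. snd p + fst p *\<^sub>R e) \<in> borel_measurable borel"
proof -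
  show "distr lborel borel (\<lambda>x. x + s *\<^sub>R e) = lborel"
    using lborel_distr_plus[of "s *\<^sub>R e"] by (simp add: add.commute[of _ "s *\<^sub>R e"])
  show "(\<lambda>p. snd p + fst p *\<^sub>R e) \<in> borel_measurable borel"
    by (intro borel_measurable_continuous_onI continuous_intros)
qed

text \<open>
  The integral of \<open>f'\<close> equals that of its mean over the translates by \<open>s e\<close>, \<open>0 \<le> s \<le> 1\<close>. This mean is
  \<open>f (x + e) - f x\<close>, the two terms of which have the same integral.
\<close>

lemma integral_directional_derivative_eq_0:
  fixes f f' :: "'a::euclidean_space \<Rightarrow> real"
  assumes f: "integrable lborel f" and f': "integrable lborel f'" "continuous_on UNIV f'"
    and d: "\<And>x. ((\<lambda>s. f (x + s *\<^sub>R e)) has_real_derivative f' x) (at 0)"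
  shows "(LINT x|lborel. f' x) = 0"
proof -
  have d': "((\<lambda>s. f (x + s *\<^sub>R e)) has_real_derivative f' (x + t *\<^sub>R e)) (at t)" for x t
    using d[of "x + t *\<^sub>R e"] DERIV_shift[of "\<lambda>s. f (x + s *\<^sub>R e)" "f' (x + t *\<^sub>R e)" 0 t]
    by (simp add: algebra_simps)
  have ftc: "(LINT s|lborel. indicator {0..1} s *\<^sub>R f' (x + s *\<^sub>R e)) = f (x + e) - f x" for x
  proof -
    have "(LINT s|lborel. indicator {0..1} s *\<^sub>R f' (x + s *\<^sub>R e)) = f (x + 1 *\<^sub>R e) - f (x + 0 *\<^sub>R e)"
      using d' by (intro integral_FTC_atLeastAtMost continuous_on_compose2[OF f'(2)] continuous_intros)
        (auto simp flip: has_real_derivative_iff_has_vector_derivative intro: DERIV_subset)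
    then show ?thesis by simp
  qed
  have "(LINT x|lborel. f' x) = (LINT x|lborel. (LINT s|lborel. indicator {0..1} s *\<^sub>R f' (x + s *\<^sub>R e)))"
    using integral_orbit[OF f'(1) translation_orbit, of 0 1 e] by simp
  also have "\<dots> = (LINT x|lborel. f (x + e)) - (LINT x|lborel. f x)"
    unfolding ftc by (intro Bochner_Integration.integral_diff integrable_translation f)
  also have "\<dots> = 0"
    using integral_translation[of f e] f by (simp add: borel_measurable_integrable)
  finally show ?thesis .
qed

text \<open>
  The measures with densities \<open>u\<^sup>+\<close> and \<open>u\<^sup>-\<close> agree on boxes, which form a generator stable under
  intersections, so they are equal, and therefore so are their densities.
\<close>

lemma AE_eq_0_if_box_integrals_eq_0_real:
  fixes u :: "'a::euclidean_space \<Rightarrow> real"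
  assumes [measurable]: "u \<in> borel_measurable borel"
    and i: "\<And>a b. integrable lborel (\<lambda>x. indicator (box a b) x * u x)"
    and z: "\<And>a b. (LINT x|lborel. indicator (box a b) x * u x) = 0"
  shows "AE x in lborel. u x = 0"
proof -
  let ?P = "density lborel (\<lambda>x. ennreal (u x))" and ?N = "density lborel (\<lambda>x. ennreal (- u x))"
  have P: "emeasure ?P (box a b) = (\<integral>\<^sup>+x. ennreal (indicator (box a b) x * u x) \<partial>lborel)" for a b
    by (simp add: emeasure_density, intro nn_integral_cong) (auto simp: indicator_def)
  have N: "emeasure ?N (box a b) = (\<integral>\<^sup>+x. ennreal (- (indicator (box a b) x * u x)) \<partial>lborel)" for a b
    by (simp add: emeasure_density, intro nn_integral_cong) (auto simp: indicator_def)
  have fin: "emeasure ?P (box a b) \<noteq> \<infinity>" "emeasure ?N (box a b) \<noteq> \<infinity>" for a b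
    using i[of a b] unfolding P N real_integrable_def by auto
  have eq: "emeasure ?P (box a b) = emeasure ?N (box a b)" for a b
    using real_lebesgue_integral_def[OF i[of a b]] z[of a b] fin[of a b]
    unfolding P[symmetric] N[symmetric] by (metis diff_eq_diff_eq cancel_comm_monoid_add_class.diff_cancel ennreal_enn2real less_top infinity_ennreal_def)
  have "?P = ?N"
  proof (rule measure_eqI_generator_eq)
    let ?E = "range (\<lambda>(a, b). box a b::'a set)"
    show "Int_stable ?E"
      by (auto simp: Int_stable_def box_Int_box)
    show "?E \<subseteq> Pow UNIV" "sets ?P = sigma_sets UNIV ?E" "sets ?N = sigma_sets UNIV ?E"
      by (simp_all add: borel_eq_box)
    let ?A = "\<lambda>n::nat. box (- (real n *\<^sub>R One)) (real n *\<^sub>R One) :: 'a set"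
    show "range ?A \<subseteq> ?E" "(\<Union>i. ?A i) = UNIV"
      unfolding UN_box_eq_UNIV by auto
    show "emeasure ?P (?A i) \<noteq> \<infinity>" for i by (rule fin)
    show "emeasure ?P X = emeasure ?N X" if "X \<in> ?E" for X
      using that eq by auto
  qed
  then have "AE x in lborel. ennreal (u x) = ennreal (- u x)"
    by (intro sigma_finite_measure.density_unique[OF lborel.sigma_finite_measure_axioms]) auto
  then show ?thesis
  proof eventually_elim
    case (elim x)
    then show ?case
      by (cases "0 \<le> u x") (auto simp: ennreal_neg)
  qed
qed

lemma AE_eq_0_if_box_integrals_eq_0:
  fixes g :: "'a::euclidean_space \<Rightarrow> complex"
  assumes [measurable]: "g \<in> borel_measurable borel"
    and i: "\<And>a b. integrable lborel (\<lambda>x. indicator (box a b) x * g x)"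
    and z: "\<And>a b. (LINT x|lborel. indicator (box a b) x * g x) = 0"
  shows "AE x in lborel. g x = 0"
proof -
  have re: "Re (indicator S x * g x) = indicator S x * Re (g x)"
    and im: "Im (indicator S x * g x) = indicator S x * Im (g x)" for S x
    by (auto simp: indicator_def)
  have "AE x in lborel. Re (g x) = 0"
  proof (rule AE_eq_0_if_box_integrals_eq_0_real)
    show "integrable lborel (\<lambda>x. indicator (box a b) x * Re (g x))" for a b
      using integrable_Re[OF i[of a b]] unfolding re .
    show "(LINT x|lborel. indicator (box a b) x * Re (g x)) = 0" for a b
      using integral_Re[OF i[of a b]] z[of a b] unfolding re by simp
  qed simp
  moreover have "AE x in lborel. Im (g x) = 0"
  proof (rule AE_eq_0_if_box_integrals_eq_0_real)
    show "integrable lborel (\<lambda>x. indicator (box a b) x * Im (g x))" for a b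
      using integrable_Im[OF i[of a b]] unfolding im .
    show "(LINT x|lborel. indicator (box a b) x * Im (g x)) = 0" for a b
      using integral_Im[OF i[of a b]] z[of a b] unfolding im by simp
  qed simp
  ultimately show ?thesis
    by eventually_elim (auto simp: complex_eq_iff)
qed

section \<open>Smooth compactly supported functions\<close>

subsection \<open>One variable\<close>

fun differentiable_times :: "nat \<Rightarrow> (real \<Rightarrow> real) \<Rightarrow> bool" where
  "differentiable_times 0 u \<longleftrightarrow> True"
| "differentiable_times (Suc n) u \<longleftrightarrow>
    (\<exists>u'. (\<forall>t. (u has_real_derivative u' t) (at t)) \<and> differentiable_times n u')"

definition smooth :: "(real \<Rightarrow> real) \<Rightarrow> bool"
  where "smooth u \<longleftrightarrow> (\<forall>n. differentiable_times n u)"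

lemma smooth_derivative:
  assumes "smooth u"
  obtains u' where "\<And>t. (u has_real_derivative u' t) (at t)" "smooth u'"
proof -
  have ex: "\<exists>u'. (\<forall>t. (u has_real_derivative u' t) (at t)) \<and> differentiable_times n u'" for n
    using assms by (metis differentiable_times.simps(2) smooth_def)
  obtain u' where u': "\<And>t. (u has_real_derivative u' t) (at t)"
    using ex by blast
  have "smooth u'"
    unfolding smooth_def
  proof
    fix n
    obtain v where v: "\<And>t. (u has_real_derivative v t) (at t)" "differentiable_times n v"
      using ex[of n] by blast
    then have "v = u'"
      using u' by (auto intro: DERIV_unique)
    with v show "differentiable_times n u'" by simp
  qed
  with u' show thesis by (rule that)
qed

lemma differentiable_times_mono: "differentiable_times (Suc n) u \<Longrightarrow> differentiable_times n u"
proof (induction n arbitrary: u)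
  case (Suc n)
  then show ?case
    by (metis differentiable_times.simps(2))
qed simp

lemma differentiable_times_add:
  "differentiable_times n u \<Longrightarrow> differentiable_times n v \<Longrightarrow> differentiable_times n (\<lambda>t. u t + v t)"
proof (induction n arbitrary: u v)
  case (Suc n)
  then obtain u' v' where *: "\<And>t. (u has_real_derivative u' t) (at t)" "differentiable_times n u'"
    "\<And>t. (v has_real_derivative v' t) (at t)" "differentiable_times n v'"
    by auto
  then have "differentiable_times n (\<lambda>t. u' t + v' t)"
    by (intro Suc.IH)
  with * show ?case
    by (auto intro!: exI[of _ "\<lambda>t. u' t + v' t"] derivative_intros)
qed simp

lemma differentiable_times_mult:
  "differentiable_times n u \<Longrightarrow> differentiable_times n v \<Longrightarrow> differentiable_times n (\<lambda>t. u t * v t)"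
proof (induction n arbitrary: u v)
  case (Suc n)
  then obtain u' v' where *: "\<And>t. (u has_real_derivative u' t) (at t)" "differentiable_times n u'"
    "\<And>t. (v has_real_derivative v' t) (at t)" "differentiable_times n v'"
    by auto
  have "differentiable_times n u" "differentiable_times n v"
    using Suc.prems by (auto simp only: differentiable_times_mono)
  then have "differentiable_times n (\<lambda>t. u' t * v t + v' t * u t)"
    using differentiable_times_add[OF Suc.IH[OF *(2)] Suc.IH[OF *(4)]] by blast
  with * show ?case
    by (auto intro!: exI[of _ "\<lambda>t. u' t * v t + v' t * u t"] DERIV_mult)
qed simp

lemma differentiable_times_affine:
  "differentiable_times n u \<Longrightarrow> differentiable_times n (\<lambda>t. c * u (a * t + b))"
proof (induction n arbitrary: u c)
  case (Suc n)
  then obtain u' where *: "\<And>t. (u has_real_derivative u' t) (at t)" "differentiable_times n u'"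
    by auto
  then have "differentiable_times n (\<lambda>t. (c * a) * u' (a * t + b))"
    by (intro Suc.IH)
  moreover have "((\<lambda>t. c * u (a * t + b)) has_real_derivative (c * a) * u' (a * t + b)) (at t)" for t
  proof -
    have "((\<lambda>t. a * t + b) has_real_derivative a) (at t)"
      by (auto intro!: derivative_eq_intros)
    then have "((\<lambda>t. u (a * t + b)) has_real_derivative u' (a * t + b) * a) (at t)"
      by (rule DERIV_chain2[where g="\<lambda>t. a * t + b", OF *(1)])
    then show ?thesis
      by (rule DERIV_cmult[THEN DERIV_cong]) simp
  qed
  ultimately show ?case
    by (auto intro!: exI[of _ "\<lambda>t. (c * a) * u' (a * t + b)"])
qed simp

lemma smooth_mult: "smooth u \<Longrightarrow> smooth v \<Longrightarrow> smooth (\<lambda>t. u t * v t)"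
  and smooth_affine: "smooth u \<Longrightarrow> smooth (\<lambda>t. u (a * t + b))"
  using differentiable_times_affine[where c=1] by (auto simp: smooth_def differentiable_times_mult)

text \<open>
  The polynomial factor makes the family closed under differentiation: with \<open>y = 1/t\<close>, the
  derivative of \<open>p y * exp (- y)\<close> is \<open>(p y - p' y) * y\<^sup>2 * exp (- y)\<close>.
\<close>

definition flat_at_0 :: "real poly \<Rightarrow> real \<Rightarrow> real"
  where "flat_at_0 p t = (if 0 < t then poly p (1 / t) * exp (- 1 / t) else 0)"

lemma tendsto_poly_times_exp: "((\<lambda>y. poly p y * exp (- y)) \<longlongrightarrow> (0::real)) at_top"
proof -
  have "((\<lambda>y. \<Sum>i\<le>degree p. coeff p i * (y ^ i / exp y)) \<longlongrightarrow> (\<Sum>i\<le>degree p. coeff p i * (0::real))) at_top"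
    by (intro tendsto_intros tendsto_power_div_exp_0)
  then show ?thesis
    by (simp add: poly_altdef exp_minus sum_distrib_right divide_inverse mult.assoc)
qed

lemma flat_at_0_derivative:
  "(flat_at_0 p has_real_derivative flat_at_0 ((p - pderiv p) * monom 1 2) t) (at t)"
proof (cases t "0::real" rule: linorder_cases)
  case less
  have "((\<lambda>_. 0) has_real_derivative 0) (at t)" by simp
  then have "(flat_at_0 p has_real_derivative 0) (at t)"
    by (rule has_field_derivative_transform_within_open[where S="{..<0}"])
      (use less in \<open>auto simp: flat_at_0_def\<close>)
  then show ?thesis using less by (simp add: flat_at_0_def)
next
  case greater
  have "((\<lambda>t. poly p (1 / t) * exp (- 1 / t)) has_real_derivative
      poly ((p - pderiv p) * monom 1 2) (1 / t) * exp (- 1 / t)) (at t)"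
    using greater
    by (auto intro!: derivative_eq_intros DERIV_chain2[OF poly_DERIV] simp: poly_monom field_simps power2_eq_square)
  then have "(flat_at_0 p has_real_derivative
      poly ((p - pderiv p) * monom 1 2) (1 / t) * exp (- 1 / t)) (at t)"
    by (rule has_field_derivative_transform_within_open[where S="{0<..}"])
      (use greater in \<open>auto simp: flat_at_0_def\<close>)
  then show ?thesis using greater by (simp add: flat_at_0_def)
next
  case equal
  have "((\<lambda>y. flat_at_0 p y / y) \<longlongrightarrow> 0) (at 0)"
    unfolding filterlim_at_split
  proof
    show "((\<lambda>y. flat_at_0 p y / y) \<longlongrightarrow> 0) (at_left 0)"
      by (rule tendsto_eventually) (auto simp: eventually_at_filter flat_at_0_def)
    have "((\<lambda>y. poly (pCons 0 p) (inverse y) * exp (- inverse y)) \<longlongrightarrow> 0) (at_right (0::real))"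
      by (rule filterlim_compose[OF tendsto_poly_times_exp filterlim_inverse_at_top_right])
    then show "((\<lambda>y. flat_at_0 p y / y) \<longlongrightarrow> 0) (at_right 0)"
      by (rule Lim_transform_eventually)
        (auto simp: eventually_at_filter flat_at_0_def field_simps)
  qed
  then show ?thesis
    using equal by (simp add: has_field_derivative_iff flat_at_0_def)
qed

lemma smooth_flat_at_0: "smooth (flat_at_0 p)"
proof -
  have "differentiable_times n (flat_at_0 p)" for n
    by (induction n arbitrary: p) (auto intro: flat_at_0_derivative)
  then show ?thesis by (simp add: smooth_def)
qed

subsection \<open>Test functions\<close>

lemma test_functions_iff:
  "\<phi> \<in> test_functions \<longleftrightarrow>
    (\<forall>is x. foldr real_partial is \<phi> differentiable at x) \<and> bounded {x. \<phi> x \<noteq> 0}"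
  by (auto simp: test_functions_def compact_closure)

lemma has_vector_derivative_real_partial:
  assumes "\<And>x. \<phi> differentiable at x"
  shows "((\<lambda>t. \<phi> (x + t *\<^sub>R axis i 1)) has_vector_derivative real_partial i \<phi> (x + t *\<^sub>R axis i 1)) (at t)"
proof -
  have "(\<lambda>s. \<phi> (y + s *\<^sub>R axis i 1)) differentiable at 0" for y
    using differentiable_chain_at[of "\<lambda>s. y + s *\<^sub>R axis i 1" 0 \<phi>] assms by (simp add: o_def)
  then have *: "((\<lambda>s. \<phi> (y + s *\<^sub>R axis i 1)) has_vector_derivative real_partial i \<phi> y) (at 0)" for y
    by (simp add: real_partial_def vector_derivative_works)
  have "((\<lambda>s. s - t) has_real_derivative 1) (at t)"
    by (auto intro!: derivative_eq_intros)
  then have "((\<lambda>s. \<phi> ((x + t *\<^sub>R axis i 1) + (s - t) *\<^sub>R axis i 1)) has_vector_derivative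
      1 *\<^sub>R real_partial i \<phi> (x + t *\<^sub>R axis i 1)) (at t)"
    using vector_diff_chain_at[of "\<lambda>s. s - t" 1 t "\<lambda>s. \<phi> ((x + t *\<^sub>R axis i 1) + s *\<^sub>R axis i 1)"]
      *[of "x + t *\<^sub>R axis i 1"]
    by (auto simp: o_def has_real_derivative_iff_has_vector_derivative)
  then show ?thesis by (simp add: algebra_simps)
qed

lemma test_function_differentiable: "\<phi> \<in> test_functions \<Longrightarrow> \<phi> differentiable at x"
  unfolding test_functions_iff by (metis foldr_Nil id_apply)

lemma test_function_real_partial:
  assumes "\<phi> \<in> test_functions"
  shows "real_partial i \<phi> \<in> test_functions"
  unfolding test_functions_iff
proof (intro conjI allI)
  fix "is" x
  show "foldr real_partial is (real_partial i \<phi>) differentiable at x"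
    using assms[unfolded test_functions_iff, THEN conjunct1, rule_format, of "is @ [i]" x] by simp
next
  have "real_partial i \<phi> x = 0" if "x \<notin> closure {x. \<phi> x \<noteq> 0}" for x
  proof -
    let ?U = "(\<lambda>t. x + t *\<^sub>R axis i 1) -` (- closure {x. \<phi> x \<noteq> 0})"
    have "open ?U"
      by (intro open_vimage continuous_intros) simp
    moreover have "0 \<in> ?U" using that by simp
    moreover have "\<phi> (x + t *\<^sub>R axis i 1) = 0" if "t \<in> ?U" for t
      using that closure_subset[of "{x. \<phi> x \<noteq> 0}"] by auto
    ultimately have "((\<lambda>t. \<phi> (x + t *\<^sub>R axis i 1)) has_vector_derivative 0) (at 0)"
      using has_vector_derivative_transform_within_open[of "\<lambda>_. 0" 0 0 ?U "\<lambda>t. \<phi> (x + t *\<^sub>R axis i 1)"]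
      by fastforce
    then show ?thesis
      by (simp add: real_partial_def vector_derivative_at)
  qed
  then have "{x. real_partial i \<phi> x \<noteq> 0} \<subseteq> closure {x. \<phi> x \<noteq> 0}" by auto
  moreover have "bounded (closure {x. \<phi> x \<noteq> 0})"
    using assms by (simp add: test_functions_iff bounded_closure)
  ultimately show "bounded {x. real_partial i \<phi> x \<noteq> 0}"
    by (rule bounded_subset[rotated])
qed

lemma test_function_foldr_real_partial:
  "\<phi> \<in> test_functions \<Longrightarrow> foldr real_partial is \<phi> \<in> test_functions"
  by (induction "is") (auto intro: test_function_real_partial)

lemma foldr_real_partial_translation:
  "foldr real_partial is (\<lambda>x. \<phi> (x + a)) = (\<lambda>x. foldr real_partial is \<phi> (x + a))"
proof (induction "is")
  case (Cons i "is")
  have "real_partial i (\<lambda>x. \<psi> (x + a)) = (\<lambda>x. real_partial i \<psi> (x + a))" for \<psi>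
    by (simp add: real_partial_def fun_eq_iff add_ac)
  then show ?case
    by (simp add: Cons.IH)
qed simp

lemma test_function_translation:
  assumes "\<phi> \<in> test_functions"
  shows "(\<lambda>x. \<phi> (x + a)) \<in> test_functions"
  unfolding test_functions_iff
proof (intro conjI allI)
  fix "is" x
  have "foldr real_partial is \<phi> differentiable at (x + a)"
    using assms by (auto simp: test_functions_iff)
  then show "foldr real_partial is (\<lambda>x. \<phi> (x + a)) differentiable at x"
    unfolding foldr_real_partial_translation
    using differentiable_chain_at[of "\<lambda>x. x + a" x "foldr real_partial is \<phi>"] by (simp add: o_def)
next
  have "{x. \<phi> (x + a) \<noteq> 0} = (\<lambda>x. x - a) ` {x. \<phi> x \<noteq> 0}"
    by (auto simp: image_iff intro!: exI[of _ "_ + a"])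
  moreover have "bounded {x. \<phi> x \<noteq> 0}"
    using assms by (simp add: test_functions_iff)
  ultimately show "bounded {x. \<phi> (x + a) \<noteq> 0}"
    using bounded_translation_minus by metis
qed

lemma test_function_bounded:
  assumes "\<phi> \<in> test_functions"
  obtains M R where "0 < M" "0 < R" "\<And>x. cmod (\<phi> x) \<le> M" "\<And>x. R < norm x \<Longrightarrow> \<phi> x = 0"
proof -
  obtain R where R: "0 < R" "\<And>x. \<phi> x \<noteq> 0 \<Longrightarrow> norm x \<le> R"
    using assms by (auto simp: test_functions_iff bounded_pos)
  have "continuous_on (cball 0 R) \<phi>"
    using test_function_differentiable[OF assms]
    by (auto intro!: continuous_at_imp_continuous_on differentiable_imp_continuous_within)
  then have "bounded (\<phi> ` cball 0 R)"
    by (intro compact_imp_bounded compact_continuous_image) auto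
  then obtain M where M: "0 < M" "\<And>x. x \<in> cball 0 R \<Longrightarrow> cmod (\<phi> x) \<le> M"
    by (auto simp: bounded_pos)
  show thesis
  proof (rule that[of M R])
    show "cmod (\<phi> x) \<le> M" for x
      using M R(2)[of x] by (cases "\<phi> x = 0") auto
    show "\<phi> x = 0" if "R < norm x" for x
      using R(2)[of x] that by (cases "\<phi> x = 0") auto
  qed fact+
qed

lemma test_function_measurable: "\<phi> \<in> test_functions \<Longrightarrow> \<phi> \<in> borel_measurable borel"
  by (intro borel_measurable_continuous_onI continuous_at_imp_continuous_on ballI
      differentiable_imp_continuous_within test_function_differentiable)

lemma indicator_cball_l2: "(\<lambda>x. of_real (c * indicator (cball 0 R) x)) \<in> l2 (lborel :: 'a::euclidean_space measure)"
proof -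
  have "integrable lborel (indicator (cball 0 R) :: 'a \<Rightarrow> real)"
    by (intro integrable_real_indicator) (use emeasure_lborel_cball_finite[of "0::'a" R] in auto)
  then have "integrable lborel (\<lambda>x. c\<^sup>2 * indicator (cball (0::'a) R) x)"
    by (rule integrable_mult_right)
  moreover have "(\<lambda>x. c\<^sup>2 * indicator (cball (0::'a) R) x) = (\<lambda>x. (cmod (of_real (c * indicator (cball 0 R) x)))\<^sup>2)"
    by (auto simp: fun_eq_iff indicator_def)
  moreover have [measurable]: "cball (0::'a) R \<in> sets borel" by simp
  have "(\<lambda>x::'a. of_real (c * indicator (cball 0 R) x) :: complex) \<in> borel_measurable lborel"
    by measurable
  ultimately show ?thesis unfolding l2_def by auto
qed

lemma test_function_l2:
  assumes "\<phi> \<in> test_functions"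
  shows "\<phi> \<in> l2 lborel"
proof -
  obtain M R where MR: "0 < M" "0 < R" "\<And>x. cmod (\<phi> x) \<le> M" "\<And>x. R < norm x \<Longrightarrow> \<phi> x = 0"
    using test_function_bounded[OF assms] by blast
  have "cmod (\<phi> x) \<le> cmod (of_real (M * indicator (cball 0 R) x))" for x
    using MR(1) MR(3)[of x] MR(4)[of x] by (auto simp: indicator_def)
  then show ?thesis
    using test_function_measurable[OF assms] by (intro l2_bound[OF indicator_cball_l2[of M R]]) auto
qed

lemma test_function_Lipschitz_along_axis:
  assumes "\<phi> \<in> test_functions"
  obtains M where "0 < M" "\<And>x t. cmod (\<phi> (x + t *\<^sub>R axis i 1) - \<phi> x) \<le> M * \<bar>t\<bar>"
proof -
  obtain M where M: "0 < M" "\<And>x. cmod (real_partial i \<phi> x) \<le> M"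
    using test_function_bounded[OF test_function_real_partial[OF assms, of i]] by metis
  have "cmod (\<phi> (x + t *\<^sub>R axis i 1) - \<phi> (x + 0 *\<^sub>R axis i 1)) \<le> M * norm (t - 0)" for x t
  proof (rule differentiable_bound[of UNIV])
    show "((\<lambda>t. \<phi> (x + t *\<^sub>R axis i 1)) has_derivative (\<lambda>h. h *\<^sub>R real_partial i \<phi> (x + t *\<^sub>R axis i 1))) (at t within UNIV)" for t
      using has_vector_derivative_real_partial[OF test_function_differentiable[OF assms]]
      by (simp add: has_vector_derivative_def)
    show "onorm (\<lambda>h. h *\<^sub>R real_partial i \<phi> (x + t *\<^sub>R axis i 1)) \<le> M" for t
      using M by (intro onorm_bound) (auto simp: mult.commute[of M] intro!: mult_left_mono)
  qed auto
  with M(1) show thesis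
    by (intro that[of M]) auto
qed

subsection \<open>Bumps filling a box\<close>

definition product_function :: "('n::finite \<Rightarrow> real \<Rightarrow> real) \<Rightarrow> real ^ 'n \<Rightarrow> complex"
  where "product_function u x = of_real (\<Prod>i\<in>UNIV. u i (x $ i))"

lemma product_function_differentiable:
  assumes "\<And>i. smooth (u i)"
  shows "product_function u differentiable at x"
proof -
  have "\<exists>D. ((\<lambda>x. u i (x $ i)) has_derivative D) (at x)" for i
  proof -
    obtain u' where "\<And>t. (u i has_real_derivative u' t) (at t)"
      using smooth_derivative[OF assms[of i]] by metis
    moreover have "((\<lambda>x. x $ i) has_derivative (\<lambda>x. x $ i)) (at x)"
      by (intro bounded_linear_imp_has_derivative bounded_linear_vec_nth)
    ultimately show ?thesis
      unfolding has_field_derivative_def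
      by (intro exI) (rule has_derivative_compose[where g="u i"])
  qed
  then obtain D where D: "\<And>i. ((\<lambda>x. u i (x $ i)) has_derivative D i) (at x)"
    by metis
  have "(\<lambda>x. \<Prod>i\<in>UNIV. u i (x $ i)) differentiable at x"
    unfolding differentiable_def by (rule exI) (rule has_derivative_prod, rule D)
  then obtain E where "((\<lambda>x. \<Prod>i\<in>UNIV. u i (x $ i)) has_derivative E) (at x)"
    by (auto simp: differentiable_def)
  then have "((\<lambda>x. of_real (\<Prod>i\<in>UNIV. u i (x $ i)) :: complex) has_derivative (\<lambda>h. of_real (E h))) (at x)"
    by (rule bounded_linear.has_derivative[OF bounded_linear_of_real])
  then show ?thesis
    unfolding product_function_def differentiable_def by blast
qed

lemma real_partial_product_function:
  assumes "\<And>t. (u j has_real_derivative u' t) (at t)"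
  shows "real_partial j (product_function u) = product_function (u(j := u'))"
proof
  fix x
  let ?P = "\<Prod>i\<in>UNIV-{j}. u i (x $ i)"
  have split: "(\<Prod>i\<in>UNIV. v i) = v j * (\<Prod>i\<in>UNIV-{j}. v i)" for v :: "'a \<Rightarrow> real"
    by (rule prod.remove) auto
  have eq: "product_function u (x + t *\<^sub>R axis j 1) = of_real (u j (x $ j + t) * ?P)" for t
    unfolding product_function_def of_real_eq_iff
    by (subst split) (auto simp: axis_def intro!: arg_cong2[where f="(*)"] prod.cong)
  have "((\<lambda>t. u j (x $ j + t) * ?P) has_real_derivative u' (x $ j) * ?P) (at 0)"
    using assms[of "x $ j"] by (auto intro!: derivative_eq_intros DERIV_chain2[of "u j"])
  then have "((\<lambda>t. of_real (u j (x $ j + t) * ?P) :: complex) has_vector_derivative of_real (u' (x $ j) * ?P)) (at 0)"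
    by (intro has_vector_derivative_of_real) (simp add: has_real_derivative_iff_has_vector_derivative)
  then have "real_partial j (product_function u) x = of_real (u' (x $ j) * ?P)"
    unfolding real_partial_def eq by (rule vector_derivative_at)
  also have "\<dots> = product_function (u(j := u')) x"
    unfolding product_function_def of_real_eq_iff split[of "\<lambda>i. (u(j := u')) i (x $ i)"]
    by (auto intro!: arg_cong2[where f="(*)"] prod.cong)
  finally show "real_partial j (product_function u) x = product_function (u(j := u')) x" .
qed

lemma foldr_real_partial_product_function:
  assumes "\<And>i. smooth (u i)"
  shows "\<exists>v. (\<forall>i. smooth (v i)) \<and> foldr real_partial is (product_function u) = product_function v"
proof (induction "is")
  case (Cons j "is")
  then obtain v where v: "\<And>i. smooth (v i)" "foldr real_partial is (product_function u) = product_function v"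
    by blast
  obtain v' where v': "\<And>t. (v j has_real_derivative v' t) (at t)" "smooth v'"
    using smooth_derivative[OF v(1)[of j]] by metis
  have "foldr real_partial (j # is) (product_function u) = product_function (v(j := v'))"
    using real_partial_product_function[of v j v', OF v'(1)] v(2) by simp
  moreover have "\<forall>i. smooth ((v(j := v')) i)"
    using v v' by simp
  ultimately show ?case by blast
qed (use assms in auto)

text \<open>
  On each axis the two factors are \<open>exp (- 1 / ((k + 1) s))\<close> with \<open>s\<close> the distance to an end of the
  interval; as \<open>k\<close> grows they tend to \<open>1\<close> inside the box.
\<close>

definition box_bump :: "real ^ 'n \<Rightarrow> real ^ 'n \<Rightarrow> nat \<Rightarrow> real ^ 'n \<Rightarrow> complex" where
  "box_bump a b k = product_function
    (\<lambda>i t. flat_at_0 1 (real (Suc k) * t + - real (Suc k) * a $ i) *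
           flat_at_0 1 (- real (Suc k) * t + real (Suc k) * b $ i))"

lemma box_bump_factor:
  "flat_at_0 1 (real (Suc k) * t + - real (Suc k) * a) =
    (if a < t then exp (- (1 / real (Suc k)) * (1 / (t - a))) else 0)"
  "flat_at_0 1 (- real (Suc k) * t + real (Suc k) * b) =
    (if t < b then exp (- (1 / real (Suc k)) * (1 / (b - t))) else 0)"
proof -
  have 1: "real (Suc k) * t + - real (Suc k) * a = real (Suc k) * (t - a)"
    and 2: "- real (Suc k) * t + real (Suc k) * b = real (Suc k) * (b - t)"
    by (simp_all add: algebra_simps)
  show "flat_at_0 1 (real (Suc k) * t + - real (Suc k) * a) =
    (if a < t then exp (- (1 / real (Suc k)) * (1 / (t - a))) else 0)"
    unfolding 1 by (simp add: flat_at_0_def zero_less_mult_iff del: of_nat_Suc)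
  show "flat_at_0 1 (- real (Suc k) * t + real (Suc k) * b) =
    (if t < b then exp (- (1 / real (Suc k)) * (1 / (b - t))) else 0)"
    unfolding 2 by (simp add: flat_at_0_def zero_less_mult_iff del: of_nat_Suc)
qed

lemma box_bump_eq_0: "x \<notin> box a b \<Longrightarrow> box_bump a b k x = 0"
  unfolding box_bump_def product_function_def box_bump_factor mem_box_cart
  by (auto simp: prod_zero_iff)

lemma norm_box_bump_le: "cmod (box_bump a b k x) \<le> 1"
proof -
  have *: "\<bar>\<Prod>i\<in>UNIV. u i\<bar> \<le> 1" if "\<And>i. 0 \<le> u i \<and> u i \<le> 1" for u :: "'a \<Rightarrow> real"
    using prod_le_1[of UNIV u] prod_nonneg[of UNIV u] that by auto
  have "exp (- (1 / real (Suc k)) * (1 / (d - c))) \<le> 1" if "c < d" for c d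
    using that by (simp del: of_nat_Suc)
  then show ?thesis
    unfolding box_bump_def product_function_def box_bump_factor norm_of_real
    by (intro *) (simp only: split: if_split, auto intro!: mult_le_one simp del: of_nat_Suc)
qed

lemma box_bump_tendsto: "(\<lambda>k. box_bump a b k x) \<longlonglongrightarrow> indicator (box a b) x"
proof (cases "x \<in> box a b")
  case False
  then show ?thesis by (simp add: box_bump_eq_0)
next
  case True
  then have ab: "a $ i < x $ i" "x $ i < b $ i" for i
    by (auto simp: mem_box_cart)
  have "(\<lambda>k. exp (- (1 / real (Suc k)) * c)) \<longlonglongrightarrow> exp (- 0 * c)" for c
    by (intro tendsto_intros LIMSEQ_Suc[OF lim_1_over_n])
  then have e: "(\<lambda>k. exp (- (1 / real (Suc k)) * c)) \<longlonglongrightarrow> 1" for c by simp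
  have "(\<lambda>k. box_bump a b k x) \<longlonglongrightarrow> of_real (\<Prod>i\<in>(UNIV :: 'a set). 1 * 1)"
    unfolding box_bump_def product_function_def box_bump_factor
    using ab e by (intro tendsto_of_real tendsto_prod tendsto_mult) (simp_all only: if_True)
  with True show ?thesis by simp
qed

lemma test_function_box_bump: "box_bump a b k \<in> test_functions"
  unfolding test_functions_iff
proof (intro conjI allI)
  fix "is" x
  show "foldr real_partial is (box_bump a b k) differentiable at x"
  proof -
    define u where "u i t = flat_at_0 1 (real (Suc k) * t + - real (Suc k) * a $ i) *
           flat_at_0 1 (- real (Suc k) * t + real (Suc k) * b $ i)" for i t
    have "smooth (u i)" for i
      unfolding u_def[abs_def] by (intro smooth_mult smooth_affine smooth_flat_at_0)
    then obtain v where "\<And>i. smooth (v i)" "foldr real_partial is (product_function u) = product_function v"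
      using foldr_real_partial_product_function[of u "is"] by blast
    moreover have "box_bump a b k = product_function u"
      by (simp only: box_bump_def u_def[abs_def])
    ultimately show ?thesis
      using product_function_differentiable[of v x] by simp
  qed
next
  have "{x. box_bump a b k x \<noteq> 0} \<subseteq> box a b"
    using box_bump_eq_0 by blast
  then show "bounded {x. box_bump a b k x \<noteq> 0}"
    by (rule bounded_subset[OF bounded_box])
qed

theorem AE_eq_0_if_test_integrals_eq_0:
  fixes g :: "real ^ 'n \<Rightarrow> complex"
  assumes m: "g \<in> borel_measurable borel"
    and i: "\<And>a b. integrable lborel (\<lambda>x. indicator (box a b) x * g x)"
    and z: "\<And>\<phi>. \<phi> \<in> test_functions \<Longrightarrow> (LINT x|lborel. g x * \<phi> x) = 0"
  shows "AE x in lborel. g x = 0"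
proof (rule AE_eq_0_if_box_integrals_eq_0[OF m i])
  fix a b :: "real ^ 'n"
  note [measurable] = m test_function_measurable[OF test_function_box_bump]
  have "(\<lambda>k. LINT x|lborel. g x * box_bump a b k x) \<longlonglongrightarrow> (LINT x|lborel. indicator (box a b) x * g x)"
  proof (rule integral_dominated_convergence)
    show "integrable lborel (\<lambda>x. cmod (indicator (box a b) x * g x))"
      by (intro integrable_norm i)
    show "AE x in lborel. (\<lambda>k. g x * box_bump a b k x) \<longlonglongrightarrow> indicator (box a b) x * g x"
      by (subst mult.commute) (intro AE_I2 tendsto_intros box_bump_tendsto)
    show "AE x in lborel. cmod (g x * box_bump a b k x) \<le> cmod (indicator (box a b) x * g x)" for k
    proof (rule AE_I2)
      fix x
      show "cmod (g x * box_bump a b k x) \<le> cmod (indicator (box a b) x * g x)"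
        using mult_left_le[OF norm_box_bump_le[of a b k x], of "cmod (g x)"]
        by (cases "x \<in> box a b") (auto simp: norm_mult box_bump_eq_0)
    qed
  qed measurable
  then show "(LINT x|lborel. indicator (box a b) x * g x) = 0"
    using z[OF test_function_box_bump] by (simp add: LIMSEQ_const_iff)
qed

corollary l2_AE_eq_0_if_test_integrals_eq_0:
  fixes g :: "real ^ 'n \<Rightarrow> complex"
  assumes g: "g \<in> l2 lborel"
    and z: "\<And>\<phi>. \<phi> \<in> test_functions \<Longrightarrow> (LINT x|lborel. g x * \<phi> x) = 0"
  shows "AE x in lborel. g x = 0"
proof (rule AE_eq_0_if_test_integrals_eq_0[OF _ _ z])
  fix a b :: "real ^ 'n"
  obtain R where R: "box a b \<subseteq> cball 0 R"
    using bounded_box[of a b] by (auto simp: bounded_pos subset_iff)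
  have "(\<lambda>x. indicator (box a b) x :: complex) \<in> l2 lborel"
    by (rule l2_bound[OF indicator_cball_l2[of 1 R]]) (use R in \<open>auto simp: indicator_def intro!: AE_I2\<close>)
  then show "integrable lborel (\<lambda>x. indicator (box a b) x * g x)"
    by (rule l2_mult_integrable[OF _ g])
qed (use l2_measurable[OF g] in auto)

section \<open>Entire functions of several variables\<close>

definition dot :: "complex ^ 'n \<Rightarrow> complex ^ 'n \<Rightarrow> complex"
  where "dot u v = (\<Sum>i\<in>UNIV. u $ i * v $ i)"

definition conjugate :: "complex ^ 'n \<Rightarrow> complex ^ 'n"
  where "conjugate z = (\<chi> i. cnj (z $ i))"

lemma dot_simps:
  "dot (u + v) w = dot u w + dot v w" "dot w (u + v) = dot w u + dot w v"
  "dot (u - v) w = dot u w - dot v w" "dot w (u - v) = dot w u - dot w v"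
  "dot (- u) w = - dot u w" "dot w (- u) = - dot w u"
  "dot (c *s u) v = c * dot u v" "dot u (c *s v) = c * dot u v"
  "dot 0 v = 0" "dot v 0 = 0"
  by (simp_all add: dot_def algebra_simps sum.distrib sum_subtractf sum_negf sum_distrib_left)

lemma dot_commute: "dot u v = dot v u"
  by (simp add: dot_def mult.commute)

lemma conjugate_simps [simp]:
  "conjugate (u + v) = conjugate u + conjugate v" "conjugate (u - v) = conjugate u - conjugate v"
  "conjugate (conjugate u) = u" "conjugate u $ i = cnj (u $ i)" "norm (conjugate u) = norm u"
  by (simp_all add: conjugate_def vec_eq_iff norm_vec_def)

lemma cnj_dot: "cnj (dot u v) = dot (conjugate u) (conjugate v)"
  by (simp add: dot_def)

lemma norm_dot_le: "cmod (dot u v) \<le> norm u * norm v"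
proof -
  have "cmod (dot u v) \<le> (\<Sum>i\<in>UNIV. \<bar>cmod (u $ i)\<bar> * \<bar>cmod (v $ i)\<bar>)"
    unfolding dot_def by (intro sum_norm_le) (simp add: norm_mult)
  also have "\<dots> \<le> norm u * norm v"
    unfolding norm_vec_def by (rule L2_set_mult_ineq)
  finally show ?thesis .
qed

lemma dot_conjugate: "dot z (conjugate z) = of_real ((norm z)\<^sup>2)"
proof -
  have "(norm z)\<^sup>2 = (\<Sum>i\<in>UNIV. (cmod (z $ i))\<^sup>2)"
    by (simp add: norm_vec_def L2_set_def sum_nonneg)
  then show ?thesis
    by (simp add: dot_def complex_norm_square del: of_real_power)
qed

lemma norm_scalar_mult: "norm (c *s z) = cmod c * norm (z :: complex ^ 'n)"
  by (simp add: norm_vec_def L2_set_def norm_mult power_mult_distrib real_sqrt_mult flip: sum_distrib_left)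

lemma continuous_on_dot [continuous_intros]:
  "continuous_on S f \<Longrightarrow> continuous_on S g \<Longrightarrow> continuous_on S (\<lambda>x. dot (f x) (g x))"
  unfolding dot_def by (intro continuous_intros)

lemma continuous_on_conjugate [continuous_intros]:
  "continuous_on S f \<Longrightarrow> continuous_on S (\<lambda>x. conjugate (f x))"
  unfolding conjugate_def by (intro continuous_intros)

lemma borel_measurable_component [measurable (raw)]:
  fixes f :: "'a \<Rightarrow> 'b::{second_countable_topology,real_normed_vector} ^ 'n"
  assumes "f \<in> borel_measurable M"
  shows "(\<lambda>x. f x $ i) \<in> borel_measurable M"
  by (rule measurable_compose[OF assms borel_measurable_continuous_onI]) (intro continuous_intros)

lemma borel_measurable_dot [measurable (raw)]:
  "f \<in> borel_measurable M \<Longrightarrow> g \<in> borel_measurable M \<Longrightarrow> (\<lambda>x. dot (f x) (g x)) \<in> borel_measurable M"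
  unfolding dot_def
  by (intro borel_measurable_sum borel_measurable_times borel_measurable_component)

lemma borel_measurable_conjugate [measurable (raw)]:
  assumes "f \<in> borel_measurable M"
  shows "(\<lambda>x. conjugate (f x)) \<in> borel_measurable M"
  by (rule measurable_compose[OF assms borel_measurable_continuous_onI]) (intro continuous_intros)

subsection \<open>Derivatives\<close>

lemma complex_line_has_derivative:
  fixes v :: "complex ^ 'n"
  shows "((\<lambda>t. z + t *s v) has_derivative (\<lambda>t. t *s v)) (at t)"
proof -
  have "bounded_linear (\<lambda>t::complex. t *s v)"
    by (intro linear_conv_bounded_linear[THEN iffD1] linearI) (auto simp: vec_eq_iff algebra_simps)
  then have "((\<lambda>t::complex. t *s v) has_derivative (\<lambda>t. t *s v)) (at t)"
    by (rule bounded_linear_imp_has_derivative)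
  from has_derivative_add_const[OF this, of z] show ?thesis
    by (simp add: add.commute)
qed

lemma entireI:
  assumes "\<And>z. (F has_derivative (\<lambda>h. \<Sum>i\<in>UNIV. h $ i * D i z)) (at z)"
  shows "entire F" and "complex_partial i F = D i"
proof -
  show "entire F"
    unfolding entire_def using assms
    by (intro allI exI conjI) (auto simp: sum_distrib_left mult.assoc)
  show "complex_partial i F = D i"
  proof
    fix z
    have "((\<lambda>t. F (z + t *s axis i 1)) has_derivative (\<lambda>t. \<Sum>j\<in>UNIV. (t *s axis i 1) $ j * D j z)) (at 0)"
      using has_derivative_compose[OF complex_line_has_derivative[of z "axis i 1" 0],
          of F "\<lambda>h. \<Sum>j\<in>UNIV. h $ j * D j z"] assms[of z] by simp
    also have "(\<lambda>t. \<Sum>j\<in>UNIV. (t *s axis i 1) $ j * D j z) = (\<lambda>t. D i z * t)"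
      by (auto simp: axis_def if_distrib if_distribR sum.delta cong: if_cong)
    finally have "((\<lambda>t. F (z + t *s axis i 1)) has_field_derivative D i z) (at 0)"
      by (simp add: has_field_derivative_def)
    then show "complex_partial i F z = D i z"
      unfolding complex_partial_def by (rule DERIV_imp_deriv)
  qed
qed

lemma entire_has_derivative:
  assumes "entire F"
  shows "(F has_derivative (\<lambda>h. \<Sum>i\<in>UNIV. h $ i * complex_partial i F z)) (at z)"
proof -
  obtain F' where F': "\<And>z. (F has_derivative F' z) (at z)" "\<And>z c v. F' z (c *s v) = c * F' z v"
    using assms unfolding entire_def by metis
  have "F' z h = (\<Sum>i\<in>UNIV. h $ i * F' z (axis i 1))" for z h
  proof -
    have lin: "linear (F' z)"
      using F'(1) has_derivative_linear by blast
    have "h = (\<Sum>i\<in>UNIV. h $ i *s axis i 1)"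
      by (simp add: vec_eq_iff axis_def if_distrib if_distribR sum.delta' cong: if_cong)
    then have "F' z h = F' z (\<Sum>i\<in>UNIV. h $ i *s axis i 1)" by simp
    also have "\<dots> = (\<Sum>i\<in>UNIV. F' z (h $ i *s axis i 1))"
      by (rule linear_sum[OF lin])
    finally show ?thesis by (simp add: F'(2))
  qed
  then have "F' z = (\<lambda>h. \<Sum>i\<in>UNIV. h $ i * F' z (axis i 1))" for z
    by (rule ext)
  from arg_cong[where f="\<lambda>G. (F has_derivative G) (at _)", OF this]
  have D: "(F has_derivative (\<lambda>h. \<Sum>i\<in>UNIV. h $ i * F' z (axis i 1))) (at z)" for z
    using F'(1)[of z] by blast
  show ?thesis
    using D[of z] entireI(2)[of F "\<lambda>i z. F' z (axis i 1)", OF D] by simp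
qed

lemma entire_line_derivative:
  assumes "entire F"
  shows "((\<lambda>t. F (z + t *s v)) has_field_derivative (\<Sum>i\<in>UNIV. v $ i * complex_partial i F (z + t *s v))) (at t)"
proof -
  have "((\<lambda>t. F (z + t *s v)) has_derivative
      (\<lambda>h. \<Sum>i\<in>UNIV. (h *s v) $ i * complex_partial i F (z + t *s v))) (at t)"
    using has_derivative_compose[OF complex_line_has_derivative[of z v t] entire_has_derivative[OF assms]] .
  moreover have "(\<lambda>h. \<Sum>i\<in>UNIV. (h *s v) $ i * complex_partial i F (z + t *s v))
      = (*) (\<Sum>i\<in>UNIV. v $ i * complex_partial i F (z + t *s v))"
    by (rule ext) (simp add: sum_distrib_left mult_ac)
  ultimately show ?thesis
    by (simp only: has_field_derivative_def)
qed

lemma entire_continuous: "entire F \<Longrightarrow> continuous_on S F"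
  by (meson entire_has_derivative has_derivative_continuous continuous_at_imp_continuous_on)

lemma entire_measurable: "entire F \<Longrightarrow> F \<in> borel_measurable borel"
  by (intro borel_measurable_continuous_onI entire_continuous)

lemma entire_add:
  assumes "entire F" "entire G"
  shows "entire (\<lambda>z. F z + G z)"
    and "complex_partial i (\<lambda>z. F z + G z) = (\<lambda>z. complex_partial i F z + complex_partial i G z)"
proof -
  have "((\<lambda>z. F z + G z) has_derivative
      (\<lambda>h. \<Sum>i\<in>UNIV. h $ i * (complex_partial i F z + complex_partial i G z))) (at z)" for z
    using has_derivative_add[OF assms[THEN entire_has_derivative, of z]]
    by (simp add: distrib_left sum.distrib)
  then show "entire (\<lambda>z. F z + G z)"
    and "complex_partial i (\<lambda>z. F z + G z) = (\<lambda>z. complex_partial i F z + complex_partial i G z)"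
    by (rule entireI)+
qed

lemma entire_mult:
  assumes "entire F" "entire G"
  shows "entire (\<lambda>z. F z * G z)"
    and "complex_partial i (\<lambda>z. F z * G z) = (\<lambda>z. F z * complex_partial i G z + complex_partial i F z * G z)"
proof -
  have "((\<lambda>z. F z * G z) has_derivative
      (\<lambda>h. \<Sum>i\<in>UNIV. h $ i * (F z * complex_partial i G z + complex_partial i F z * G z))) (at z)" for z
    using has_derivative_mult[OF assms[THEN entire_has_derivative, of z]]
    by (simp add: distrib_left sum.distrib sum_distrib_left sum_distrib_right mult_ac)
  then show "entire (\<lambda>z. F z * G z)"
    and "complex_partial i (\<lambda>z. F z * G z) = (\<lambda>z. F z * complex_partial i G z + complex_partial i F z * G z)"
    by (rule entireI)+
qed

lemma entire_const: "entire (\<lambda>z. c)" "complex_partial i (\<lambda>z. c) = (\<lambda>z. 0)"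
  using entireI[of "\<lambda>z. c" "\<lambda>i z. 0"] by auto

lemma entire_cmult:
  "entire F \<Longrightarrow> entire (\<lambda>z. c * F z)"
  "entire F \<Longrightarrow> complex_partial i (\<lambda>z. c * F z) = (\<lambda>z. c * complex_partial i F z)"
  using entire_mult[OF entire_const(1)] by (auto simp: entire_const)

lemma entire_component:
  fixes i j :: "'n::finite"
  shows
    "entire (\<lambda>z. z $ j)" "complex_partial i (\<lambda>z. z $ j) = (\<lambda>z. if i = j then 1 else 0)"
proof -
  have "((\<lambda>z. z $ j) has_derivative (\<lambda>h. \<Sum>i\<in>UNIV. h $ i * (if i = j then 1 else 0))) (at z)" for z :: "complex ^ 'n"
  proof -
    have "((\<lambda>z. z $ j) has_derivative (\<lambda>h. h $ j)) (at z)"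
      by (intro bounded_linear_imp_has_derivative bounded_linear_vec_nth)
    moreover have "(\<lambda>h :: complex ^ 'n. h $ j) = (\<lambda>h. \<Sum>i\<in>UNIV. h $ i * (if i = j then 1 else 0))"
      by (simp add: if_distrib sum.delta cong: if_cong)
    ultimately show ?thesis by (simp only:)
  qed
  then show "entire (\<lambda>z. z $ j :: complex)" "complex_partial i (\<lambda>z. z $ j) = (\<lambda>z. if i = j then 1 else 0)"
    by (rule entireI)+
qed

lemma entire_translation:
  assumes "entire F"
  shows "entire (\<lambda>z. F (z + a))"
proof -
  have "((\<lambda>z. z + a) has_derivative (\<lambda>h. h)) (at z)" for z
    by (auto intro!: derivative_eq_intros)
  then have "((\<lambda>z. F (z + a)) has_derivative (\<lambda>h. \<Sum>i\<in>UNIV. h $ i * complex_partial i F (z + a))) (at z)" for z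
    using has_derivative_compose[where g=F and f="\<lambda>z. z + a" and x=z and s=UNIV]
      entire_has_derivative[OF assms, of "z + a"] by fastforce
  then show ?thesis by (rule entireI)
qed

text \<open>
  The remainder of the exponential is quadratic, so the exponential moments of \<open>G\<close> bound the error
  of the linear approximation by a multiple of \<open>(norm h)\<^sup>2\<close>.
\<close>

lemma exponential_integral:
  fixes p :: "'a \<Rightarrow> complex ^ 'n"
  assumes [measurable]: "G \<in> borel_measurable M" "p \<in> borel_measurable M"
    and int: "\<And>R. integrable M (\<lambda>x. cmod (G x) * exp (R * norm (p x)))"
  shows integrable_exponential: "integrable M (\<lambda>x. G x * exp (dot w (p x)))"
    and integrable_exponential_component: "integrable M (\<lambda>x. cmod (G x * p x $ i) * exp (R * norm (p x)))"
    and entire_exponential_integral: "entire (\<lambda>w. LINT x|M. G x * exp (dot w (p x)))"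
    and complex_partial_exponential_integral:
      "complex_partial i (\<lambda>w. LINT x|M. G x * exp (dot w (p x))) = (\<lambda>w. LINT x|M. G x * p x $ i * exp (dot w (p x)))"
proof -
  have expn: "cmod (exp (dot w u)) \<le> exp (norm w * norm u)" for w u :: "complex ^ 'n"
    using norm_dot_le[of w u] complex_Re_le_cmod[of "dot w u"] by simp
  have pe: "t \<le> exp t" for t :: real
    using exp_ge_add_one_self[of t] by linarith
  have 1: "integrable M (\<lambda>x. G x * exp (dot w (p x)))"
    if [measurable]: "G \<in> borel_measurable M" and int: "\<And>R. integrable M (\<lambda>x. cmod (G x) * exp (R * norm (p x)))" for w G
    by (rule Bochner_Integration.integrable_bound[OF int[of "norm w"]])
      (auto simp: norm_mult simp del: norm_exp_eq_Re intro!: AE_I2 mult_left_mono expn)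
  have 2: "integrable M (\<lambda>x. cmod (G x * p x $ i) * exp (R * norm (p x)))" for i R
  proof (rule Bochner_Integration.integrable_bound[OF int[of "R + 1"]])
    have "cmod (G x * p x $ i) * exp (R * norm (p x)) \<le> cmod (G x) * exp ((R + 1) * norm (p x))" for x
    proof -
      have "cmod (p x $ i) \<le> exp (norm (p x))"
        using Finite_Cartesian_Product.norm_nth_le[of "p x" i] pe[of "norm (p x)"] by linarith
      then have "cmod (G x) * cmod (p x $ i) * exp (R * norm (p x)) \<le> cmod (G x) * exp (norm (p x)) * exp (R * norm (p x))"
        by (intro mult_right_mono mult_left_mono) auto
      then show ?thesis
        by (simp add: norm_mult distrib_right exp_add mult_ac)
    qed
    then show "AE x in M. norm (cmod (G x * p x $ i) * exp (R * norm (p x))) \<le> norm (cmod (G x) * exp ((R + 1) * norm (p x)))"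
      by auto
  qed measurable
  show "integrable M (\<lambda>x. G x * exp (dot w (p x)))"
    by (rule 1) (use int in auto)
  show "integrable M (\<lambda>x. cmod (G x * p x $ i) * exp (R * norm (p x)))"
    by (rule 2)
  define F where "F w = (LINT x|M. G x * exp (dot w (p x)))" for w
  define D where "D i w = (LINT x|M. G x * p x $ i * exp (dot w (p x)))" for i w
  have Di: "integrable M (\<lambda>x. G x * p x $ i * exp (dot w (p x)))" for i w
    by (rule 1[OF _ 2]) measurable
  have "(F has_derivative (\<lambda>h. \<Sum>i\<in>UNIV. h $ i * D i w)) (at w)" for w
  proof (rule has_derivativeI_sandwich[where e=1
        and H="\<lambda>y. (LINT x|M. cmod (G x) * exp ((norm w + 3) * norm (p x))) * norm (y - w)"])
    show "bounded_linear (\<lambda>h. \<Sum>i\<in>UNIV. h $ i * D i w)"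
      by (intro bounded_linear_sum bounded_linear_mult_left bounded_linear_compose[OF bounded_linear_mult_left]
          bounded_linear_vec_nth)
    define C where "C = (LINT x|M. cmod (G x) * exp ((norm w + 3) * norm (p x)))"
    fix y assume y: "y \<noteq> w" "dist y w < 1"
    define h where "h = y - w"
    have h: "norm h < 1" "h \<noteq> 0" "y = w + h"
      using y by (auto simp: h_def dist_norm)
    have "(\<Sum>i\<in>UNIV. h $ i * D i w) = (LINT x|M. G x * dot h (p x) * exp (dot w (p x)))"
    proof -
      have "(\<Sum>i\<in>UNIV. h $ i * D i w) = (LINT x|M. (\<Sum>i\<in>UNIV. h $ i * (G x * p x $ i * exp (dot w (p x)))))"
        unfolding D_def by (subst Bochner_Integration.integral_sum) (auto intro!: Di)
      also have "\<dots> = (LINT x|M. G x * dot h (p x) * exp (dot w (p x)))"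
        by (intro Bochner_Integration.integral_cong) (auto simp: dot_def sum_distrib_left sum_distrib_right mult_ac)
      finally show ?thesis .
    qed
    moreover have "integrable M (\<lambda>x. G x * dot h (p x) * exp (dot w (p x)))"
    proof -
      have "integrable M (\<lambda>x. \<Sum>i\<in>UNIV. h $ i * (G x * p x $ i * exp (dot w (p x))))"
        by (intro Bochner_Integration.integrable_sum integrable_mult_right Di)
      also have "(\<lambda>x. \<Sum>i\<in>UNIV. h $ i * (G x * p x $ i * exp (dot w (p x)))) = (\<lambda>x. G x * dot h (p x) * exp (dot w (p x)))"
        by (auto simp: dot_def sum_distrib_left sum_distrib_right mult_ac)
      finally show ?thesis .
    qed
    ultimately have "F y - F w - (\<Sum>i\<in>UNIV. h $ i * D i w)
        = (LINT x|M. G x * exp (dot w (p x)) * (exp (dot h (p x)) - (1 + dot h (p x))))"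
      unfolding F_def h(3) using 1[of G "w + h"] 1[of G w] int
      by (subst Bochner_Integration.integral_diff[symmetric] | simp add: algebra_simps dot_simps exp_add)+
    \<comment> \<open>besides \<open>norm w\<close>, the remainder contributes \<open>1\<close> to the exponent and the quadratic factor \<open>2\<close>\<close>
    also have "cmod \<dots> \<le> (LINT x|M. (norm h)\<^sup>2 * (cmod (G x) * exp ((norm w + 3) * norm (p x))))"
    proof (rule order_trans[OF integral_norm_bound integral_mono_AE])
      show "integrable M (\<lambda>x. (norm h)\<^sup>2 * (cmod (G x) * exp ((norm w + 3) * norm (p x))))"
        by (intro integrable_mult_right int)
      have bound: "cmod (G x * exp (dot w (p x)) * (exp (dot h (p x)) - (1 + dot h (p x))))
          \<le> (norm h)\<^sup>2 * (cmod (G x) * exp ((norm w + 3) * norm (p x)))" for x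
      proof -
        let ?u = "dot h (p x)" and ?P = "norm (p x)"
        have u: "cmod ?u \<le> norm h * ?P" "cmod ?u \<le> ?P"
          using norm_dot_le[of h "p x"] h(1) mult_right_mono[of "norm h" 1 ?P] by auto
        have "cmod (exp ?u - (1 + ?u)) \<le> exp (cmod ?u) * cmod ?u ^ 2"
          using Taylor_exp_field[of ?u 1] by (simp add: numeral_2_eq_2)
        also have "\<dots> \<le> exp ?P * (norm h * ?P)\<^sup>2"
          using u by (intro mult_mono power_mono) auto
        also have "\<dots> \<le> exp ?P * ((norm h)\<^sup>2 * exp (2 * ?P))"
          using power_mono[OF pe[of ?P], of 2]
          by (intro mult_left_mono) (auto simp: power_mult_distrib exp_double intro!: mult_left_mono)
        finally have "cmod (G x) * cmod (exp (dot w (p x))) * cmod (exp ?u - (1 + ?u))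
            \<le> cmod (G x) * exp (norm w * ?P) * (exp ?P * ((norm h)\<^sup>2 * exp (2 * ?P)))"
          using expn[of w "p x"] by (intro mult_mono mult_left_mono) auto
        also have "\<dots> = (norm h)\<^sup>2 * (cmod (G x) * exp ((norm w + 3) * ?P))"
          by (simp add: algebra_simps flip: exp_add)
        finally show ?thesis by (simp add: norm_mult)
      qed
      then show "AE x in M. cmod (G x * exp (dot w (p x)) * (exp (dot h (p x)) - (1 + dot h (p x))))
          \<le> (norm h)\<^sup>2 * (cmod (G x) * exp ((norm w + 3) * norm (p x)))"
        by simp
      show "integrable M (\<lambda>x. cmod (G x * exp (dot w (p x)) * (exp (dot h (p x)) - (1 + dot h (p x)))))"
        by (rule integrable_norm, rule Bochner_Integration.integrable_bound[OF integrable_mult_right[OF int[of "norm w + 3"], of "(norm h)\<^sup>2"]])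
          (use bound in \<open>auto intro: order_trans[OF _ abs_ge_self]\<close>)
    qed
    also have "\<dots> = (norm h)\<^sup>2 * C"
      by (simp add: C_def)
    finally have "cmod (F y - F w - (\<Sum>i\<in>UNIV. h $ i * D i w)) / norm h \<le> (norm h)\<^sup>2 * C / norm h"
      by (intro divide_right_mono) auto
    also have "(norm h)\<^sup>2 * C / norm h = C * norm h"
      using h(2) by (simp add: power2_eq_square)
    finally show "cmod (F y - F w - (\<Sum>i\<in>UNIV. (y - w) $ i * D i w)) / norm (y - w)
        \<le> (LINT x|M. cmod (G x) * exp ((norm w + 3) * norm (p x))) * norm (y - w)"
      by (simp only: h_def C_def)
  next
    have "((\<lambda>y. (LINT x|M. cmod (G x) * exp ((norm w + 3) * norm (p x))) * norm (y - w)) \<longlongrightarrow>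
        (LINT x|M. cmod (G x) * exp ((norm w + 3) * norm (p x))) * norm (w - w)) (at w)"
      by (intro tendsto_intros)
    then show "((\<lambda>y. (LINT x|M. cmod (G x) * exp ((norm w + 3) * norm (p x))) * norm (y - w)) \<longlongrightarrow> 0) (at w)"
      by simp
  qed simp
  from entireI[of F D, OF this]
  show "entire (\<lambda>w. LINT x|M. G x * exp (dot w (p x)))"
    and "complex_partial i (\<lambda>w. LINT x|M. G x * exp (dot w (p x))) = (\<lambda>w. LINT x|M. G x * p x $ i * exp (dot w (p x)))"
    by (simp_all add: F_def[abs_def] D_def[abs_def])
qed

section \<open>The reproducing formula of the Fock space\<close>

definition gaussian_weight :: "complex ^ 'n \<Rightarrow> real"
  where "gaussian_weight z = exp (- (norm z)\<^sup>2) / pi ^ CARD('n)"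

lemma gaussian_weight_pos: "0 < gaussian_weight z"
  by (simp add: gaussian_weight_def)

lemma gaussian_weight_measurable [measurable]: "gaussian_weight \<in> borel_measurable borel"
  unfolding gaussian_weight_def[abs_def] by measurable

lemma fock_measure_eq: "fock_measure = density lborel (\<lambda>z. ennreal (gaussian_weight z))"
  by (simp add: fock_measure_def gaussian_weight_def)

lemma sets_fock_measure [measurable_cong, simp]: "sets fock_measure = sets borel"
  and space_fock_measure [simp]: "space fock_measure = UNIV"
  by (simp_all add: fock_measure_def)

lemma borel_measurable_fock_measure [simp]: "borel_measurable fock_measure = borel_measurable borel"
  by (rule measurable_cong_sets) simp_all

lemma integrable_fock_measure:
  fixes f :: "complex ^ 'n \<Rightarrow> 'b::{banach,second_countable_topology}"
  assumes "f \<in> borel_measurable borel"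
  shows "integrable fock_measure f \<longleftrightarrow> integrable lborel (\<lambda>z. gaussian_weight z *\<^sub>R f z)"
  unfolding fock_measure_eq using assms
  by (intro integrable_density) (auto simp: gaussian_weight_pos less_imp_le)

lemma integral_fock_measure:
  fixes f :: "complex ^ 'n \<Rightarrow> 'b::{banach,second_countable_topology}"
  assumes "f \<in> borel_measurable borel"
  shows "(LINT z|fock_measure. f z) = (LINT z|lborel. gaussian_weight z *\<^sub>R f z)"
  unfolding fock_measure_eq using assms
  by (intro integral_density) (auto simp: gaussian_weight_pos less_imp_le)

lemma integrable_exp_linear_fock_measure: "integrable fock_measure (\<lambda>z. exp (R * norm z))"
proof (subst integrable_fock_measure)
  have "integrable lborel (\<lambda>z :: complex ^ 'n. exp (R * norm z - 1 * (norm z)\<^sup>2) / pi ^ CARD('n))"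
    by (intro integrable_divide integrable_exp_linear_gaussian) simp
  then show "integrable lborel (\<lambda>z :: complex ^ 'n. gaussian_weight z *\<^sub>R exp (R * norm z))"
    by (simp add: gaussian_weight_def exp_diff exp_minus field_simps)
qed measurable

text \<open>
  The total mass of \<open>fock_measure\<close>, which is \<open>1\<close>; it is kept as a symbol, and positivity allows
  division by it.
\<close>

definition fock_mass :: "'n::finite itself \<Rightarrow> real"
  where "fock_mass n = (LINT z::complex ^ 'n|lborel. gaussian_weight z)"

lemma integrable_gaussian_weight: "integrable lborel gaussian_weight"
  using integrable_exp_linear_fock_measure[of 0] by (simp add: integrable_fock_measure)

lemma fock_mass_pos: "0 < fock_mass TYPE('n::finite)"
proof -
  have "\<not> (AE z::complex ^ 'n in lborel. gaussian_weight z = 0)"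
  proof
    assume "AE z::complex ^ 'n in lborel. gaussian_weight z = 0"
    then have "AE z::complex ^ 'n in lborel. False"
      by eventually_elim (use gaussian_weight_pos less_irrefl in metis)
    then have "(UNIV :: (complex ^ 'n) set) \<in> null_sets lborel"
      using AE_iff_null[of lborel "\<lambda>_ :: complex ^ 'n. False"] by simp
    then show False
      by (simp add: null_sets_def emeasure_lborel_UNIV)
  qed
  then have "fock_mass TYPE('n) \<noteq> 0"
    unfolding fock_mass_def
    by (subst integral_nonneg_eq_0_iff_AE) (auto simp: integrable_gaussian_weight gaussian_weight_pos less_imp_le)
  moreover have "0 \<le> fock_mass TYPE('n)"
    unfolding fock_mass_def by (intro integral_nonneg_AE) (auto simp: gaussian_weight_pos less_imp_le)
  ultimately show ?thesis by simp
qed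

lemma fock_iff: "F \<in> fock \<longleftrightarrow> entire F \<and> F \<in> l2 fock_measure"
  by (auto simp: fock_def l2_def entire_measurable)

lemma fock_norm_eq: "fock_norm = l2_norm fock_measure"
  by (simp add: fock_norm_def l2_norm_def fun_eq_iff)

lemma exp_linear_l2: "(\<lambda>z. of_real (exp (R * norm z))) \<in> l2 fock_measure"
  using integrable_exp_linear_fock_measure[of "2 * R"] by (simp add: l2_def exp_double[symmetric] mult.assoc)

lemma exp_dot_l2: "(\<lambda>z. exp (dot w (conjugate z))) \<in> l2 fock_measure"
proof (rule l2_bound[OF exp_linear_l2[of "norm w"]])
  show "(\<lambda>z. exp (dot w (conjugate z))) \<in> borel_measurable fock_measure"
    by simp measurable
  have "cmod (exp (dot w (conjugate z))) \<le> exp (norm w * norm z)" for z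
    using norm_dot_le[of w "conjugate z"] complex_Re_le_cmod[of "dot w (conjugate z)"] by simp
  then show "AE z in fock_measure. cmod (exp (dot w (conjugate z))) \<le> cmod (of_real (exp (norm w * norm z)))"
    by simp
qed

lemma l2_exponential_moments:
  assumes "F \<in> l2 fock_measure"
  shows "integrable fock_measure (\<lambda>z. cmod (F z) * exp (R * norm (conjugate z)))"
  using l2_hoelder(1)[OF assms exp_linear_l2[of R]] by simp

subsection \<open>Mean values\<close>

text \<open>
  Cauchy's formula at the centre of the unit circle, written as a Lebesgue integral for Fubini's
  theorem.
\<close>

lemma circle_mean_value:
  assumes "h holomorphic_on UNIV"
  shows "(LINT s|lborel. indicator {0..1} s *\<^sub>R h (exp (2 * of_real pi * \<i> * of_real s))) = h 0"
proof -
  have "((\<lambda>u. h u / (u - 0)) has_contour_integral (2 * of_real pi * \<i> * h 0)) (circlepath 0 1)"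
    by (rule Cauchy_integral_circlepath_simple) (auto intro: holomorphic_on_subset[OF assms])
  then have "((\<lambda>s. h (circlepath 0 1 s) / circlepath 0 1 s * vector_derivative (circlepath 0 1) (at s within {0..1}))
      has_integral (2 * of_real pi * \<i> * h 0)) {0..1}"
    by (simp add: has_contour_integral_def)
  moreover have "h (circlepath 0 1 s) / circlepath 0 1 s * vector_derivative (circlepath 0 1) (at s within {0..1})
      = (2 * of_real pi * \<i>) * h (exp (2 * of_real pi * \<i> * of_real s))" if "s \<in> {0..1}" for s
  proof -
    have "vector_derivative (circlepath 0 1) (at s within {0..1}) = 2 * of_real pi * \<i> * exp (2 * of_real pi * \<i> * of_real s)"
      using that by (simp only: vector_derivative_circlepath01 atLeastAtMost_iff of_real_1 mult_1_right of_real_mult of_real_numeral)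
    then show ?thesis
      by (simp add: circlepath)
  qed
  ultimately have "((\<lambda>s. (2 * of_real pi * \<i>) * h (exp (2 * of_real pi * \<i> * of_real s))) has_integral
      (2 * of_real pi * \<i> * h 0)) {0..1}"
    by (rule has_integral_eq[rotated])
  from has_integral_mult_right[OF this, of "1 / (2 * of_real pi * \<i>)"]
  have hi: "((\<lambda>s. h (exp (2 * of_real pi * \<i> * of_real s))) has_integral h 0) {0..1}"
    by simp
  have "continuous_on {0..1} (\<lambda>s. h (exp (2 * of_real pi * \<i> * of_real s)))"
    by (intro continuous_on_compose2[OF holomorphic_on_imp_continuous_on[OF assms]] continuous_intros) auto
  then have "set_integrable lborel {0..1} (\<lambda>s. h (exp (2 * of_real pi * \<i> * of_real s)))"
    by (rule borel_integrable_atLeastAtMost')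
  from set_borel_integral_eq_integral(2)[OF this] show ?thesis
    by (simp only: set_lebesgue_integral_def integral_unique[OF hi])
qed

lemma phase_rotation_orbit:
  fixes s :: real
  shows "distr lborel borel (\<lambda>z :: complex ^ 'n. exp (2 * of_real pi * \<i> * of_real s) *s z) = lborel"
    and "(\<lambda>p. exp (2 * of_real pi * \<i> * of_real (fst p)) *s snd p :: complex ^ 'n) \<in> borel_measurable borel"
proof -
  have "linear (\<lambda>z :: complex ^ 'n. c *s z)" for c
    by (intro linearI) (auto simp: vec_eq_iff algebra_simps)
  moreover have "cmod (exp (2 * of_real pi * \<i> * of_real s)) = 1" by simp
  ultimately show "distr lborel borel (\<lambda>z :: complex ^ 'n. exp (2 * of_real pi * \<i> * of_real s) *s z) = lborel"
    by (intro lborel_distr_orthogonal) (simp add: orthogonal_transformation norm_scalar_mult del: norm_exp_eq_Re)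
  show "(\<lambda>p. exp (2 * of_real pi * \<i> * of_real (fst p)) *s snd p :: complex ^ 'n) \<in> borel_measurable borel"
    unfolding vector_scalar_mult_def by (intro borel_measurable_continuous_onI continuous_intros)
qed

text \<open>
  Average over the phase rotations, which preserve the Gaussian measure: on every circle the mean
  of an entire function is its value at the origin.
\<close>

lemma fock_mean_value:
  fixes H :: "complex ^ 'n \<Rightarrow> complex"
  assumes H: "entire H" and i: "integrable fock_measure H"
  shows "(LINT z|fock_measure. H z) = of_real (fock_mass TYPE('n)) * H 0"
proof -
  have [measurable]: "H \<in> borel_measurable borel"
    by (rule entire_measurable[OF H])
  define u where "u z = gaussian_weight z *\<^sub>R H z" for z
  have ui: "integrable lborel u"
    using i by (simp add: u_def[abs_def] integrable_fock_measure)
  have mean: "(LINT s|lborel. indicator {0..1} s *\<^sub>R u (exp (2 * of_real pi * \<i> * of_real s) *s z)) = gaussian_weight z *\<^sub>R H 0" for z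
  proof -
    have "gaussian_weight (exp (2 * of_real pi * \<i> * of_real s) *s z) = gaussian_weight z" for s
      by (simp add: gaussian_weight_def norm_scalar_mult)
    then have "(LINT s|lborel. indicator {0..1} s *\<^sub>R u (exp (2 * of_real pi * \<i> * of_real s) *s z))
        = gaussian_weight z *\<^sub>R (LINT s|lborel. indicator {0..1} s *\<^sub>R H (exp (2 * of_real pi * \<i> * of_real s) *s z))"
      unfolding u_def by (subst integral_scaleR_right[symmetric], intro Bochner_Integration.integral_cong)
        (simp_all add: mult.commute)
    also have "(\<lambda>c. H (c *s z)) holomorphic_on UNIV"
      using entire_line_derivative[OF H, of 0 z] by (auto simp: holomorphic_on_def field_differentiable_def)
    note circle_mean_value[OF this]
    finally show ?thesis by simp
  qed
  have "(LINT z|fock_measure. H z) = (LINT z|lborel. u z)"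
    by (simp add: integral_fock_measure u_def)
  also have "\<dots> = (LINT z|lborel. (LINT s|lborel. indicator {0..1} s *\<^sub>R u (exp (2 * of_real pi * \<i> * of_real s) *s z)))"
    using integral_orbit[OF ui phase_rotation_orbit, of 0 1] by simp
  also have "\<dots> = (LINT z::complex ^ 'n|lborel. gaussian_weight z *\<^sub>R H 0)"
    by (simp add: mean)
  also have "\<dots> = of_real (fock_mass TYPE('n)) * H 0"
    by (simp add: fock_mass_def integrable_gaussian_weight scaleR_conv_of_real)
  finally show ?thesis .
qed

lemma entire_exp_dot:
  fixes v :: "complex ^ 'n"
  shows "entire (\<lambda>z. exp (c * dot z v))"
proof -
  have "bounded_linear (\<lambda>z :: complex ^ 'n. c * dot z v)"
    unfolding dot_def
    by (intro bounded_linear_compose[OF bounded_linear_mult_right] bounded_linear_sum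
        bounded_linear_compose[OF bounded_linear_mult_left] bounded_linear_vec_nth)
  then have "((\<lambda>z. c * dot z v) has_derivative (\<lambda>h. c * dot h v)) (at z)" for z
    by (rule bounded_linear_imp_has_derivative)
  moreover have "(exp has_derivative (*) (exp u)) (at u)" for u :: complex
    using DERIV_exp[of u] by (simp add: has_field_derivative_def)
  ultimately have "((\<lambda>z. exp (c * dot z v)) has_derivative (\<lambda>h. exp (c * dot z v) * (c * dot h v))) (at z)" for z
    by (rule has_derivative_compose[where g=exp])
  moreover have "(\<lambda>h. exp (c * dot z v) * (c * dot h v)) = (\<lambda>h. \<Sum>i\<in>UNIV. h $ i * (c * v $ i * exp (c * dot z v)))" for z
  proof -
    have "e * (c * dot h v) = (\<Sum>i\<in>UNIV. h $ i * (c * v $ i * e))" for e h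
      by (simp add: dot_def sum_distrib_left mult_ac)
    then show ?thesis by (intro ext)
  qed
  ultimately show ?thesis
    by (intro entireI(1)[of _ "\<lambda>i z. c * v $ i * exp (c * dot z v)"]) metis
qed

text \<open>The mean value formula at \<open>0\<close>, applied to the translate of \<open>F\<close> by \<open>w\<close> after the Weyl factor
  has been moved to the other side.\<close>

theorem fock_reproducing:
  fixes F :: "complex ^ 'n \<Rightarrow> complex"
  assumes F: "F \<in> fock"
  shows "(LINT z|fock_measure. F z * exp (dot w (conjugate z))) = of_real (fock_mass TYPE('n)) * F w"
proof -
  have ent: "entire F" and l2: "F \<in> l2 fock_measure"
    using F by (auto simp: fock_iff)
  have [measurable]: "F \<in> borel_measurable borel"
    by (rule entire_measurable[OF ent])
  define H where "H z = F (z + w) * exp (-1 * dot z (conjugate w))" for z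
  have entH: "entire H"
    unfolding H_def by (intro entire_mult entire_translation ent entire_exp_dot)
  have [measurable]: "H \<in> borel_measurable borel"
    by (rule entire_measurable[OF entH])
  define v where "v z = gaussian_weight z *\<^sub>R (F z * exp (dot w (conjugate z)))" for z
  have vi: "integrable lborel v"
    unfolding v_def
    by (subst integrable_fock_measure[symmetric]) (measurable, rule l2_mult_integrable[OF l2 exp_dot_l2])
  have key: "gaussian_weight z *\<^sub>R H z = v (z + w)" for z
  proof -
    have e: "- of_real ((norm z)\<^sup>2) - dot z (conjugate w) = - of_real ((norm (z + w))\<^sup>2) + dot w (conjugate (z + w))"
      unfolding dot_conjugate[symmetric] by (simp add: dot_simps)
    have "of_real (exp (- (norm z)\<^sup>2)) * exp (-1 * dot z (conjugate w)) = exp (- of_real ((norm z)\<^sup>2) - dot z (conjugate w))"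
      by (simp add: exp_of_real[symmetric] exp_diff exp_minus field_simps)
    also have "\<dots> = of_real (exp (- (norm (z + w))\<^sup>2)) * exp (dot w (conjugate (z + w)))"
      unfolding e by (simp only: exp_add exp_of_real[symmetric] of_real_minus)
    finally show ?thesis
      by (simp add: H_def v_def gaussian_weight_def scaleR_conv_of_real mult_ac)
  qed
  have "integrable fock_measure H"
    using integrable_translation[OF vi, of w] by (simp add: integrable_fock_measure key)
  from fock_mean_value[OF entH this]
  have "(LINT z|lborel. v (z + w)) = of_real (fock_mass TYPE('n)) * F w"
    by (simp add: integral_fock_measure key) (simp add: H_def dot_simps)
  also have "(LINT z|lborel. v (z + w)) = (LINT z|lborel. v z)"
    by (rule integral_translation) (use vi in auto)
  also have "\<dots> = (LINT z|fock_measure. F z * exp (dot w (conjugate z)))"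
    unfolding v_def by (rule integral_fock_measure[symmetric]) measurable
  finally show ?thesis .
qed

subsection \<open>Iterated partial derivatives\<close>

text \<open>
  Differentiating the reproducing formula under the integral multiplies the integrand by conjugate
  coordinates. So Fock functions may be differentiated without loss of holomorphy, and the order
  of the derivatives is immaterial.
\<close>

lemma fock_foldr_partial:
  fixes F :: "complex ^ 'n \<Rightarrow> complex"
  assumes F: "F \<in> fock"
  shows "entire (foldr complex_partial is F)"
    and "foldr complex_partial is F = (\<lambda>w. LINT z|fock_measure.
      F z / of_real (fock_mass TYPE('n)) * (\<Prod>i\<in>#mset is. cnj (z $ i)) * exp (dot w (conjugate z)))"
proof -
  define G where "G z = F z / of_real (fock_mass TYPE('n))" for z
  define E where "E K w = (LINT z|fock_measure. K z * exp (dot w (conjugate z)))"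
    for K :: "complex ^ 'n \<Rightarrow> complex" and w
  have [measurable]: "F \<in> borel_measurable borel"
    using F by (simp add: fock_iff entire_measurable)
  have [measurable]: "G \<in> borel_measurable borel"
    unfolding G_def by measurable
  have mom: "integrable fock_measure (\<lambda>z. cmod (G z) * exp (R * norm (conjugate z)))" for R
    using l2_exponential_moments[of F R] F by (simp add: fock_iff G_def norm_divide)
  have FE: "F = E G"
    using fock_reproducing[OF F] fock_mass_pos[where 'n='n]
    by (simp add: fun_eq_iff E_def G_def)
  have M: "(\<lambda>z. \<Prod>i\<in>#mset is. cnj (z $ i)) \<in> borel_measurable borel" for "is" :: "'n list"
  proof -
    have c: "(\<lambda>z. cnj (z $ a)) \<in> borel_measurable borel" for a :: 'n
      by (intro borel_measurable_continuous_onI continuous_intros)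
    show ?thesis
      by (induction "is") (auto intro!: borel_measurable_times c)
  qed
  have "(\<lambda>z. G z * (\<Prod>i\<in>#mset is. cnj (z $ i))) \<in> borel_measurable borel
    \<and> (\<forall>R. integrable fock_measure (\<lambda>z. cmod (G z * (\<Prod>i\<in>#mset is. cnj (z $ i))) * exp (R * norm (conjugate z))))
    \<and> foldr complex_partial is F = E (\<lambda>z. G z * (\<Prod>i\<in>#mset is. cnj (z $ i)))
    \<and> entire (foldr complex_partial is F)"
  proof (induction "is")
    case Nil
    then show ?case
      using F FE mom by (simp add: fock_iff)
  next
    case (Cons i "is")
    let ?K = "\<lambda>z. G z * (\<Prod>i\<in>#mset is. cnj (z $ i))"
    have K: "?K \<in> borel_measurable fock_measure" "conjugate \<in> borel_measurable fock_measure"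
      "\<And>R. integrable fock_measure (\<lambda>z. cmod (?K z) * exp (R * norm (conjugate z)))"
      using Cons by (auto intro!: borel_measurable_continuous_onI continuous_intros)
    have eq: "G z * (\<Prod>i\<in>#mset (i # is). cnj (z $ i)) = ?K z * conjugate z $ i" for z
      by (simp add: mult_ac)
    have K': "(\<lambda>z. ?K z * conjugate z $ i) \<in> borel_measurable borel"
      using M[of "i # is"] unfolding eq[symmetric] by measurable
    have der: "complex_partial i (E ?K) = E (\<lambda>z. ?K z * conjugate z $ i)"
      unfolding E_def[abs_def] by (rule complex_partial_exponential_integral[OF K])
    have mom': "integrable fock_measure (\<lambda>z. cmod (?K z * conjugate z $ i) * exp (R * norm (conjugate z)))" for R
      by (rule integrable_exponential_component[OF K])
    have "entire (E (\<lambda>z. ?K z * conjugate z $ i))"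
      unfolding E_def[abs_def] by (rule entire_exponential_integral[OF _ K(2) mom']) (use K' in simp)
    then show ?case
      using Cons K' mom' der unfolding eq foldr_Cons o_apply by simp
  qed
  then have 1: "entire (foldr complex_partial is F)"
    and 2: "foldr complex_partial is F = E (\<lambda>z. G z * (\<Prod>i\<in>#mset is. cnj (z $ i)))"
    by auto
  show "entire (foldr complex_partial is F)" by (rule 1)
  show "foldr complex_partial is F = (\<lambda>w. LINT z|fock_measure.
      F z / of_real (fock_mass TYPE('n)) * (\<Prod>i\<in>#mset is. cnj (z $ i)) * exp (dot w (conjugate z)))"
    using 2 unfolding E_def[abs_def] G_def .
qed

lemma multi_deriv_word:
  fixes \<alpha> :: "'n::finite \<Rightarrow> nat"
  obtains "is" :: "'n list" where "length is = (\<Sum>i\<in>UNIV. \<alpha> i)" "\<And>i. count (mset is) i = \<alpha> i"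
    "\<And>(D :: 'n \<Rightarrow> 'f \<Rightarrow> 'f). multi_deriv D \<alpha> = foldr D is"
proof
  let ?is = "concat (map (\<lambda>i. replicate (\<alpha> i) i) (coords :: 'n list))"
  have "length (concat (map (\<lambda>i. replicate (\<alpha> i) i) xs)) = (\<Sum>i\<in>set xs. \<alpha> i)" if "distinct xs" for xs :: "'n list"
    using that by (induction xs) auto
  then show "length ?is = (\<Sum>i\<in>UNIV. \<alpha> i)"
    using coords by metis
  have cnt: "count (mset (concat (map (\<lambda>i. replicate (\<alpha> i) i) xs))) j = (if j \<in> set xs then \<alpha> j else 0)"
    if "distinct xs" for xs :: "'n list" and j
    using that by (induction xs) auto
  show "count (mset ?is) j = \<alpha> j" for j
    using cnt[OF coords(1), of j] coords(2)[where 'n='n] by simp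
  fix D :: "'n \<Rightarrow> 'f \<Rightarrow> 'f"
  have rep: "foldr D (replicate k i) = D i ^^ k" for i k
    by (induction k) auto
  have "foldr (\<lambda>i. D i ^^ \<alpha> i) xs = foldr D (concat (map (\<lambda>i. replicate (\<alpha> i) i) xs))" for xs :: "'n list"
    by (induction xs) (auto simp: rep fun_eq_iff)
  then show "multi_deriv D \<alpha> = foldr D ?is"
    by (simp add: multi_deriv_def fun_eq_iff)
qed

text \<open>
  The Fock-Sobolev condition, freed from the order fixed by \<open>coords\<close>: by the formula above, iterated
  derivatives depend only on the multiset of the directions.
\<close>

lemma fock_sobolev_words:
  assumes F: "F \<in> fock_sobolev m" and len: "length is \<le> m"
  shows "foldr complex_partial is F \<in> fock"
    and "fock_norm (foldr complex_partial is F) \<le> fock_sobolev_norm m F"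
proof -
  have z: "(\<lambda>_. 0) \<in> multi_indices m"
    by (simp add: multi_indices_def)
  have "multi_deriv complex_partial (\<lambda>_. 0) F = F"
  proof -
    obtain ns where "length ns = (\<Sum>i\<in>(UNIV :: 'a set). 0 :: nat)"
      "multi_deriv complex_partial (\<lambda>_. 0 :: nat) = foldr complex_partial (ns :: 'a list)"
      by (rule multi_deriv_word[of "\<lambda>_. 0"]) blast
    then show ?thesis by simp
  qed
  then have "F \<in> fock"
    using F z by (auto simp: fock_sobolev_def)
  define \<alpha> where "\<alpha> = count (mset is)"
  obtain js where js: "length js = (\<Sum>i\<in>UNIV. \<alpha> i)" "\<And>i. count (mset js) i = \<alpha> i"
    "multi_deriv complex_partial \<alpha> = foldr complex_partial js"
    by (rule multi_deriv_word[of \<alpha>]) blast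
  have "mset is = mset js"
    by (rule multiset_eqI) (simp add: js \<alpha>_def)
  then have eq: "multi_deriv complex_partial \<alpha> F = foldr complex_partial is F"
    by (simp only: js(3) fock_foldr_partial(2)[OF \<open>F \<in> fock\<close>])
  have "length js = length is"
    using \<open>mset is = mset js\<close> by (metis size_mset)
  then have \<alpha>: "\<alpha> \<in> multi_indices m"
    using js(1) len by (simp add: multi_indices_def)
  show "foldr complex_partial is F \<in> fock"
    using F \<alpha> eq by (auto simp: fock_sobolev_def)
  show "fock_norm (foldr complex_partial is F) \<le> fock_sobolev_norm m F"
    unfolding fock_sobolev_norm_def eq[symmetric]
    by (rule member_le_sum[OF \<alpha>]) (auto simp: finite_multi_indices fock_norm_eq l2_norm_nonneg)
qed

section \<open>The Bargmann kernel\<close>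

definition complexify :: "real ^ 'n \<Rightarrow> complex ^ 'n"
  where "complexify x = (\<chi> i. of_real (x $ i))"

definition real_part :: "complex ^ 'n \<Rightarrow> real ^ 'n"
  where "real_part z = (\<chi> i. Re (z $ i))"

definition bkernel :: "real ^ 'n \<Rightarrow> complex ^ 'n \<Rightarrow> complex"
  where "bkernel x z = exp (2 * dot (complexify x) z - of_real ((norm x)\<^sup>2) - dot z z / 2)"

lemma norm_power2_eq_sum: "(norm (x :: real ^ 'n))\<^sup>2 = (\<Sum>i\<in>UNIV. (x $ i)\<^sup>2)"
  by (simp add: norm_vec_def L2_set_def sum_nonneg)

lemma norm_power2_eq_sum_complex: "(norm (z :: complex ^ 'n))\<^sup>2 = (\<Sum>i\<in>UNIV. (Re (z $ i))\<^sup>2 + (Im (z $ i))\<^sup>2)"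
  by (simp add: norm_vec_def L2_set_def sum_nonneg cmod_power2)

lemma complexify_simps [simp]:
  "complexify (x + y) = complexify x + complexify y"
  "complexify (x - y) = complexify x - complexify y"
  "complexify (r *\<^sub>R x) = of_real r *s complexify x"
  "complexify x $ i = of_real (x $ i)"
  "norm (complexify x) = norm x"
  "dot (complexify x) (complexify y) = of_real (x \<bullet> y)"
  by (simp_all add: complexify_def vec_eq_iff norm_vec_def dot_def inner_vec_def)

lemma continuous_on_complexify [continuous_intros]:
  "continuous_on S f \<Longrightarrow> continuous_on S (\<lambda>x. complexify (f x))"
  unfolding complexify_def by (intro continuous_intros)

lemma continuous_on_bkernel [continuous_intros]:
  "continuous_on S f \<Longrightarrow> continuous_on S g \<Longrightarrow> continuous_on S (\<lambda>x. bkernel (f x) (g x))"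
  unfolding bkernel_def by (intro continuous_intros) auto

lemma bkernel_measurable [measurable]: "(\<lambda>x. bkernel x z) \<in> borel_measurable borel"
  by (intro borel_measurable_continuous_onI continuous_intros)

lemma complexify_measurable [measurable]: "complexify \<in> borel_measurable borel"
  by (intro borel_measurable_continuous_onI continuous_intros)

lemma bargmann_eq_bkernel:
  fixes f :: "real ^ 'n \<Rightarrow> complex"
  shows "bargmann f z = of_real ((2 / pi) powr (real CARD('n) / 4)) * (LINT x|lborel. f x * bkernel x z)"
proof -
  have "exp (2 * (\<Sum>i\<in>UNIV. of_real (x $ i) * z $ i) - (\<Sum>i\<in>UNIV. (of_real (x $ i))\<^sup>2) - (\<Sum>i\<in>UNIV. (z $ i)\<^sup>2) / 2)
      = bkernel x z" for x
  proof -
    have "dot z z = (\<Sum>i\<in>UNIV. (z $ i)\<^sup>2)" "dot (complexify x) z = (\<Sum>i\<in>UNIV. of_real (x $ i) * z $ i)"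
      by (simp_all add: dot_def power2_eq_square)
    moreover have "of_real ((norm x)\<^sup>2) = (\<Sum>i\<in>UNIV. (of_real (x $ i) :: complex)\<^sup>2)"
      by (simp only: norm_power2_eq_sum of_real_sum of_real_power)
    ultimately show ?thesis
      by (simp only: bkernel_def)
  qed
  then show ?thesis by (simp add: bargmann_def)
qed

lemma norm_bkernel: "cmod (bkernel x z) = exp ((norm z)\<^sup>2 / 2 - (norm (x - real_part z))\<^sup>2)"
proof -
  have "Re (dot (complexify x) z) = x \<bullet> real_part z"
    by (simp add: dot_def real_part_def inner_vec_def)
  moreover have "Re (dot z z) = 2 * (norm (real_part z))\<^sup>2 - (norm z)\<^sup>2"
    unfolding norm_power2_eq_sum norm_power2_eq_sum_complex
    by (simp add: dot_def real_part_def power2_eq_square sum.distrib sum_subtractf)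
  moreover have "(norm (x - real_part z))\<^sup>2 = (norm x)\<^sup>2 + (norm (real_part z))\<^sup>2 - 2 * (x \<bullet> real_part z)"
    by (simp add: power2_norm_eq_inner inner_diff inner_commute)
  ultimately show ?thesis
    by (simp add: bkernel_def diff_divide_distrib)
qed

lemma norm_real_part_le: "norm (real_part z) \<le> norm z"
proof (rule power2_le_imp_le)
  show "(norm (real_part z))\<^sup>2 \<le> (norm z)\<^sup>2"
    unfolding norm_power2_eq_sum norm_power2_eq_sum_complex by (auto simp: real_part_def intro: sum_mono)
qed simp

lemma norm_bkernel_le: "cmod (bkernel x z) \<le> exp (3 / 2 * (norm z)\<^sup>2 - (norm x)\<^sup>2 / 2)"
proof -
  have "norm x \<le> norm (x - real_part z) + norm z"
    using norm_triangle_sub[of x "real_part z"] norm_real_part_le[of z] by linarith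
  then have "(norm x)\<^sup>2 \<le> (norm (x - real_part z) + norm z)\<^sup>2"
    by (intro power_mono) auto
  also have "\<dots> \<le> 2 * (norm (x - real_part z))\<^sup>2 + 2 * (norm z)\<^sup>2"
    using sum_squares_bound[of "norm (x - real_part z)" "norm z"] by (simp add: power2_sum)
  finally show ?thesis
    by (simp add: norm_bkernel)
qed

definition gaussian_l2_norm :: "'n::finite itself \<Rightarrow> real"
  where "gaussian_l2_norm n = sqrt (LINT x::real ^ 'n|lborel. exp (- 2 * (norm x)\<^sup>2))"

lemma bkernel_l2:
  fixes z :: "complex ^ 'n"
  shows "(\<lambda>x. bkernel x z) \<in> l2 lborel"
    and "l2_norm lborel (\<lambda>x. bkernel x z) = gaussian_l2_norm TYPE('n) * exp ((norm z)\<^sup>2 / 2)"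
proof -
  have eq: "(cmod (bkernel x z))\<^sup>2 = exp ((norm z)\<^sup>2) * exp (- 2 * (norm (x + - real_part z))\<^sup>2)" for x
    by (simp add: norm_bkernel exp_double[symmetric] flip: exp_add)
  show "(\<lambda>x. bkernel x z) \<in> l2 lborel"
    unfolding l2_def mem_Collect_eq eq
    using integrable_translation[OF integrable_gaussian[of 2], of "- real_part z"] by simp
  have "(LINT x|lborel. (cmod (bkernel x z))\<^sup>2) = exp ((norm z)\<^sup>2) * (LINT x::real ^ 'n|lborel. exp (- 2 * (norm x)\<^sup>2))"
    unfolding eq by (subst integral_mult_right_zero, subst integral_translation) auto
  moreover have "sqrt (exp t) = exp (t / 2)" for t
    by (rule real_sqrt_unique) (simp_all add: power2_eq_square flip: exp_add)
  ultimately show "l2_norm lborel (\<lambda>x. bkernel x z) = gaussian_l2_norm TYPE('n) * exp ((norm z)\<^sup>2 / 2)"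
    by (simp add: l2_norm_def gaussian_l2_norm_def real_sqrt_mult mult.commute)
qed

lemma bargmann_growth:
  fixes z :: "complex ^ 'n"
  assumes "f \<in> l2 lborel"
  shows "cmod (bargmann f z) \<le> (2 / pi) powr (real CARD('n) / 4) * gaussian_l2_norm TYPE('n) * l2_norm lborel f * exp ((norm z)\<^sup>2 / 2)"
proof -
  have "cmod (LINT x|lborel. f x * bkernel x z) \<le> l2_norm lborel f * (gaussian_l2_norm TYPE('n) * exp ((norm z)\<^sup>2 / 2))"
    using l2_Cauchy_Schwarz[OF assms bkernel_l2(1)] by (simp add: bkernel_l2(2))
  then have "(2 / pi) powr (real CARD('n) / 4) * cmod (LINT x|lborel. f x * bkernel x z)
      \<le> (2 / pi) powr (real CARD('n) / 4) * (l2_norm lborel f * (gaussian_l2_norm TYPE('n) * exp ((norm z)\<^sup>2 / 2)))"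
    by (intro mult_left_mono) auto
  then show ?thesis
    by (simp add: bargmann_eq_bkernel norm_mult mult_ac)
qed

subsection \<open>Gaussian integrals with complex parameters\<close>

definition gaussian_integral :: "real \<Rightarrow> 'n::finite itself \<Rightarrow> real"
  where "gaussian_integral s n = (LINT x::real ^ 'n|lborel. exp (- s * (norm x)\<^sup>2))"

lemma gaussian_integral_pos:
  assumes "0 < s"
  shows "0 < gaussian_integral s TYPE('n::finite)"
proof -
  have "\<not> (AE x::real ^ 'n in lborel. exp (- s * (norm x)\<^sup>2) = 0)"
  proof
    assume "AE x::real ^ 'n in lborel. exp (- s * (norm x)\<^sup>2) = 0"
    then have "(UNIV :: (real ^ 'n) set) \<in> null_sets lborel"
      using AE_iff_null[of lborel "\<lambda>_ :: real ^ 'n. False"] by simp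
    then show False
      by (simp add: null_sets_def emeasure_lborel_UNIV)
  qed
  then have "gaussian_integral s TYPE('n) \<noteq> 0"
    unfolding gaussian_integral_def
    by (subst integral_nonneg_eq_0_iff_AE) (auto simp: integrable_gaussian[OF assms, simplified])
  moreover have "0 \<le> gaussian_integral s TYPE('n)"
    unfolding gaussian_integral_def by (intro integral_nonneg_AE) auto
  ultimately show ?thesis by simp
qed

text \<open>
  For a real parameter, complete the square and translate. Both sides are holomorphic along the
  complex line through \<open>A\<close> with direction \<open>B\<close> and agree at its real points, so they agree at \<open>A + \<i> B\<close>.
\<close>

lemma complex_gaussian_integral:
  fixes \<zeta> :: "complex ^ 'n"
  assumes s: "0 < s"
  shows "integrable lborel (\<lambda>x :: real ^ 'n. exp (2 * dot (complexify x) \<zeta> - of_real (s * (norm x)\<^sup>2)))"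
    and "(LINT x|lborel. exp (2 * dot (complexify x) \<zeta> - of_real (s * (norm x)\<^sup>2)))
      = of_real (gaussian_integral s TYPE('n)) * exp (dot \<zeta> \<zeta> / of_real s)"
proof -
  define G :: "real ^ 'n \<Rightarrow> complex" where "G x = of_real (exp (- s * (norm x)\<^sup>2))" for x
  define p :: "real ^ 'n \<Rightarrow> complex ^ 'n" where "p x = complexify (2 *\<^sub>R x)" for x
  define E where "E w = (LINT x|lborel. G x * exp (dot w (p x)))" for w
  have Gp: "G \<in> borel_measurable lborel" "p \<in> borel_measurable lborel"
    "integrable lborel (\<lambda>x. cmod (G x) * exp (R * norm (p x)))" for R
  proof -
    have "(\<lambda>x. cmod (G x) * exp (R * norm (p x))) = (\<lambda>x. exp ((2 * R) * norm x - s * (norm x)\<^sup>2))"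
      by (simp add: G_def p_def fun_eq_iff flip: exp_add complexify_simps(3))
    then show "integrable lborel (\<lambda>x. cmod (G x) * exp (R * norm (p x)))"
      by (simp only: integrable_exp_linear_gaussian[OF s])
    show "G \<in> borel_measurable lborel"
      unfolding G_def[abs_def] by measurable
    show "p \<in> borel_measurable lborel"
      unfolding p_def[abs_def] by (simp del: complexify_simps(3))
  qed
  have form: "G x * exp (dot w (p x)) = exp (2 * dot (complexify x) w - of_real (s * (norm x)\<^sup>2))" for x w
    by (simp add: G_def p_def dot_simps dot_commute[of w] exp_of_real[symmetric] del: exp_of_real flip: exp_add)
  have entE: "entire E"
    unfolding E_def by (rule entire_exponential_integral[OF Gp])
  have real: "E (complexify a) = of_real (gaussian_integral s TYPE('n)) * exp (dot (complexify a) (complexify a) / of_real s)" for a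
  proof -
    have sq: "2 * (x \<bullet> a) - s * (norm x)\<^sup>2 = (a \<bullet> a) / s - s * (norm (x + - (1/s) *\<^sub>R a))\<^sup>2" for x
      using s by (simp add: power2_norm_eq_inner inner_diff inner_add field_simps inner_commute)
    have "E (complexify a) = (LINT x|lborel. of_real (exp ((a \<bullet> a) / s) * exp (- s * (norm (x + - (1/s) *\<^sub>R a))\<^sup>2)))"
      unfolding E_def form
    proof (rule Bochner_Integration.integral_cong[OF refl])
      fix x :: "real ^ 'n"
      have "exp (2 * dot (complexify x) (complexify a) - of_real (s * (norm x)\<^sup>2)) = (of_real (exp (2 * (x \<bullet> a) - s * (norm x)\<^sup>2)) :: complex)"
        by (simp add: exp_of_real[symmetric])
      also have "exp (2 * (x \<bullet> a) - s * (norm x)\<^sup>2) = exp ((a \<bullet> a) / s) * exp (- s * (norm (x + - (1/s) *\<^sub>R a))\<^sup>2)"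
        unfolding sq by (simp flip: exp_add)
      finally show "exp (2 * dot (complexify x) (complexify a) - of_real (s * (norm x)\<^sup>2))
          = of_real (exp ((a \<bullet> a) / s) * exp (- s * (norm (x + - (1/s) *\<^sub>R a))\<^sup>2))" .
    qed
    also have "\<dots> = of_real (exp ((a \<bullet> a) / s) * (LINT x|lborel. exp (- s * (norm (x + - (1/s) *\<^sub>R a))\<^sup>2)))"
      by (subst integral_complex_of_real) simp
    also have "(LINT x|lborel. exp (- s * (norm (x + - (1/s) *\<^sub>R a))\<^sup>2)) = gaussian_integral s TYPE('n)"
      unfolding gaussian_integral_def by (rule integral_translation) simp
    finally show ?thesis
      by (simp add: exp_of_real[symmetric])
  qed
  have "E \<zeta> = of_real (gaussian_integral s TYPE('n)) * exp (dot \<zeta> \<zeta> / of_real s)"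
  proof -
    define u v where "u = complexify (real_part \<zeta>)" and "v = complexify (\<chi> i. Im (\<zeta> $ i))"
    have \<zeta>: "\<zeta> = u + \<i> *s v"
      by (simp add: u_def v_def real_part_def vec_eq_iff complex_eq_iff)
    define h where "h t = E (u + t *s v) - of_real (gaussian_integral s TYPE('n)) *
      exp ((dot u u + 2 * t * dot u v + t\<^sup>2 * dot v v) / of_real s)" for t
    have dd: "dot (u + t *s v) (u + t *s v) = dot u u + 2 * t * dot u v + t\<^sup>2 * dot v v" for t
      by (simp add: dot_simps dot_commute[of v u] power2_eq_square algebra_simps)
    have "h \<i> = 0"
    proof (rule analytic_continuation[of h UNIV "range complex_of_real" 0])
      have "(\<lambda>t. E (u + t *s v)) holomorphic_on UNIV"
        using entire_line_derivative[OF entE, of u v] by (auto simp: holomorphic_on_def field_differentiable_def)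
      then show "h holomorphic_on UNIV"
        unfolding h_def[abs_def] using s by (intro holomorphic_intros) auto
      show "0 islimpt range complex_of_real"
        unfolding islimpt_approachable
      proof (intro allI impI)
        fix e :: real assume "e > 0"
        then show "\<exists>x'\<in>range complex_of_real. x' \<noteq> 0 \<and> dist x' 0 < e"
          by (intro bexI[OF _ rangeI[of _ "e/2"]]) (auto simp: norm_divide)
      qed
      show "h t = 0" if "t \<in> range complex_of_real" for t
      proof -
        from that obtain r where r: "t = of_real r" by (elim rangeE)
        have "u + t *s v = complexify (real_part \<zeta> + r *\<^sub>R (\<chi> i. Im (\<zeta> $ i)))"
          by (simp add: r u_def v_def)
        then have "E (u + t *s v) = of_real (gaussian_integral s TYPE('n)) * exp (dot (u + t *s v) (u + t *s v) / of_real s)"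
          using real by metis
        then show ?thesis by (simp add: h_def dd)
      qed
    qed auto
    then show ?thesis
      unfolding h_def \<zeta> dd by simp
  qed
  then show "(LINT x|lborel. exp (2 * dot (complexify x) \<zeta> - of_real (s * (norm x)\<^sup>2)))
      = of_real (gaussian_integral s TYPE('n)) * exp (dot \<zeta> \<zeta> / of_real s)"
    by (simp only: E_def form)
  show "integrable lborel (\<lambda>x :: real ^ 'n. exp (2 * dot (complexify x) \<zeta> - of_real (s * (norm x)\<^sup>2)))"
    using integrable_exponential[OF Gp, of \<zeta>] by (simp only: form)
qed

text \<open>
  Composing the kernel with its adjoint (replace \<open>z\<close> by \<open>conjugate z\<close>) gives the reproducing kernel
  \<open>exp (dot w (conjugate z))\<close>; this makes the adjoint of the transform its inverse.
\<close>

lemma integral_bkernel_mult_bkernel: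
  fixes w z :: "complex ^ 'n"
  shows "(LINT x|lborel. bkernel x z * bkernel x w) = of_real (gaussian_integral 2 TYPE('n)) * exp (dot w z)"
proof -
  have "(2 * dot (complexify x) z - of_real ((norm x)\<^sup>2) - dot z z / 2) + (2 * dot (complexify x) w - of_real ((norm x)\<^sup>2) - dot w w / 2)
      = (2 * dot (complexify x) (z + w) - of_real (2 * (norm x)\<^sup>2)) + - (dot z z + dot w w) / 2" for x
    by (simp add: dot_simps field_simps)
  then have k: "bkernel x z * bkernel x w = exp (2 * dot (complexify x) (z + w) - of_real (2 * (norm x)\<^sup>2)) * exp (- (dot z z + dot w w) / 2)" for x
    unfolding bkernel_def exp_add[symmetric] by (rule arg_cong)
  have e: "dot (z + w) (z + w) / 2 + - (dot z z + dot w w) / 2 = dot w z"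
    by (simp add: dot_simps dot_commute[of z w] field_simps)
  have "(LINT x|lborel. bkernel x z * bkernel x w)
      = (of_real (gaussian_integral 2 TYPE('n)) * exp (dot (z + w) (z + w) / 2)) * exp (- (dot z z + dot w w) / 2)"
    unfolding k using complex_gaussian_integral(2)[of 2 "z + w"] by simp
  also have "\<dots> = of_real (gaussian_integral 2 TYPE('n)) * exp (dot w z)"
    unfolding mult.assoc exp_add[symmetric] e ..
  finally show ?thesis .
qed

section \<open>The Bargmann transform is onto\<close>

lemma finite_measure_fock_measure: "finite_measure (fock_measure :: (complex ^ 'n) measure)"
proof
  have "integrable fock_measure (\<lambda>z :: complex ^ 'n. 1 :: real)"
    using integrable_exp_linear_fock_measure[of 0] by simp
  then show "emeasure (fock_measure :: (complex ^ 'n) measure) (space fock_measure) \<noteq> \<infinity>"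
    by (simp add: integrable_iff_bounded)
qed

interpretation fock: finite_measure fock_measure
  by (rule finite_measure_fock_measure)

interpretation lborel_fock: pair_sigma_finite lborel fock_measure ..

lemma borel_measurable_lborel_fock:
  "borel_measurable (lborel \<Otimes>\<^sub>M (fock_measure :: (complex ^ 'n) measure))
    = borel_measurable (borel :: ('a::euclidean_space \<times> (complex ^ 'n)) measure)"
proof (rule measurable_cong_sets)
  have "sets (lborel \<Otimes>\<^sub>M (fock_measure :: (complex ^ 'n) measure)) = sets (borel \<Otimes>\<^sub>M (borel :: (complex ^ 'n) measure) :: ('a \<times> _) measure)"
    by (rule sets_pair_measure_cong) simp_all
  then show "sets (lborel \<Otimes>\<^sub>M (fock_measure :: (complex ^ 'n) measure)) = sets (borel :: ('a \<times> (complex ^ 'n)) measure)"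
    unfolding borel_prod .
qed simp

text \<open>
  The formal adjoint of the transform, up to a constant factor; the integral converges absolutely
  when \<open>G\<close> is bounded with bounded support.
\<close>

definition bargmann_adjoint :: "(complex ^ 'n \<Rightarrow> complex) \<Rightarrow> real ^ 'n \<Rightarrow> complex"
  where "bargmann_adjoint G x = (LINT z|fock_measure. G z * bkernel x (conjugate z))"

lemma cnj_bkernel: "cnj (bkernel x z) = bkernel x (conjugate z)"
proof -
  have "conjugate (complexify x) = complexify x"
    by (simp add: conjugate_def complexify_def)
  then show ?thesis
    by (simp add: bkernel_def cnj_dot exp_cnj)
qed

lemma norm_integral_le_nn_integral:
  fixes f :: "'a \<Rightarrow> 'b::{banach,second_countable_topology}"
  shows "ennreal (norm (LINT x|M. f x)) \<le> (\<integral>\<^sup>+x. ennreal (norm (f x)) \<partial>M)"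
  using integral_norm_bound_ennreal[of M f] by (cases "integrable M f") (auto simp: not_integrable_integral_eq)

text \<open>
  Schur's test: against the Gaussian measure the reproducing kernel has absolute value
  \<open>exp (- |z - w|\<^sup>2 / 2)\<close>, and \<open>2 a b \<le> a\<^sup>2 + b\<^sup>2\<close> removes the double integral.
\<close>

lemma schur_exp_dot:
  fixes G :: "complex ^ 'n \<Rightarrow> complex"
  assumes [measurable]: "G \<in> borel_measurable borel" and G: "G \<in> l2 fock_measure"
  shows "(\<integral>\<^sup>+w. (\<integral>\<^sup>+z. ennreal (cmod (G w) * cmod (G z) * cmod (exp (dot w (conjugate z)))) \<partial>fock_measure) \<partial>fock_measure)
    \<le> ennreal ((LINT u::complex ^ 'n|lborel. exp (- (1/2) * (norm u)\<^sup>2)) / pi ^ CARD('n) * (l2_norm fock_measure G)\<^sup>2)"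
proof -
  define P where "P = pi ^ CARD('n)"
  have P: "0 < P" by (simp add: P_def)
  define \<kappa> where "\<kappa> = (LINT u::complex ^ 'n|lborel. exp (- (1/2) * (norm u)\<^sup>2))"
  have \<kappa>0: "0 \<le> \<kappa>"
    unfolding \<kappa>_def by (intro integral_nonneg_AE) auto
  define q where "q z = exp (- (norm z)\<^sup>2) * (cmod (G z))\<^sup>2 / 2" for z
  have q0: "0 \<le> q z" for z by (simp add: q_def)
  have [measurable]: "q \<in> borel_measurable borel"
    unfolding q_def[abs_def] by measurable
  define k where "k w z = exp (- (1/2) * (norm (w + - z))\<^sup>2)" for w z :: "complex ^ 'n"
  have km [measurable]: "(\<lambda>(w, z). k w z) \<in> borel_measurable (lborel \<Otimes>\<^sub>M lborel)"
    unfolding k_def[abs_def] lborel_prod by (auto intro!: borel_measurable_continuous_onI continuous_intros simp: case_prod_beta)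
  have kI: "(\<integral>\<^sup>+w. ennreal (k w z) \<partial>lborel) = ennreal \<kappa>" for z
  proof -
    have "integrable lborel (\<lambda>w. k w z)"
      unfolding k_def by (intro integrable_translation[of "\<lambda>w. exp (- (1/2) * (norm w)\<^sup>2)"] integrable_gaussian) simp
    then have "(\<integral>\<^sup>+w. ennreal (k w z) \<partial>lborel) = ennreal (LINT w|lborel. k w z)"
      by (intro nn_integral_eq_integral) (auto simp: k_def)
    also have "(LINT w|lborel. k w z) = \<kappa>"
      unfolding k_def \<kappa>_def by (rule integral_translation) simp
    finally show ?thesis .
  qed
  have ksym: "k w z = k z w" for w z
    by (simp add: k_def norm_minus_commute)
  have bound: "gaussian_weight w * (gaussian_weight z * (cmod (G w) * cmod (G z) * cmod (exp (dot w (conjugate z)))))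
      \<le> (q w + q z) * k w z / P\<^sup>2" for w z
  proof -
    have "(norm (w + - z))\<^sup>2 = (norm w)\<^sup>2 + (norm z)\<^sup>2 - 2 * Re (dot w (conjugate z))"
    proof -
      have "complex_of_real ((norm (w + - z))\<^sup>2) = of_real ((norm w)\<^sup>2) + of_real ((norm z)\<^sup>2) - (dot w (conjugate z) + cnj (dot w (conjugate z)))"
        unfolding dot_conjugate[symmetric] cnj_dot by (simp add: dot_simps dot_commute[of "conjugate w"])
      also have "\<dots> = of_real ((norm w)\<^sup>2 + (norm z)\<^sup>2 - 2 * Re (dot w (conjugate z)))"
        by (simp add: complex_add_cnj)
      finally show ?thesis by (simp only: of_real_eq_iff)
    qed
    then have e: "- (norm w)\<^sup>2 + - (norm z)\<^sup>2 + Re (dot w (conjugate z)) = - (norm w)\<^sup>2 / 2 + - (norm z)\<^sup>2 / 2 + - (1/2) * (norm (w + - z))\<^sup>2"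
      by (simp add: diff_divide_distrib add_divide_distrib)
    have "gaussian_weight w * (gaussian_weight z * (cmod (G w) * cmod (G z) * cmod (exp (dot w (conjugate z)))))
      = (cmod (G w) * cmod (G z)) * exp (- (norm w)\<^sup>2 + - (norm z)\<^sup>2 + Re (dot w (conjugate z))) / P\<^sup>2"
      unfolding exp_add by (simp add: gaussian_weight_def P_def power2_eq_square)
    also have "\<dots> = ((exp (- (norm w)\<^sup>2 / 2) * cmod (G w)) * (exp (- (norm z)\<^sup>2 / 2) * cmod (G z))) * k w z / P\<^sup>2"
      unfolding e exp_add k_def by simp
    also have "\<dots> \<le> (q w + q z) * k w z / P\<^sup>2"
    proof (intro divide_right_mono mult_right_mono)
      have sq: "(exp (- (norm y)\<^sup>2 / 2) * cmod (G y))\<^sup>2 / 2 = q y" for y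
        by (simp add: q_def power_mult_distrib exp_double[symmetric])
      show "(exp (- (norm w)\<^sup>2 / 2) * cmod (G w)) * (exp (- (norm z)\<^sup>2 / 2) * cmod (G z)) \<le> q w + q z"
        using sum_squares_bound[of "exp (- (norm w)\<^sup>2 / 2) * cmod (G w)" "exp (- (norm z)\<^sup>2 / 2) * cmod (G z)"]
        unfolding sq[symmetric] by (simp add: field_simps)
    qed (auto simp: k_def)
    finally show ?thesis .
  qed
  have qI: "(\<integral>\<^sup>+z. ennreal (q z) \<partial>lborel) = ennreal (P * (l2_norm fock_measure G)\<^sup>2 / 2)"
  proof -
    have gi: "integrable lborel (\<lambda>z. gaussian_weight z *\<^sub>R (cmod (G z))\<^sup>2)"
      using l2_integrable[OF G] by (subst (asm) integrable_fock_measure) measurable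
    have q: "q z = P / 2 * (gaussian_weight z *\<^sub>R (cmod (G z))\<^sup>2)" for z
      by (simp add: q_def gaussian_weight_def P_def)
    have "(\<integral>\<^sup>+z. ennreal (q z) \<partial>lborel) = ennreal (LINT z|lborel. q z)"
    proof (rule nn_integral_eq_integral)
      show "integrable lborel (\<lambda>z. q z)"
        unfolding q by (intro integrable_mult_right gi)
    qed (simp add: q0)
    also have "(LINT z|lborel. q z) = P / 2 * (LINT z|fock_measure. (cmod (G z))\<^sup>2)"
      unfolding q by (subst integral_mult_right_zero, subst integral_fock_measure) auto
    finally show ?thesis
      by (simp add: l2_norm_power2)
  qed
  have "(\<integral>\<^sup>+w. (\<integral>\<^sup>+z. ennreal (cmod (G w) * cmod (G z) * cmod (exp (dot w (conjugate z)))) \<partial>fock_measure) \<partial>fock_measure)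
      = (\<integral>\<^sup>+w. (\<integral>\<^sup>+z. ennreal (gaussian_weight w * (gaussian_weight z * (cmod (G w) * cmod (G z) * cmod (exp (dot w (conjugate z)))))) \<partial>lborel) \<partial>lborel)"
    unfolding fock_measure_eq
    by (simp add: nn_integral_density gaussian_weight_pos less_imp_le ennreal_mult flip: nn_integral_cmult del: norm_exp_eq_Re)
  also have "\<dots> \<le> (\<integral>\<^sup>+w. (\<integral>\<^sup>+z. ennreal (1 / P\<^sup>2) * (ennreal (q w) * ennreal (k w z) + ennreal (q z) * ennreal (k w z)) \<partial>lborel) \<partial>lborel)"
  proof (intro nn_integral_mono)
    fix w z
    have "ennreal (gaussian_weight w * (gaussian_weight z * (cmod (G w) * cmod (G z) * cmod (exp (dot w (conjugate z))))))
        \<le> ennreal ((q w + q z) * k w z / P\<^sup>2)"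
      by (rule ennreal_leI[OF bound])
    also have "\<dots> = ennreal (1 / P\<^sup>2 * (q w * k w z + q z * k w z))"
      by (simp add: field_simps)
    also have "\<dots> = ennreal (1 / P\<^sup>2) * (ennreal (q w) * ennreal (k w z) + ennreal (q z) * ennreal (k w z))"
    proof -
      have "0 \<le> k w z" by (simp add: k_def)
      then show ?thesis
        using q0[of w] q0[of z] P by (simp only: ennreal_mult ennreal_plus mult_nonneg_nonneg add_nonneg_nonneg zero_le_divide_1_iff zero_le_power2)
    qed
    finally show "ennreal (gaussian_weight w * (gaussian_weight z * (cmod (G w) * cmod (G z) * cmod (exp (dot w (conjugate z))))))
        \<le> ennreal (1 / P\<^sup>2) * (ennreal (q w) * ennreal (k w z) + ennreal (q z) * ennreal (k w z))" .
  qed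
  also have "\<dots> = ennreal (1 / P\<^sup>2) * ((\<integral>\<^sup>+w. (\<integral>\<^sup>+z. ennreal (q w) * ennreal (k w z) \<partial>lborel) \<partial>lborel)
      + (\<integral>\<^sup>+w. (\<integral>\<^sup>+z. ennreal (q z) * ennreal (k w z) \<partial>lborel) \<partial>lborel))"
    by (simp add: nn_integral_cmult nn_integral_add)
  also have "(\<integral>\<^sup>+w. (\<integral>\<^sup>+z. ennreal (q w) * ennreal (k w z) \<partial>lborel) \<partial>lborel) = ennreal \<kappa> * (\<integral>\<^sup>+w. ennreal (q w) \<partial>lborel)"
    by (subst ksym) (simp add: nn_integral_cmult kI mult.commute)
  also have "(\<integral>\<^sup>+w. (\<integral>\<^sup>+z. ennreal (q z) * ennreal (k w z) \<partial>lborel) \<partial>lborel)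
      = (\<integral>\<^sup>+z. (\<integral>\<^sup>+w. ennreal (q z) * ennreal (k w z) \<partial>lborel) \<partial>lborel)"
    by (rule lborel_pair.Fubini') measurable
  also have "\<dots> = ennreal \<kappa> * (\<integral>\<^sup>+w. ennreal (q w) \<partial>lborel)"
    by (simp add: nn_integral_cmult kI mult.commute)
  also have "ennreal (1 / P\<^sup>2) * (ennreal \<kappa> * (\<integral>\<^sup>+w. ennreal (q w) \<partial>lborel) + ennreal \<kappa> * (\<integral>\<^sup>+w. ennreal (q w) \<partial>lborel))
      = ennreal (1 / P\<^sup>2 * (\<kappa> * (P * (l2_norm fock_measure G)\<^sup>2 / 2) + \<kappa> * (P * (l2_norm fock_measure G)\<^sup>2 / 2)))"
  proof -
    define X where "X = P * (l2_norm fock_measure G)\<^sup>2 / 2"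
    have "0 \<le> X" using P by (simp add: X_def)
    then show ?thesis
      unfolding qI X_def[symmetric] using \<kappa>0
      by (simp only: ennreal_mult ennreal_plus mult_nonneg_nonneg add_nonneg_nonneg zero_le_divide_1_iff zero_le_power2)
  qed
  also have "1 / P\<^sup>2 * (\<kappa> * (P * (l2_norm fock_measure G)\<^sup>2 / 2) + \<kappa> * (P * (l2_norm fock_measure G)\<^sup>2 / 2)) = \<kappa> / P * (l2_norm fock_measure G)\<^sup>2"
    using P by (simp add: field_simps power2_eq_square)
  finally show ?thesis
    by (simp only: P_def \<kappa>_def)
qed

definition adjoint_bound :: "'n::finite itself \<Rightarrow> real"
  where "adjoint_bound n = sqrt (gaussian_integral 2 TYPE('n) *
    ((LINT u::complex ^ 'n|lborel. exp (- (1/2) * (norm u)\<^sup>2)) / pi ^ CARD('n)))"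

text \<open>
  Exchanging the integrals, the transform of the adjoint of \<open>G\<close> is the integral of \<open>G\<close> against the
  reproducing kernel. Doing this once more, the squared norm of the adjoint is the pairing of \<open>G\<close>
  with that integral, which Schur's test bounds by a multiple of the squared norm of \<open>G\<close>.
\<close>

lemma bargmann_adjoint:
  fixes G :: "complex ^ 'n \<Rightarrow> complex"
  assumes m [measurable]: "G \<in> borel_measurable borel" and B: "\<And>z. cmod (G z) \<le> B" and R: "\<And>z. R < norm z \<Longrightarrow> G z = 0"
  shows "bargmann_adjoint G \<in> l2 lborel"
    and "(LINT x|lborel. bargmann_adjoint G x * bkernel x w)
      = of_real (gaussian_integral 2 TYPE('n)) * (LINT z|fock_measure. G z * exp (dot w (conjugate z)))"
    and "l2_norm lborel (bargmann_adjoint G) \<le> adjoint_bound TYPE('n) * l2_norm fock_measure G"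
proof -
  have B0: "0 \<le> B" using B[of 0] norm_ge_zero[of "G 0"] by linarith
  define c where "c = B * exp (3/2 * R\<^sup>2)"
  have Gk: "cmod (G z * bkernel x (conjugate z)) \<le> c * exp (- (1/2) * (norm x)\<^sup>2)" for x z
  proof (cases "R < norm z")
    case True
    then show ?thesis using R B0 by (simp add: c_def)
  next
    case False
    then have "(norm z)\<^sup>2 \<le> R\<^sup>2" by (intro power_mono) auto
    then have "cmod (bkernel x (conjugate z)) \<le> exp (3/2 * R\<^sup>2 - (norm x)\<^sup>2 / 2)"
      using norm_bkernel_le[of x "conjugate z"] by (auto elim!: order_trans)
    then have "cmod (G z) * cmod (bkernel x (conjugate z)) \<le> B * exp (3/2 * R\<^sup>2 - (norm x)\<^sup>2 / 2)"
      using B B0 by (intro mult_mono) auto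
    also have "\<dots> = c * exp (- (1/2) * (norm x)\<^sup>2)"
      by (simp add: c_def mult.assoc flip: exp_add)
    finally show ?thesis by (simp add: norm_mult)
  qed
  have meas: "(\<lambda>(x, z). G z * bkernel x (conjugate z)) \<in> borel_measurable (lborel \<Otimes>\<^sub>M fock_measure)"
    unfolding borel_measurable_lborel_fock
  proof -
    have 1: "(\<lambda>p. G (snd p)) \<in> borel_measurable (borel :: ((real ^ 'n) \<times> (complex ^ 'n)) measure)"
      by (rule measurable_compose[OF _ m]) (intro borel_measurable_continuous_onI continuous_intros)
    have 2: "(\<lambda>p. bkernel (fst p) (conjugate (snd p))) \<in> borel_measurable (borel :: ((real ^ 'n) \<times> (complex ^ 'n)) measure)"
      by (intro borel_measurable_continuous_onI continuous_intros)
    show "(\<lambda>(x, z). G z * bkernel x (conjugate z)) \<in> borel_measurable (borel :: ((real ^ 'n) \<times> (complex ^ 'n)) measure)"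
      using borel_measurable_times[OF 1 2] by (simp add: case_prod_beta)
  qed
  have pair: "integrable (lborel \<Otimes>\<^sub>M fock_measure) (\<lambda>(x, z). h x * (G z * bkernel x (conjugate z)))"
    if hm [measurable]: "h \<in> borel_measurable borel" and D: "\<And>x. cmod (h x) \<le> D" for h D
  proof -
    have D0: "0 \<le> D" using D[of 0] norm_ge_zero[of "h 0"] by linarith
    have hm': "(\<lambda>p. h (fst p)) \<in> borel_measurable (lborel \<Otimes>\<^sub>M fock_measure)"
      by measurable
    have bd: "integrable (lborel \<Otimes>\<^sub>M fock_measure) (\<lambda>(x :: real ^ 'n, z :: complex ^ 'n). D * (c * exp (- (1/2) * (norm x)\<^sup>2)))"
    proof (rule lborel_fock.Fubini_integrable)
      have "integrable lborel (\<lambda>x :: real ^ 'n. norm (D * (c * exp (- (1/2) * (norm x)\<^sup>2))) * measure fock_measure (UNIV :: (complex ^ 'n) set))"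
        by (intro integrable_mult_left integrable_norm integrable_mult_right integrable_gaussian) simp
      then show "integrable lborel (\<lambda>x :: real ^ 'n. LINT z|(fock_measure :: (complex ^ 'n) measure).
          norm (case (x, z) of (x, z) \<Rightarrow> D * (c * exp (- (1/2) * (norm x)\<^sup>2))))"
        by (simp add: mult.commute)
      show "(\<lambda>(x :: real ^ 'n, z :: complex ^ 'n). D * (c * exp (- (1/2) * (norm x)\<^sup>2))) \<in> borel_measurable (lborel \<Otimes>\<^sub>M fock_measure)"
        unfolding borel_measurable_lborel_fock case_prod_beta
        by (intro borel_measurable_continuous_onI continuous_intros)
    qed simp
    have le: "cmod (h x * (G z * bkernel x (conjugate z))) \<le> D * (c * exp (- (1/2) * (norm x)\<^sup>2))" for x z
      unfolding norm_mult[of "h x"] by (intro mult_mono D Gk D0) auto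
    show ?thesis
    proof (rule Bochner_Integration.integrable_bound[OF bd])
      show "(\<lambda>(x, z). h x * (G z * bkernel x (conjugate z))) \<in> borel_measurable (lborel \<Otimes>\<^sub>M fock_measure)"
        using borel_measurable_times[OF hm' meas] by (simp add: case_prod_beta)
      show "AE p in lborel \<Otimes>\<^sub>M fock_measure. norm (case p of (x, z) \<Rightarrow> h x * (G z * bkernel x (conjugate z)))
          \<le> norm (case p of (x, z) \<Rightarrow> D * (c * exp (- (1/2) * (norm x)\<^sup>2)))"
        using le by (auto intro!: AE_I2 order_trans[OF _ abs_ge_self])
    qed
  qed
  have Am: "bargmann_adjoint G \<in> borel_measurable borel"
  proof -
    have "(\<lambda>x. LINT z|fock_measure. G z * bkernel x (conjugate z)) \<in> borel_measurable lborel"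
      by (rule fock.borel_measurable_lebesgue_integral) (rule meas)
    then show ?thesis by (simp add: bargmann_adjoint_def[abs_def])
  qed
  define \<mu> where "\<mu> = measure fock_measure (UNIV :: (complex ^ 'n) set)"
  have A: "cmod (bargmann_adjoint G x) \<le> \<mu> * c * exp (- (1/2) * (norm x)\<^sup>2)" for x
  proof -
    have "cmod (bargmann_adjoint G x) \<le> (LINT z|fock_measure. cmod (G z * bkernel x (conjugate z)))"
      unfolding bargmann_adjoint_def by (rule integral_norm_bound)
    also have "\<dots> \<le> (LINT z::complex ^ 'n|fock_measure. c * exp (- (1/2) * (norm x)\<^sup>2))"
    proof (rule integral_mono)
      have "(\<lambda>z. G z * bkernel x (conjugate z)) \<in> borel_measurable borel"
        by (intro borel_measurable_times m borel_measurable_continuous_onI continuous_intros)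
      then have "integrable fock_measure (\<lambda>z. G z * bkernel x (conjugate z))"
        using Gk by (intro fock.integrable_const_bound[of _ "c * exp (- (1/2) * (norm x)\<^sup>2)"]) auto
      then show "integrable fock_measure (\<lambda>z. cmod (G z * bkernel x (conjugate z)))"
        by (rule integrable_norm)
    qed (use Gk in auto)
    also have "\<dots> = \<mu> * c * exp (- (1/2) * (norm x)\<^sup>2)"
      by (simp add: \<mu>_def)
    finally show ?thesis .
  qed
  have gl2: "(\<lambda>x :: real ^ 'n. of_real (\<mu> * c * exp (- (1/2) * (norm x)\<^sup>2))) \<in> l2 lborel"
  proof -
    have "(cmod (of_real (\<mu> * c * exp (- (1/2) * (norm x)\<^sup>2))))\<^sup>2 = (\<mu> * c)\<^sup>2 * exp (- 1 * (norm x)\<^sup>2)" for x :: "real ^ 'n"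
      by (simp add: norm_mult power_mult_distrib exp_double[symmetric])
    then show ?thesis
      using integrable_gaussian[of 1, where 'a="real ^ 'n"] by (auto simp: l2_def intro!: integrable_mult_right)
  qed
  show Al2: "bargmann_adjoint G \<in> l2 lborel"
    by (rule l2_bound[OF gl2]) (use Am A in \<open>auto intro!: AE_I2 order_trans[OF A] simp del: of_real_mult\<close>)
  have Ab: "cmod (bargmann_adjoint G x) \<le> \<mu> * c" for x
  proof -
    have "0 \<le> \<mu> * c" using B0 by (simp add: \<mu>_def c_def)
    then have "\<mu> * c * exp (- (1/2) * (norm x)\<^sup>2) \<le> \<mu> * c * 1"
      by (intro mult_left_mono) auto
    then show ?thesis using A[of x] by simp
  qed
  have kb: "cmod (bkernel x w) \<le> exp (3/2 * (norm w)\<^sup>2)" for x :: "real ^ 'n" and w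
    using norm_bkernel_le[of x w] by (rule order_trans) auto
  show BA: "(LINT x|lborel. bargmann_adjoint G x * bkernel x w)
      = of_real (gaussian_integral 2 TYPE('n)) * (LINT z|fock_measure. G z * exp (dot w (conjugate z)))" for w
  proof -
    have "(LINT x|lborel. bargmann_adjoint G x * bkernel x w)
        = (LINT x|lborel. (LINT z|fock_measure. bkernel x w * (G z * bkernel x (conjugate z))))"
      by (simp add: bargmann_adjoint_def mult.commute[of _ "bkernel _ w"])
    also have "\<dots> = (LINT z|fock_measure. (LINT x|lborel. bkernel x w * (G z * bkernel x (conjugate z))))"
      by (rule lborel_fock.Fubini_integral[symmetric]) (rule pair[OF bkernel_measurable kb])
    also have "\<dots> = (LINT z|fock_measure. G z * (LINT x|lborel. bkernel x (conjugate z) * bkernel x w))"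
      by (subst integral_mult_right_zero[symmetric]) (simp add: mult_ac)
    also have "\<dots> = of_real (gaussian_integral 2 TYPE('n)) * (LINT z|fock_measure. G z * exp (dot w (conjugate z)))"
      unfolding integral_bkernel_mult_bkernel by (subst integral_mult_right_zero[symmetric]) (simp add: mult_ac)
    finally show ?thesis .
  qed
  have Gl2: "G \<in> l2 fock_measure"
    unfolding l2_def
  proof (intro CollectI conjI)
    show "integrable fock_measure (\<lambda>z. (cmod (G z))\<^sup>2)"
      using B by (intro fock.integrable_const_bound[of _ "B\<^sup>2"]) (auto intro!: AE_I2 power_mono)
  qed simp
  define PG where "PG w = (LINT z|fock_measure. G z * exp (dot w (conjugate z)))" for w
  have "of_real ((l2_norm lborel (bargmann_adjoint G))\<^sup>2) = (LINT x|lborel. cnj (bargmann_adjoint G x) * bargmann_adjoint G x)"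
    unfolding l2_norm_power2 integral_complex_of_real[symmetric] complex_norm_square by (simp add: mult.commute)
  also have "\<dots> = cnj (LINT x|lborel. cnj (bargmann_adjoint G x) * bargmann_adjoint G x)"
    by (subst Bochner_Integration.integral_cnj[symmetric]) (simp add: mult.commute)
  also have "(LINT x|lborel. cnj (bargmann_adjoint G x) * bargmann_adjoint G x)
      = (LINT x|lborel. (LINT z|fock_measure. cnj (bargmann_adjoint G x) * (G z * bkernel x (conjugate z))))"
    by (simp add: bargmann_adjoint_def)
  also have "\<dots> = (LINT z|fock_measure. (LINT x|lborel. cnj (bargmann_adjoint G x) * (G z * bkernel x (conjugate z))))"
  proof (rule lborel_fock.Fubini_integral[symmetric], rule pair[of _ "\<mu> * c"])
    show "(\<lambda>x. cnj (bargmann_adjoint G x)) \<in> borel_measurable borel"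
      by (rule measurable_compose[OF Am]) (intro borel_measurable_continuous_onI continuous_intros)
  qed (simp add: Ab)
  also have "\<dots> = (LINT z|fock_measure. G z * cnj (LINT x|lborel. bargmann_adjoint G x * bkernel x z))"
    by (simp add: cnj_bkernel[symmetric] mult_ac flip: Bochner_Integration.integral_cnj integral_mult_right_zero)
  also have "\<dots> = (LINT z|fock_measure. of_real (gaussian_integral 2 TYPE('n)) * (G z * cnj (PG z)))"
    unfolding BA PG_def by (simp add: mult_ac)
  also have "cnj \<dots> = of_real (gaussian_integral 2 TYPE('n)) * cnj (LINT z|fock_measure. G z * cnj (PG z))"
    by simp
  finally have "cmod (of_real ((l2_norm lborel (bargmann_adjoint G))\<^sup>2)) = cmod (of_real (gaussian_integral 2 TYPE('n)) * cnj (LINT z|fock_measure. G z * cnj (PG z)))"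
    by simp
  then have norm_eq: "(l2_norm lborel (bargmann_adjoint G))\<^sup>2 = gaussian_integral 2 TYPE('n) * cmod (LINT z|fock_measure. G z * cnj (PG z))"
    using gaussian_integral_pos[of 2, where 'n='n] by (simp add: norm_mult norm_power l2_norm_nonneg)
  define K where "K = (LINT u::complex ^ 'n|lborel. exp (- (1/2) * (norm u)\<^sup>2)) / pi ^ CARD('n)"
  have K0: "0 \<le> K"
    unfolding K_def by (intro divide_nonneg_nonneg integral_nonneg_AE) auto
  have "ennreal (cmod (LINT w|fock_measure. G w * cnj (PG w))) \<le> (\<integral>\<^sup>+w. ennreal (cmod (G w)) * ennreal (cmod (PG w)) \<partial>fock_measure)"
    using norm_integral_le_nn_integral[of fock_measure "\<lambda>w. G w * cnj (PG w)"] by (simp add: norm_mult ennreal_mult)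
  also have "\<dots> \<le> (\<integral>\<^sup>+w. ennreal (cmod (G w)) * (\<integral>\<^sup>+z. ennreal (cmod (G z) * cmod (exp (dot w (conjugate z)))) \<partial>fock_measure) \<partial>fock_measure)"
    unfolding PG_def norm_mult[symmetric]
    by (intro nn_integral_mono mult_left_mono norm_integral_le_nn_integral) auto
  also have "\<dots> = (\<integral>\<^sup>+w. (\<integral>\<^sup>+z. ennreal (cmod (G w) * cmod (G z) * cmod (exp (dot w (conjugate z)))) \<partial>fock_measure) \<partial>fock_measure)"
    by (subst nn_integral_cmult[symmetric]) (auto simp: ennreal_mult mult.assoc simp del: norm_exp_eq_Re)
  also have "\<dots> \<le> ennreal (K * (l2_norm fock_measure G)\<^sup>2)"
    unfolding K_def by (rule schur_exp_dot[OF m Gl2])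
  finally have "cmod (LINT w|fock_measure. G w * cnj (PG w)) \<le> K * (l2_norm fock_measure G)\<^sup>2"
    using K0 by (simp add: ennreal_le_iff)
  then have "(l2_norm lborel (bargmann_adjoint G))\<^sup>2 \<le> gaussian_integral 2 TYPE('n) * (K * (l2_norm fock_measure G)\<^sup>2)"
    unfolding norm_eq using gaussian_integral_pos[of 2, where 'n='n] by (intro mult_left_mono) auto
  also have "\<dots> = (adjoint_bound TYPE('n) * l2_norm fock_measure G)\<^sup>2"
    unfolding adjoint_bound_def K_def[symmetric] power_mult_distrib
    using K0 gaussian_integral_pos[of 2, where 'n='n] by simp
  finally show "l2_norm lborel (bargmann_adjoint G) \<le> adjoint_bound TYPE('n) * l2_norm fock_measure G"
    by (rule power2_le_imp_le)
      (use K0 gaussian_integral_pos[of 2, where 'n='n] in \<open>auto simp: adjoint_bound_def K_def[symmetric] l2_norm_nonneg\<close>)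
qed

text \<open>
  The adjoint inverts the transform on truncations of \<open>F\<close>, by the reproducing formula. The radii
  \<open>R k\<close> are chosen such that the pieces between consecutive radii decay geometrically; their
  preimages then add up to a square-integrable function.
\<close>

lemma bargmann_onto:
  fixes F :: "complex ^ 'n \<Rightarrow> complex"
  assumes F: "F \<in> fock"
  shows "\<exists>f\<in>l2 lborel. (\<forall>w. (LINT x|lborel. f x * bkernel x w)
        = of_real (gaussian_integral 2 TYPE('n) * fock_mass TYPE('n)) * F w)
      \<and> l2_norm lborel f \<le> 2 * (adjoint_bound TYPE('n) * l2_norm fock_measure F)"
proof -
  have ent: "entire F" and Fl2: "F \<in> l2 fock_measure"
    using F by (auto simp: fock_iff)
  have [measurable]: "F \<in> borel_measurable borel"
    by (rule entire_measurable[OF ent])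
  define N where "N = l2_norm fock_measure F"
  have N0: "0 \<le> N" by (simp add: N_def l2_norm_nonneg)
  define tail where "tail r = (LINT z|fock_measure. indicator {z. r \<le> norm z} z * (cmod (F z))\<^sup>2)" for r :: real
  have ind_m [measurable]: "{z. r \<le> norm z} \<in> sets (borel :: (complex ^ 'n) measure)" for r
    by (intro borel_closed closed_Collect_le continuous_intros)
  have tail_int: "integrable fock_measure (\<lambda>z. indicator {z. r \<le> norm z} z * (cmod (F z))\<^sup>2)" for r
    using integrable_mult_indicator[OF _ l2_integrable[OF Fl2], of "{z. r \<le> norm z}"] by simp
  have tail_lim: "(\<lambda>k. tail (real k)) \<longlonglongrightarrow> 0"
  proof -
    have "(\<lambda>k. tail (real k)) \<longlonglongrightarrow> (LINT z::complex ^ 'n|fock_measure. 0)"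
      unfolding tail_def
    proof (rule integral_dominated_convergence)
      show "integrable fock_measure (\<lambda>z. (cmod (F z))\<^sup>2)"
        by (rule l2_integrable[OF Fl2])
      show "AE z in fock_measure. (\<lambda>k. indicator {z. real k \<le> norm z} z * (cmod (F z))\<^sup>2) \<longlonglongrightarrow> 0"
      proof (rule AE_I2)
        fix z :: "complex ^ 'n"
        obtain K where "norm z < real K"
          using reals_Archimedean2 by blast
        then have "eventually (\<lambda>k. indicator {z. real k \<le> norm z} z * (cmod (F z))\<^sup>2 = 0) sequentially"
          by (intro eventually_sequentiallyI[of K]) (auto simp: indicator_def)
        then show "(\<lambda>k. indicator {z. real k \<le> norm z} z * (cmod (F z))\<^sup>2) \<longlonglongrightarrow> 0"
          by (rule tendsto_eventually)
      qed
    qed (auto simp: indicator_def)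
    then show ?thesis by simp
  qed
  have tail_le: "tail r \<le> N\<^sup>2" for r
    unfolding tail_def N_def l2_norm_power2
    by (intro integral_mono tail_int l2_integrable[OF Fl2]) (auto simp: indicator_def)
  have "\<exists>r. real k \<le> r \<and> tail r \<le> (N * (1/2)^k)\<^sup>2 \<and> (k = 0 \<longrightarrow> r = 0)" for k
  proof (cases "k = 0 \<or> N = 0")
    case True
    then show ?thesis
      using tail_le[of "real k"] by (intro exI[of _ "real k"]) auto
  next
    case False
    then have "0 < (N * (1/2)^k)\<^sup>2" using N0 by simp
    then have "eventually (\<lambda>j. tail (real j) < (N * (1/2)^k)\<^sup>2) sequentially"
      using tail_lim by (simp add: order_tendstoD)
    then obtain J where "\<And>j. J \<le> j \<Longrightarrow> tail (real j) < (N * (1/2)^k)\<^sup>2"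
      by (auto simp: eventually_sequentially)
    then have "tail (real (max J k)) < (N * (1/2)^k)\<^sup>2" by simp
    then show ?thesis
      using False by (intro exI[of _ "real (max J k)"]) auto
  qed
  then obtain R where R: "\<And>k. real k \<le> R k" "\<And>k. tail (R k) \<le> (N * (1/2)^k)\<^sup>2" "R 0 = 0"
    by metis
  define T where "T k z = F z * indicator (ball 0 (R k)) z" for k z
  define G where "G k z = T (Suc k) z - T k z" for k z
  have [measurable]: "ball 0 r \<in> sets (borel :: (complex ^ 'n) measure)" for r
    by simp
  have Gm: "G k \<in> borel_measurable borel" for k
    unfolding G_def[abs_def] T_def by measurable
  have Gz: "G k z = 0" if "max (R k) (R (Suc k)) < norm z" for k z
    using that by (simp add: G_def T_def indicator_def)
  have G_le: "cmod (G k z) \<le> cmod (F z)" for k z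
    by (simp add: G_def T_def indicator_def)
  have "\<exists>B. \<forall>z. cmod (G k z) \<le> B" for k
  proof -
    let ?M = "max (R k) (R (Suc k))"
    have "compact (F ` cball 0 ?M)"
      by (intro compact_continuous_image entire_continuous ent) simp
    from compact_imp_bounded[OF this] obtain B where "0 < B" "\<forall>y\<in>F ` cball 0 ?M. cmod y \<le> B"
      unfolding bounded_pos by blast
    then have B: "0 < B" "\<And>z. z \<in> cball 0 ?M \<Longrightarrow> cmod (F z) \<le> B"
      by auto
    have "cmod (G k z) \<le> B" for z
      using B(1) B(2)[of z] G_le[of k z] Gz[of k z] by (cases "?M < norm z") auto
    then show ?thesis by blast
  qed
  then obtain B where B: "\<And>k z. cmod (G k z) \<le> B k" by metis
  note adj = bargmann_adjoint[where G="G k" and B="B k" and R="max (R k) (R (Suc k))" for k, OF Gm B Gz]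
  have Gl2: "G k \<in> l2 fock_measure" for k
    using Gm G_le by (intro l2_bound[OF Fl2]) auto
  have Gnorm: "l2_norm fock_measure (G k) \<le> N * (1/2)^k" for k
  proof -
    define r where "r = min (R k) (R (Suc k))"
    have "(cmod (G k z))\<^sup>2 \<le> indicator {z. r \<le> norm z} z * (cmod (F z))\<^sup>2" for z
      by (auto simp: G_def T_def indicator_def r_def)
    then have "(l2_norm fock_measure (G k))\<^sup>2 \<le> tail r"
      unfolding tail_def l2_norm_power2
      by (intro integral_mono tail_int l2_integrable[OF Gl2]) auto
    also have "tail r \<le> (N * (1/2)^k)\<^sup>2"
    proof -
      have "(N * (1/2)^Suc k)\<^sup>2 \<le> (N * (1/2)^k)\<^sup>2"
        using N0 by (intro power_mono mult_left_mono) auto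
      then show ?thesis
        using R(2)[of k] R(2)[of "Suc k"] by (auto simp: r_def min_def)
    qed
    finally show ?thesis
      by (rule power2_le_imp_le) (use N0 in simp)
  qed
  define v where "v k x = 2^k * bargmann_adjoint (G k) x" for k x
  have vl2: "v k \<in> l2 lborel" for k
    unfolding v_def[abs_def] by (intro l2_cmult adj)
  have A0: "0 \<le> adjoint_bound TYPE('n)"
    unfolding adjoint_bound_def using gaussian_integral_pos[of 2, where 'n='n]
    by (intro real_sqrt_ge_zero mult_nonneg_nonneg divide_nonneg_nonneg integral_nonneg_AE) auto
  have vnorm: "l2_norm lborel (v k) \<le> adjoint_bound TYPE('n) * N" for k
  proof -
    have "l2_norm lborel (v k) = 2^k * l2_norm lborel (bargmann_adjoint (G k))"
      unfolding v_def[abs_def] l2_norm_cmult by (simp add: norm_power)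
    also have "\<dots> \<le> 2^k * (adjoint_bound TYPE('n) * (N * (1/2)^k))"
      using adj(3)[of k] mult_left_mono[OF Gnorm[of k] A0] by (intro mult_left_mono) auto
    also have "\<dots> = adjoint_bound TYPE('n) * N"
      by (simp add: power_divide)
    finally show ?thesis .
  qed
  obtain f where f: "f \<in> l2 lborel" "l2_norm lborel f \<le> 2 * (adjoint_bound TYPE('n) * N)"
    "\<And>h. h \<in> l2 lborel \<Longrightarrow> (\<lambda>k. (1/2)^k * (LINT x|lborel. v k x * h x)) sums (LINT x|lborel. f x * h x)"
    by (rule l2_weighted_series[where v=v and M=lborel, OF vl2 vnorm]) blast
  show ?thesis
  proof (intro bexI[OF _ f(1)] conjI allI)
    show "l2_norm lborel f \<le> 2 * (adjoint_bound TYPE('n) * l2_norm fock_measure F)"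
      using f(2) by (simp add: N_def)
    fix w :: "complex ^ 'n"
    define e where "e z = exp (dot w (conjugate z))" for z
    have Fe: "integrable fock_measure (\<lambda>z. F z * e z)"
      unfolding e_def by (rule l2_mult_integrable[OF Fl2 exp_dot_l2])
    have em [measurable]: "e \<in> borel_measurable borel"
      unfolding e_def[abs_def] by (intro borel_measurable_continuous_onI continuous_intros)
    have Te: "integrable fock_measure (\<lambda>z. T k z * e z)" for k
      by (rule Bochner_Integration.integrable_bound[OF Fe]) (auto simp: T_def norm_mult indicator_def)
    have piece: "(1/2)^k * (LINT x|lborel. v k x * bkernel x w)
        = of_real (gaussian_integral 2 TYPE('n)) * ((LINT z|fock_measure. T (Suc k) z * e z) - (LINT z|fock_measure. T k z * e z))" for k
    proof -
      have "(1/2)^k * (LINT x|lborel. v k x * bkernel x w) = (1/2)^k * (2^k * (LINT x|lborel. bargmann_adjoint (G k) x * bkernel x w))"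
        unfolding v_def by (simp add: mult.assoc)
      also have "\<dots> = (LINT x|lborel. bargmann_adjoint (G k) x * bkernel x w)"
        by (simp add: power_divide)
      also have "\<dots> = of_real (gaussian_integral 2 TYPE('n)) * (LINT z|fock_measure. T (Suc k) z * e z - T k z * e z)"
        using adj(2)[of k w] by (simp add: G_def e_def left_diff_distrib)
      also have "(LINT z|fock_measure. T (Suc k) z * e z - T k z * e z) = (LINT z|fock_measure. T (Suc k) z * e z) - (LINT z|fock_measure. T k z * e z)"
        by (rule Bochner_Integration.integral_diff[OF Te Te])
      finally show ?thesis .
    qed
    have T0: "T 0 z = 0" for z by (simp add: T_def R(3))
    have "(\<lambda>k. LINT z|fock_measure. T k z * e z) \<longlonglongrightarrow> (LINT z|fock_measure. F z * e z)"
    proof (rule integral_dominated_convergence)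
      show "integrable fock_measure (\<lambda>z. cmod (F z * e z))"
        by (rule integrable_norm[OF Fe])
      show "AE z in fock_measure. (\<lambda>k. T k z * e z) \<longlonglongrightarrow> F z * e z"
      proof (rule AE_I2)
        fix z :: "complex ^ 'n"
        obtain K where K: "norm z < real K"
          using reals_Archimedean2 by blast
        have "norm z < R k" if "K \<le> k" for k
          using that K R(1)[of k] by linarith
        then have "eventually (\<lambda>k. T k z * e z = F z * e z) sequentially"
          by (intro eventually_sequentiallyI[of K]) (auto simp: T_def indicator_def)
        then show "(\<lambda>k. T k z * e z) \<longlonglongrightarrow> F z * e z"
          by (rule tendsto_eventually)
      qed
      show "AE z in fock_measure. cmod (T k z * e z) \<le> cmod (F z * e z)" for k
        by (auto simp: T_def norm_mult indicator_def)
    qed (auto simp: T_def)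
    from telescope_sums[OF this]
    have "(\<lambda>k. (LINT z|fock_measure. T (Suc k) z * e z) - (LINT z|fock_measure. T k z * e z)) sums (LINT z|fock_measure. F z * e z)"
      by (simp add: T0)
    from sums_mult[OF this, of "of_real (gaussian_integral 2 TYPE('n))"]
    have "(\<lambda>k. (1/2)^k * (LINT x|lborel. v k x * bkernel x w)) sums (of_real (gaussian_integral 2 TYPE('n)) * (LINT z|fock_measure. F z * e z))"
      by (simp only: piece)
    moreover have "(\<lambda>k. (1/2)^k * (LINT x|lborel. v k x * bkernel x w)) sums (LINT x|lborel. f x * bkernel x w)"
      by (rule f(3)[OF bkernel_l2(1)])
    ultimately have "(LINT x|lborel. f x * bkernel x w) = of_real (gaussian_integral 2 TYPE('n)) * (LINT z|fock_measure. F z * e z)"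
      by (rule sums_unique2[symmetric])
    also have "(LINT z|fock_measure. F z * e z) = of_real (fock_mass TYPE('n)) * F w"
      unfolding e_def by (rule fock_reproducing[OF F])
    finally show "(LINT x|lborel. f x * bkernel x w) = of_real (gaussian_integral 2 TYPE('n) * fock_mass TYPE('n)) * F w"
      by simp
  qed
qed

text \<open>
  The bound for the adjoint, doubled by the geometric series and divided by the factor in
  \<open>bargmann_onto\<close> and the constant in front of the transform.
\<close>

definition inverse_bound :: "'n::finite itself \<Rightarrow> real" where
  "inverse_bound n = 2 * adjoint_bound TYPE('n) /
    ((2 / pi) powr (real CARD('n) / 4) * (gaussian_integral 2 TYPE('n) * fock_mass TYPE('n)))"

theorem bargmann_surjective:
  fixes F :: "complex ^ 'n \<Rightarrow> complex"
  assumes F: "F \<in> fock"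
  obtains f where "f \<in> l2 lborel" "bargmann f = F"
    "l2_norm lborel f \<le> inverse_bound TYPE('n) * fock_norm F"
proof -
  obtain f where f: "f \<in> l2 lborel" "\<And>w. (LINT x|lborel. f x * bkernel x w)
        = of_real (gaussian_integral 2 TYPE('n) * fock_mass TYPE('n)) * F w"
      "l2_norm lborel f \<le> 2 * (adjoint_bound TYPE('n) * l2_norm fock_measure F)"
    using bargmann_onto[OF F] by blast
  define c where "c = (2 / pi) powr (real CARD('n) / 4) * (gaussian_integral 2 TYPE('n) * fock_mass TYPE('n))"
  have c: "0 < c"
    using fock_mass_pos[where 'n='n] gaussian_integral_pos[of 2, where 'n='n] by (simp add: c_def)
  show thesis
  proof
    show "(\<lambda>x. of_real (1 / c) * f x) \<in> l2 lborel"
      by (rule l2_cmult[OF f(1)])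
    show "bargmann (\<lambda>x. of_real (1 / c) * f x) = F"
    proof
      fix w
      have "bargmann (\<lambda>x. of_real (1 / c) * f x) w = of_real (1 / c) * (of_real ((2 / pi) powr (real CARD('n) / 4)) * (LINT x|lborel. f x * bkernel x w))"
        unfolding bargmann_eq_bkernel by (simp add: mult.assoc)
      also have "\<dots> = of_real (1 / c * c) * F w"
        unfolding f(2) c_def by (simp only: of_real_mult mult.assoc)
      finally show "bargmann (\<lambda>x. of_real (1 / c) * f x) w = F w"
        using c by simp
    qed
    have "l2_norm lborel (\<lambda>x. of_real (1 / c) * f x) = l2_norm lborel f / c"
      unfolding l2_norm_cmult using c by (simp add: norm_divide)
    also have "\<dots> \<le> 2 * (adjoint_bound TYPE('n) * l2_norm fock_measure F) / c"
      using f(3) c by (intro divide_right_mono) auto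
    finally show "l2_norm lborel (\<lambda>x. of_real (1 / c) * f x) \<le> inverse_bound TYPE('n) * fock_norm F"
      by (simp add: inverse_bound_def c_def fock_norm_eq)
  qed
qed

section \<open>The Bargmann transform is injective\<close>

lemma integral_scaled:
  fixes f :: "'a::euclidean_space \<Rightarrow> 'b::{banach,second_countable_topology}"
  assumes [measurable]: "f \<in> borel_measurable borel" and t: "0 < t"
  shows "(LINT u|lborel. f (x + t *\<^sub>R u)) = (1 / t ^ DIM('a)) *\<^sub>R (LINT y|lborel. f y)"
proof -
  have "(LINT y|lborel. f y) = (LINT y|density (distr lborel borel (\<lambda>u. x + t *\<^sub>R u)) (\<lambda>_. ennreal (t ^ DIM('a))). f y)"
    using lborel_affine[of t x] t by simp
  also have "\<dots> = t ^ DIM('a) *\<^sub>R (LINT u|lborel. f (x + t *\<^sub>R u))"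
    using t by (subst integral_density) (auto simp: integral_distr)
  finally show ?thesis
    using t by simp
qed

text \<open>
  Vanishing of the transform at the imaginary points says that the Fourier transform of
  \<open>g x = f x * exp (- |x|\<^sup>2)\<close> vanishes. Integrated against Gaussians of width \<open>1 / t\<close>, this
  shows that \<open>g\<close> annihilates all Gaussian mollifications of test functions at scale \<open>t\<close>, and \<open>t\<close>
  tends to \<open>0\<close>.
\<close>

theorem bargmann_injective:
  fixes f :: "real ^ 'n \<Rightarrow> complex"
  assumes f: "f \<in> l2 lborel" and z: "\<And>w. bargmann f w = 0"
  shows "AE x in lborel. f x = 0"
proof -
  define g where "g x = f x * of_real (exp (- (norm x)\<^sup>2))" for x
  have fm [measurable]: "f \<in> borel_measurable borel"
    using l2_measurable[OF f] by simp
  have gm [measurable]: "g \<in> borel_measurable borel"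
    unfolding g_def[abs_def] by measurable
  have "(\<lambda>x :: real ^ 'n. complex_of_real (exp (- (norm x)\<^sup>2))) \<in> l2 lborel"
    using integrable_gaussian[of 2, where 'a="real ^ 'n"] by (simp add: l2_def exp_double[symmetric])
  then have gi: "integrable lborel g"
    unfolding g_def by (rule l2_mult_integrable[OF f])
  have gz: "(LINT x|lborel. g x * exp (2 * dot (complexify x) w)) = 0" for w
  proof -
    have "(LINT x|lborel. f x * bkernel x w) = 0"
      using z[of w] by (simp add: bargmann_eq_bkernel)
    moreover have "f x * bkernel x w = exp (- dot w w / 2) * (g x * exp (2 * dot (complexify x) w))" for x
    proof -
      have "bkernel x w = exp (- dot w w / 2) * (exp (- of_real ((norm x)\<^sup>2)) * exp (2 * dot (complexify x) w))"
        by (simp add: bkernel_def algebra_simps flip: exp_add)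
      moreover have "complex_of_real (exp (- (norm x)\<^sup>2)) = exp (- of_real ((norm x)\<^sup>2))"
        by (simp only: exp_of_real[symmetric] of_real_minus)
      ultimately show ?thesis
        by (simp only: g_def mult_ac)
    qed
    ultimately show ?thesis by simp
  qed
  define \<kappa> where "\<kappa> = gaussian_integral 1 TYPE('n)"
  have \<kappa>: "0 < \<kappa>" unfolding \<kappa>_def by (rule gaussian_integral_pos) simp
  have gauss: "(LINT x|lborel. g x * of_real (exp (- (norm ((1/t) *\<^sub>R (y - x)))\<^sup>2))) = 0" if t: "0 < t" for t y
  proof -
    define p where "p b u = exp (2 * dot (complexify b) (\<i> *s complexify u) - of_real (1 * (norm b)\<^sup>2))" for b u :: "real ^ 'n"
    have p: "(LINT b|lborel. p b u) = of_real \<kappa> * of_real (exp (- (norm u)\<^sup>2))" for u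
      unfolding p_def \<kappa>_def
      by (subst complex_gaussian_integral(2)) (simp_all add: dot_simps power2_norm_eq_inner exp_of_real[symmetric])
    have pn: "cmod (p b u) = exp (- 1 * (norm b)\<^sup>2)" for b u
      by (simp add: p_def dot_simps)
    have pi: "integrable (lborel \<Otimes>\<^sub>M lborel) (\<lambda>(x, b). g x * p b ((1/t) *\<^sub>R (y - x)))"
    proof (rule lborel_pair.Fubini_integrable)
      have 1: "(\<lambda>q. g (fst q)) \<in> borel_measurable (borel :: ((real ^ 'n) \<times> (real ^ 'n)) measure)"
        by (rule measurable_compose[OF _ gm]) (intro borel_measurable_continuous_onI continuous_intros)
      have 2: "(\<lambda>q. p (snd q) ((1/t) *\<^sub>R (y - fst q))) \<in> borel_measurable (borel :: ((real ^ 'n) \<times> (real ^ 'n)) measure)"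
        unfolding p_def vector_scalar_mult_def by (intro borel_measurable_continuous_onI continuous_intros)
      show "(\<lambda>(x, b). g x * p b ((1/t) *\<^sub>R (y - x))) \<in> borel_measurable (lborel \<Otimes>\<^sub>M lborel)"
        using borel_measurable_times[OF 1 2] by (simp add: lborel_prod case_prod_beta)
      show "integrable lborel (\<lambda>x. LINT b|lborel. norm (case (x, b) of (x, b) \<Rightarrow> g x * p b ((1/t) *\<^sub>R (y - x))))"
        using gi by (simp add: norm_mult pn)
      have "integrable lborel (\<lambda>b. p b u)" for u
        unfolding p_def by (rule complex_gaussian_integral(1)) simp
      then show "AE x in lborel. integrable lborel (\<lambda>b. case (x, b) of (x, b) \<Rightarrow> g x * p b ((1/t) *\<^sub>R (y - x)))"
        by simp
    qed
    have "of_real \<kappa> * (LINT x|lborel. g x * of_real (exp (- (norm ((1/t) *\<^sub>R (y - x)))\<^sup>2)))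
        = (LINT x|lborel. (LINT b|lborel. g x * p b ((1/t) *\<^sub>R (y - x))))"
    proof -
      have "(LINT b|lborel. g x * p b ((1/t) *\<^sub>R (y - x))) = of_real \<kappa> * (g x * of_real (exp (- (norm ((1/t) *\<^sub>R (y - x)))\<^sup>2)))" for x
        unfolding integral_mult_right_zero p by (simp only: mult_ac)
      then show ?thesis
        by (simp only: integral_mult_right_zero)
    qed
    also have "\<dots> = (LINT b|lborel. (LINT x|lborel. g x * p b ((1/t) *\<^sub>R (y - x))))"
      by (rule lborel_pair.Fubini_integral[symmetric, OF pi])
    also have "\<dots> = (LINT b|lborel. p b ((1/t) *\<^sub>R y) * (LINT x|lborel. g x * exp (2 * dot (complexify x) (- (\<i> / of_real t) *s complexify b))))"
    proof -
      have "g x * p b ((1/t) *\<^sub>R (y - x)) = p b ((1/t) *\<^sub>R y) * (g x * exp (2 * dot (complexify x) (- (\<i> / of_real t) *s complexify b)))" for x b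
        by (simp add: p_def dot_simps inner_commute inner_diff algebra_simps diff_divide_distrib flip: exp_add)
      then show ?thesis
        by (simp only: integral_mult_right_zero)
    qed
    also have "\<dots> = 0"
      unfolding gz by simp
    finally show ?thesis using \<kappa> by simp
  qed
  have "AE x in lborel. g x = 0"
  proof (rule AE_eq_0_if_test_integrals_eq_0[OF gm])
    show "integrable lborel (\<lambda>x. indicator (box a b) x * g x)" for a b :: "real ^ 'n"
      by (rule Bochner_Integration.integrable_bound[OF gi]) (auto simp: norm_mult indicator_def)
    fix \<phi> :: "real ^ 'n \<Rightarrow> complex" assume \<phi>: "\<phi> \<in> test_functions"
    have \<phi>m [measurable]: "\<phi> \<in> borel_measurable borel"
      by (rule test_function_measurable[OF \<phi>])
    obtain M where M: "0 < M" "\<And>x. cmod (\<phi> x) \<le> M"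
      using test_function_bounded[OF \<phi>] by metis
    have \<phi>i: "integrable lborel \<phi>"
    proof -
      obtain C R where CR: "0 < C" "\<And>x. cmod (\<phi> x) \<le> C" "\<And>x. R < norm x \<Longrightarrow> \<phi> x = 0"
        using test_function_bounded[OF \<phi>] by metis
      have "integrable lborel (indicator (cball 0 R) :: real ^ 'n \<Rightarrow> real)"
        by (intro integrable_real_indicator) (use emeasure_lborel_cball_finite[of "0 :: real ^ 'n" R] in auto)
      then have "integrable lborel (\<lambda>x :: real ^ 'n. C * indicator (cball 0 R) x)"
        by (rule integrable_mult_right)
      moreover have "cmod (\<phi> x) \<le> norm (C * indicator (cball 0 R) x)" for x
        using CR(1) CR(2)[of x] CR(3)[of x] by (auto simp: indicator_def)
      ultimately show ?thesis
        by (intro Bochner_Integration.integrable_bound[of _ "\<lambda>x. C * indicator (cball 0 R) x" \<phi>]) auto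
    qed
    define E where "E u = complex_of_real (exp (- (norm u)\<^sup>2))" for u :: "real ^ 'n"
    have Em [measurable]: "E \<in> borel_measurable borel"
      unfolding E_def[abs_def] by measurable
    have En: "cmod (E u) = exp (- 1 * (norm u)\<^sup>2)" for u by (simp add: E_def)
    have Ei: "integrable lborel E"
      using integrable_gaussian[of 1, where 'a="real ^ 'n"] unfolding E_def[abs_def] by simp
    have EI: "(LINT u|lborel. E u) = of_real \<kappa>"
      by (simp add: E_def \<kappa>_def gaussian_integral_def)
    define \<Phi> where "\<Phi> t x = (LINT u|lborel. \<phi> (x + t *\<^sub>R u) * E u)" for t x
    have zero: "(LINT x|lborel. g x * \<Phi> t x) = 0" if t: "0 < t" for t
    proof -
      have scale: "\<Phi> t x = (1 / t ^ DIM(real ^ 'n)) *\<^sub>R (LINT y|lborel. \<phi> y * E ((1/t) *\<^sub>R (y - x)))" for x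
      proof -
        have m: "(\<lambda>y. \<phi> y * E ((1/t) *\<^sub>R (y - x))) \<in> borel_measurable borel"
          by measurable
        have "\<Phi> t x = (LINT u|lborel. \<phi> (x + t *\<^sub>R u) * E ((1/t) *\<^sub>R ((x + t *\<^sub>R u) - x)))"
          using t by (simp add: \<Phi>_def)
        also have "\<dots> = (1 / t ^ DIM(real ^ 'n)) *\<^sub>R (LINT y|lborel. \<phi> y * E ((1/t) *\<^sub>R (y - x)))"
          by (rule integral_scaled[OF m t])
        finally show ?thesis .
      qed
      have int: "integrable (lborel \<Otimes>\<^sub>M lborel) (\<lambda>(x, y). g x * (\<phi> y * E ((1/t) *\<^sub>R (y - x))))"
      proof (rule lborel_pair.Fubini_integrable)
        have 1: "(\<lambda>q. g (fst q)) \<in> borel_measurable (borel :: ((real ^ 'n) \<times> (real ^ 'n)) measure)"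
          by (rule measurable_compose[OF _ gm]) (intro borel_measurable_continuous_onI continuous_intros)
        have 2: "(\<lambda>q. \<phi> (snd q)) \<in> borel_measurable (borel :: ((real ^ 'n) \<times> (real ^ 'n)) measure)"
          by (rule measurable_compose[OF _ \<phi>m]) (intro borel_measurable_continuous_onI continuous_intros)
        have 3: "(\<lambda>q. E ((1/t) *\<^sub>R (snd q - fst q))) \<in> borel_measurable (borel :: ((real ^ 'n) \<times> (real ^ 'n)) measure)"
          by (rule measurable_compose[OF _ Em]) (intro borel_measurable_continuous_onI continuous_intros)
        show "(\<lambda>(x, y). g x * (\<phi> y * E ((1/t) *\<^sub>R (y - x)))) \<in> borel_measurable (lborel \<Otimes>\<^sub>M lborel)"
          using borel_measurable_times[OF 1 borel_measurable_times[OF 2 3]] by (simp add: lborel_prod case_prod_beta)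
        have E1: "cmod (E u) \<le> 1" for u by (simp add: E_def)
        have le: "cmod (\<phi> y * E ((1/t) *\<^sub>R (y - x))) \<le> cmod (\<phi> y)" for x y
          using mult_left_le[OF E1, of "cmod (\<phi> y)"] by (simp add: norm_mult)
        have yi: "integrable lborel (\<lambda>y. \<phi> y * E ((1/t) *\<^sub>R (y - x)))" for x
          by (rule Bochner_Integration.integrable_bound[OF \<phi>i]) (use le in auto)
        then show "AE x in lborel. integrable lborel (\<lambda>y. case (x, y) of (x, y) \<Rightarrow> g x * (\<phi> y * E ((1/t) *\<^sub>R (y - x))))"
          by simp
        show "integrable lborel (\<lambda>x. LINT y|lborel. norm (case (x, y) of (x, y) \<Rightarrow> g x * (\<phi> y * E ((1/t) *\<^sub>R (y - x)))))"
        proof (rule Bochner_Integration.integrable_bound)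
          show "integrable lborel (\<lambda>x. cmod (g x) * (LINT y|lborel. cmod (\<phi> y)))"
            using gi by simp
          have "(LINT y|lborel. cmod (\<phi> y * E ((1/t) *\<^sub>R (y - x)))) \<le> (LINT y|lborel. cmod (\<phi> y))" for x
            using le yi \<phi>i by (intro integral_mono) auto
          then show "AE x in lborel. norm (LINT y|lborel. norm (case (x, y) of (x, y) \<Rightarrow> g x * (\<phi> y * E ((1/t) *\<^sub>R (y - x)))))
              \<le> norm (cmod (g x) * (LINT y|lborel. cmod (\<phi> y)))"
            by (auto simp: norm_mult[of "g _"] abs_mult integral_nonneg_AE intro!: mult_left_mono)
          have "(\<lambda>q. norm (case q of (x, y) \<Rightarrow> g x * (\<phi> y * E ((1/t) *\<^sub>R (y - x))))) \<in> borel_measurable (lborel \<Otimes>\<^sub>M lborel)"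
            using measurable_compose[OF borel_measurable_times[OF 1 borel_measurable_times[OF 2 3]] borel_measurable_norm] by (simp add: lborel_prod case_prod_beta)
          then show "(\<lambda>x. LINT y|lborel. norm (case (x, y) of (x, y) \<Rightarrow> g x * (\<phi> y * E ((1/t) *\<^sub>R (y - x))))) \<in> borel_measurable lborel"
            by (intro lborel.borel_measurable_lebesgue_integral) (simp add: case_prod_beta)
        qed
      qed
      have "(LINT x|lborel. g x * \<Phi> t x) = (1 / t ^ DIM(real ^ 'n)) *\<^sub>R (LINT x|lborel. (LINT y|lborel. g x * (\<phi> y * E ((1/t) *\<^sub>R (y - x)))))"
        unfolding scale by simp
      also have "(LINT x|lborel. (LINT y|lborel. g x * (\<phi> y * E ((1/t) *\<^sub>R (y - x))))) = (LINT y|lborel. (LINT x|lborel. g x * (\<phi> y * E ((1/t) *\<^sub>R (y - x)))))"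
        by (rule lborel_pair.Fubini_integral[symmetric, OF int])
      also have "\<dots> = (LINT y|lborel. \<phi> y * (LINT x|lborel. g x * E ((1/t) *\<^sub>R (y - x))))"
        by (simp add: mult_ac flip: integral_mult_right_zero)
      also have "\<dots> = 0"
        unfolding E_def gauss[OF t] by simp
      finally show ?thesis by simp
    qed
    have \<Phi>_lim: "(\<lambda>k. \<Phi> (1 / real (Suc k)) x) \<longlonglongrightarrow> \<phi> x * of_real \<kappa>" for x
    proof -
      have "(\<lambda>k. LINT u|lborel. \<phi> (x + (1 / real (Suc k)) *\<^sub>R u) * E u) \<longlonglongrightarrow> (LINT u|lborel. \<phi> x * E u)"
      proof (rule integral_dominated_convergence)
        show "integrable lborel (\<lambda>u. M * cmod (E u))"
          using Ei by simp
        show "AE u in lborel. (\<lambda>k. \<phi> (x + (1 / real (Suc k)) *\<^sub>R u) * E u) \<longlonglongrightarrow> \<phi> x * E u"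
        proof (rule AE_I2)
          fix u
          have "(\<lambda>k. x + (1 / real (Suc k)) *\<^sub>R u) \<longlonglongrightarrow> x + 0 *\<^sub>R u"
            by (intro tendsto_intros LIMSEQ_Suc[OF lim_1_over_n])
          then have "(\<lambda>k. \<phi> (x + (1 / real (Suc k)) *\<^sub>R u)) \<longlonglongrightarrow> \<phi> x"
            using isCont_tendsto_compose[OF differentiable_imp_continuous_within[OF test_function_differentiable[OF \<phi>]]] by simp
          then show "(\<lambda>k. \<phi> (x + (1 / real (Suc k)) *\<^sub>R u) * E u) \<longlonglongrightarrow> \<phi> x * E u"
            by (intro tendsto_intros)
        qed
        show "AE u in lborel. cmod (\<phi> (x + (1 / real (Suc k)) *\<^sub>R u) * E u) \<le> M * cmod (E u)" for k
          using M by (auto simp: norm_mult intro!: AE_I2 mult_right_mono)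
      qed measurable
      then show ?thesis by (simp add: \<Phi>_def EI)
    qed
    have \<Phi>_le: "cmod (\<Phi> t x) \<le> M * \<kappa>" if "0 < t" for t x
    proof -
      have le: "cmod (\<phi> (x + t *\<^sub>R u) * E u) \<le> M * cmod (E u)" for u
        using M by (auto simp: norm_mult intro!: mult_right_mono)
      have "cmod (\<Phi> t x) \<le> (LINT u|lborel. cmod (\<phi> (x + t *\<^sub>R u) * E u))"
        unfolding \<Phi>_def by (rule integral_norm_bound)
      also have "\<dots> \<le> (LINT u|lborel. M * cmod (E u))"
      proof (rule integral_mono)
        show iM: "integrable lborel (\<lambda>u. M * cmod (E u))" using Ei by simp
        have "integrable lborel (\<lambda>u. \<phi> (x + t *\<^sub>R u) * E u)"
          by (rule Bochner_Integration.integrable_bound[OF iM])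
            (use le in \<open>auto intro!: AE_I2 order_trans[OF _ abs_ge_self]\<close>)
        then show "integrable lborel (\<lambda>u. cmod (\<phi> (x + t *\<^sub>R u) * E u))" by simp
      qed (rule le)
      also have "\<dots> = M * \<kappa>"
        by (simp add: En \<kappa>_def gaussian_integral_def)
      finally show ?thesis .
    qed
    have \<Phi>m: "(\<lambda>x. \<Phi> t x) \<in> borel_measurable lborel" for t
    proof -
      have "(\<lambda>q. \<phi> (fst q + t *\<^sub>R snd q)) \<in> borel_measurable (borel :: ((real ^ 'n) \<times> (real ^ 'n)) measure)"
        by (rule measurable_compose[OF _ \<phi>m]) (intro borel_measurable_continuous_onI continuous_intros)
      moreover have "(\<lambda>q. E (snd q)) \<in> borel_measurable (borel :: ((real ^ 'n) \<times> (real ^ 'n)) measure)"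
        by (rule measurable_compose[OF _ Em]) (intro borel_measurable_continuous_onI continuous_intros)
      ultimately have "(\<lambda>(x, u). \<phi> (x + t *\<^sub>R u) * E u) \<in> borel_measurable (lborel \<Otimes>\<^sub>M lborel)"
        by (simp add: lborel_prod case_prod_beta)
      then show ?thesis
        unfolding \<Phi>_def by (rule lborel.borel_measurable_lebesgue_integral)
    qed
    have "(\<lambda>k. LINT x|lborel. g x * \<Phi> (1 / real (Suc k)) x) \<longlonglongrightarrow> (LINT x|lborel. g x * (\<phi> x * of_real \<kappa>))"
    proof (rule integral_dominated_convergence)
      show "integrable lborel (\<lambda>x. cmod (g x) * (M * \<kappa>))"
        using gi by simp
      show "AE x in lborel. (\<lambda>k. g x * \<Phi> (1 / real (Suc k)) x) \<longlonglongrightarrow> g x * (\<phi> x * of_real \<kappa>)"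
        by (intro AE_I2 tendsto_intros \<Phi>_lim)
      show "AE x in lborel. cmod (g x * \<Phi> (1 / real (Suc k)) x) \<le> cmod (g x) * (M * \<kappa>)" for k
        using \<Phi>_le[of "1 / real (Suc k)"] by (auto simp: norm_mult intro!: AE_I2 mult_left_mono)
    qed (use \<Phi>m in measurable)
    then have "(LINT x|lborel. g x * (\<phi> x * of_real \<kappa>)) = 0"
      by (simp add: zero LIMSEQ_const_iff)
    then show "(LINT x|lborel. g x * \<phi> x) = 0"
      using \<kappa> by (simp add: mult.assoc[symmetric])
  qed
  then show ?thesis
    by eventually_elim (simp add: g_def)
qed

corollary bargmann_eq_AE:
  fixes f g :: "real ^ 'n \<Rightarrow> complex"
  assumes f: "f \<in> l2 lborel" and g: "g \<in> l2 lborel" and eq: "bargmann f = bargmann g"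
  shows "AE x in lborel. f x = g x"
proof -
  have "bargmann (\<lambda>x. f x - g x) w = bargmann f w - bargmann g w" for w
    unfolding bargmann_eq_bkernel
    using l2_mult_integrable[OF f bkernel_l2(1)] l2_mult_integrable[OF g bkernel_l2(1)]
    by (simp add: left_diff_distrib right_diff_distrib)
  then have "AE x in lborel. f x - g x = 0"
    by (intro bargmann_injective l2_diff f g) (simp add: eq)
  then show ?thesis by eventually_elim simp
qed

lemma bargmann_cong_AE:
  assumes "f \<in> l2 lborel" "g \<in> l2 lborel" "AE x in lborel. f x = g x"
  shows "bargmann f = bargmann g"
proof
  fix w
  have "(LINT x|lborel. f x * bkernel x w) = (LINT x|lborel. g x * bkernel x w)"
    using assms(3) l2_measurable[OF assms(1)] l2_measurable[OF assms(2)]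
    by (intro integral_cong_AE) (auto elim: eventually_mono intro!: borel_measurable_times)
  then show "bargmann f w = bargmann g w"
    by (simp add: bargmann_eq_bkernel)
qed

section \<open>Multiplication by coordinates\<close>

lemma entire_has_vector_derivative_axis:
  assumes "entire F"
  shows "((\<lambda>s. F (z + s *\<^sub>R axis j c)) has_vector_derivative c * complex_partial j F z) (at 0)"
proof -
  have "((\<lambda>s. z + s *\<^sub>R axis j c) has_derivative (\<lambda>s. s *\<^sub>R axis j c)) (at 0)"
    by (auto intro!: derivative_eq_intros)
  from has_derivative_compose[OF this entire_has_derivative[OF assms]]
  have "((\<lambda>s. F (z + s *\<^sub>R axis j c)) has_derivative
      (\<lambda>s. \<Sum>i\<in>UNIV. (s *\<^sub>R axis j c) $ i * complex_partial i F z)) (at 0)"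
    by simp
  moreover have "(\<Sum>i\<in>UNIV. (s *\<^sub>R axis j c) $ i * complex_partial i F z) = s *\<^sub>R (c * complex_partial j F z)" for s
    by (simp add: axis_def if_distrib if_distribR sum.delta cong: if_cong)
  ultimately show ?thesis
    by (simp add: has_vector_derivative_def)
qed

text \<open>
  A one-dimensional inequality of Poincare type in the real direction \<open>axis j c\<close>. The derivative of
  \<open>\<eta> X * |F|\<^sup>2 * exp (- |z|\<^sup>2)\<close> has integral zero; with \<open>\<eta> x = x\<close> this reads
  \<open>2 \<integral> X\<^sup>2 |F|\<^sup>2 = \<integral> |F|\<^sup>2 + 2 \<integral> X Re (cnj F * F')\<close>, and the last term is absorbed. The factor
  \<open>1 / (1 + \<epsilon> x\<^sup>2)\<close> makes all integrals converge; afterwards \<open>\<epsilon>\<close> tends to \<open>0\<close>.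
\<close>

lemma fock_weighted_bound:
  fixes F :: "complex ^ 'n \<Rightarrow> complex"
  assumes F: "F \<in> fock" and dF: "complex_partial j F \<in> fock" and c: "cmod c = 1"
  shows "integrable fock_measure (\<lambda>z. (z \<bullet> axis j c)\<^sup>2 * (cmod (F z))\<^sup>2)"
    and "(LINT z|fock_measure. (z \<bullet> axis j c)\<^sup>2 * (cmod (F z))\<^sup>2) \<le> (fock_norm F)\<^sup>2 + (fock_norm (complex_partial j F))\<^sup>2"
proof -
  define e where "e = (axis j c :: complex ^ 'n)"
  define X where "X z = z \<bullet> e" for z
  define F' where "F' z = c * complex_partial j F z" for z
  have ent: "entire F" and entD: "entire (complex_partial j F)" and Fl2: "F \<in> l2 fock_measure" and Dl2: "complex_partial j F \<in> l2 fock_measure"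
    using F dF by (auto simp: fock_iff)
  have F'n: "cmod (F' z) = cmod (complex_partial j F z)" for z
    using c by (simp add: F'_def norm_mult)
  have ee: "e \<bullet> e = 1"
  proof -
    have "c \<bullet> c = 1"
      using c by (simp only: power2_norm_eq_inner[symmetric] power_one)
    then show ?thesis
      by (simp only: e_def inner_axis_axis refl if_True)
  qed
  have Fc [continuous_intros]: "continuous_on S F" and F'c [continuous_intros]: "continuous_on S F'" for S
    unfolding F'_def[abs_def] by (intro entire_continuous ent continuous_intros entD)+
  have Xc [continuous_intros]: "continuous_on S X" for S
    unfolding X_def[abs_def] by (intro continuous_intros)
  have gc [continuous_intros]: "continuous_on S (gaussian_weight :: complex ^ 'n \<Rightarrow> real)" for S
    unfolding gaussian_weight_def[abs_def] by (intro continuous_intros) auto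
  define S where "S = (fock_norm F)\<^sup>2 + (fock_norm (complex_partial j F))\<^sup>2"
  have Fi: "integrable fock_measure (\<lambda>z. (cmod (F z))\<^sup>2)" "(LINT z|fock_measure. (cmod (F z))\<^sup>2) = (fock_norm F)\<^sup>2"
    using l2_integrable[OF Fl2] by (simp_all add: fock_norm_eq l2_norm_power2)
  have F'i: "integrable fock_measure (\<lambda>z. (cmod (F' z))\<^sup>2)" "(LINT z|fock_measure. (cmod (F' z))\<^sup>2) = (fock_norm (complex_partial j F))\<^sup>2"
    using l2_integrable[OF Dl2] by (simp_all add: F'n fock_norm_eq l2_norm_power2)
  have reg: "integrable fock_measure (\<lambda>z. (X z)\<^sup>2 / (1 + \<epsilon> * (X z)\<^sup>2) * (cmod (F z))\<^sup>2)
      \<and> (LINT z|fock_measure. (X z)\<^sup>2 / (1 + \<epsilon> * (X z)\<^sup>2) * (cmod (F z))\<^sup>2) \<le> S" if \<epsilon>: "0 < \<epsilon>" for \<epsilon>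
  proof -
    define d where "d x = 1 + \<epsilon> * x\<^sup>2" for x :: real
    have d1: "1 \<le> d x" for x using \<epsilon> by (simp add: d_def)
    have d0: "d x \<noteq> 0" for x using d1[of x] by linarith
    define \<eta> where "\<eta> x = x / d x" for x
    define \<eta>' where "\<eta>' x = (1 - \<epsilon> * x\<^sup>2) / (d x)\<^sup>2" for x
    have x\<eta>: "x * \<eta> x = x\<^sup>2 / d x" for x by (simp add: \<eta>_def power2_eq_square)
    have \<eta>sq: "(\<eta> x)\<^sup>2 \<le> x\<^sup>2 / d x" for x
    proof -
      have "x\<^sup>2 / (d x)\<^sup>2 \<le> x\<^sup>2 / d x"
        using d1[of x] by (intro divide_left_mono) (auto simp: power2_eq_square)
      then show ?thesis by (simp add: \<eta>_def power_divide)
    qed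
    have x\<eta>b: "0 \<le> x\<^sup>2 / d x" "x\<^sup>2 / d x \<le> 1 / \<epsilon>" for x
    proof -
      show "0 \<le> x\<^sup>2 / d x" using d1[of x] by simp
      have "x\<^sup>2 \<le> 1 / \<epsilon> * d x"
        using \<epsilon> by (simp add: d_def distrib_left add_divide_distrib)
      then show "x\<^sup>2 / d x \<le> 1 / \<epsilon>"
        using d1[of x] by (intro mult_imp_div_pos_le) auto
    qed
    have \<eta>b: "\<bar>\<eta> x\<bar> \<le> 1 / \<epsilon> + 1" for x
    proof -
      have "\<bar>\<eta> x\<bar> \<le> (\<eta> x)\<^sup>2 + 1"
        using sum_squares_bound[of "\<bar>\<eta> x\<bar>" 1] by (simp add: power2_eq_square)
      then show ?thesis using \<eta>sq[of x] x\<eta>b[of x] by linarith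
    qed
    have \<eta>'b: "\<eta>' x \<le> 1" "\<bar>\<eta>' x\<bar> \<le> 1" for x
    proof -
      have "\<bar>1 - \<epsilon> * x\<^sup>2\<bar> \<le> d x"
        using \<epsilon> by (simp add: d_def abs_le_iff)
      also have "d x \<le> (d x)\<^sup>2"
        using d1[of x] by (simp add: power2_eq_square)
      finally show "\<bar>\<eta>' x\<bar> \<le> 1" using d0[of x] by (simp add: \<eta>'_def)
      then show "\<eta>' x \<le> 1" by simp
    qed
    have \<eta>d: "(\<eta> has_real_derivative \<eta>' x) (at x)" for x
    proof -
      have "(d has_real_derivative 2 * \<epsilon> * x) (at x)"
        unfolding d_def[abs_def] by (auto intro!: derivative_eq_intros)
      then have "((\<lambda>x. x / d x) has_real_derivative (1 * d x - x * (2 * \<epsilon> * x)) / (d x * d x)) (at x)"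
        by (intro DERIV_divide DERIV_ident d0)
      then show ?thesis
        by (simp add: \<eta>_def[abs_def] \<eta>'_def d_def power2_eq_square algebra_simps)
    qed
    have \<eta>c [continuous_intros]: "continuous_on A (\<lambda>z. \<eta> (X z))" "continuous_on A (\<lambda>z. \<eta>' (X z))" for A
      unfolding \<eta>_def \<eta>'_def d_def using d0 unfolding d_def by (intro continuous_intros; simp)+
    define f where "f z = gaussian_weight z * (\<eta> (X z) * (F z \<bullet> F z))" for z
    define f' where "f' z = gaussian_weight z * (\<eta>' (X z) * (cmod (F z))\<^sup>2 + 2 * \<eta> (X z) * (F z \<bullet> F' z) - 2 * ((X z)\<^sup>2 / d (X z)) * (cmod (F z))\<^sup>2)" for z
    have fc: "continuous_on UNIV f" and f'c: "continuous_on UNIV f'"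
      unfolding f_def[abs_def] f'_def[abs_def] d_def using d0 unfolding d_def by (intro continuous_intros; simp)+
    define h where "h z = \<eta>' (X z) * (cmod (F z))\<^sup>2 + 2 * \<eta> (X z) * (F z \<bullet> F' z)" for z
    define q where "q z = (X z)\<^sup>2 / d (X z) * (cmod (F z))\<^sup>2" for z
    have hc: "continuous_on UNIV h" and qc: "continuous_on UNIV q"
      unfolding h_def[abs_def] q_def[abs_def] d_def using d0 unfolding d_def by (intro continuous_intros; simp)+
    have qi: "integrable fock_measure q"
    proof (rule Bochner_Integration.integrable_bound[OF integrable_mult_right[OF Fi(1), of "1 / \<epsilon>"]])
      show "AE z in fock_measure. norm (q z) \<le> norm (1 / \<epsilon> * (cmod (F z))\<^sup>2)"
      proof (rule AE_I2)
        fix z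
        have "0 \<le> q z" "q z \<le> 1 / \<epsilon> * (cmod (F z))\<^sup>2"
          unfolding q_def by (intro mult_nonneg_nonneg mult_right_mono x\<eta>b zero_le_power2)+
        then show "norm (q z) \<le> norm (1 / \<epsilon> * (cmod (F z))\<^sup>2)"
          by (simp only: real_norm_def abs_of_nonneg order_trans[OF _ abs_ge_self])
      qed
    qed (use borel_measurable_continuous_onI[OF qc] in simp)
    have in_le: "\<bar>2 * (F z \<bullet> F' z)\<bar> \<le> (cmod (F z))\<^sup>2 + (cmod (F' z))\<^sup>2" for z
      using Cauchy_Schwarz_ineq2[of "F z" "F' z"] sum_squares_bound[of "cmod (F z)" "cmod (F' z)"] by simp
    have hi: "integrable fock_measure h"
    proof (rule Bochner_Integration.integrable_bound)
      show "integrable fock_measure (\<lambda>z. (cmod (F z))\<^sup>2 + (1 / \<epsilon> + 1) * ((cmod (F z))\<^sup>2 + (cmod (F' z))\<^sup>2))"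
        by (intro Bochner_Integration.integrable_add integrable_mult_right Fi F'i)
      have "\<bar>h z\<bar> \<le> (cmod (F z))\<^sup>2 + (1 / \<epsilon> + 1) * ((cmod (F z))\<^sup>2 + (cmod (F' z))\<^sup>2)" for z
      proof -
        have "\<bar>h z\<bar> \<le> \<bar>\<eta>' (X z)\<bar> * (cmod (F z))\<^sup>2 + \<bar>\<eta> (X z)\<bar> * \<bar>2 * (F z \<bullet> F' z)\<bar>"
          unfolding h_def by (rule order_trans[OF abs_triangle_ineq]) (simp add: abs_mult)
        also have "\<dots> \<le> 1 * (cmod (F z))\<^sup>2 + (1 / \<epsilon> + 1) * ((cmod (F z))\<^sup>2 + (cmod (F' z))\<^sup>2)"
          using \<epsilon> by (intro add_mono mult_mono \<eta>'b \<eta>b in_le) auto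
        finally show ?thesis by simp
      qed
      then show "AE z in fock_measure. norm (h z) \<le> norm ((cmod (F z))\<^sup>2 + (1 / \<epsilon> + 1) * ((cmod (F z))\<^sup>2 + (cmod (F' z))\<^sup>2))"
        by (auto intro!: AE_I2 order_trans[OF _ abs_ge_self])
    qed (use borel_measurable_continuous_onI[OF hc] in simp)
    have f'eq: "f' z = gaussian_weight z *\<^sub>R (h z - 2 * q z)" for z
      by (simp add: f'_def h_def q_def algebra_simps)
    have hqi: "integrable fock_measure (\<lambda>z. h z - 2 * q z)"
      by (intro Bochner_Integration.integrable_diff integrable_mult_right hi qi)
    have hqm: "(\<lambda>z. h z - 2 * q z) \<in> borel_measurable borel"
      by (intro borel_measurable_continuous_onI continuous_intros hc qc)
    have f'i: "integrable lborel f'"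
      using hqi hqm by (simp add: f'eq[abs_def] integrable_fock_measure)
    have fi: "integrable lborel f"
    proof -
      have m: "(\<lambda>z. \<eta> (X z) * (F z \<bullet> F z)) \<in> borel_measurable borel"
        by (intro borel_measurable_continuous_onI continuous_intros)
      have "integrable fock_measure (\<lambda>z. \<eta> (X z) * (F z \<bullet> F z))"
      proof (rule Bochner_Integration.integrable_bound[OF integrable_mult_right[OF Fi(1), of "1 / \<epsilon> + 1"]])
        show "AE z in fock_measure. norm (\<eta> (X z) * (F z \<bullet> F z)) \<le> norm ((1 / \<epsilon> + 1) * (cmod (F z))\<^sup>2)"
          using \<eta>b \<epsilon> by (auto simp: power2_norm_eq_inner[symmetric] abs_mult intro!: AE_I2 mult_right_mono)
      qed (use m in simp)
      then show ?thesis
        using m by (simp add: f_def[abs_def] integrable_fock_measure)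
    qed
    have "(LINT z|lborel. f' z) = 0"
    proof (rule integral_directional_derivative_eq_0[OF fi f'i f'c])
      fix z
      have Xs: "X (z + s *\<^sub>R e) = X z + s" for s
        using ee by (simp add: X_def inner_add_left)
      have ns: "gaussian_weight (z + s *\<^sub>R e) = exp (- ((norm z)\<^sup>2 + 2 * s * X z + s\<^sup>2)) / pi ^ CARD('n)" for s
      proof -
        have "(norm (z + s *\<^sub>R e))\<^sup>2 = (norm z)\<^sup>2 + 2 * s * X z + s\<^sup>2"
          unfolding power2_norm_eq_inner X_def inner_add_left inner_add_right inner_scaleR_left inner_scaleR_right
            inner_commute[of e z] ee by (simp add: power2_eq_square distrib_left)
        then show ?thesis
          by (simp only: gaussian_weight_def)
      qed
      have g0: "gaussian_weight z = exp (- (norm z)\<^sup>2) / pi ^ CARD('n)"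
        by (simp add: gaussian_weight_def)
      have 1: "((\<lambda>s. gaussian_weight (z + s *\<^sub>R e)) has_real_derivative (- 2 * X z * gaussian_weight z)) (at 0)"
        unfolding ns g0 by (auto intro!: derivative_eq_intros)
      have "((\<lambda>s. X z + s) has_real_derivative 1) (at 0)"
        by (auto intro!: derivative_eq_intros)
      from DERIV_chain2[where f=\<eta> and x=0, OF _ this, of "\<eta>' (X z)"] \<eta>d[of "X z"]
      have 2: "((\<lambda>s. \<eta> (X (z + s *\<^sub>R e))) has_real_derivative \<eta>' (X z)) (at 0)"
        unfolding Xs by simp
      have v: "((\<lambda>s. F (z + s *\<^sub>R e)) has_vector_derivative F' z) (at 0)"
        unfolding e_def F'_def by (rule entire_has_vector_derivative_axis[OF ent])
      have 3: "((\<lambda>s. F (z + s *\<^sub>R e) \<bullet> F (z + s *\<^sub>R e)) has_real_derivative 2 * (F z \<bullet> F' z)) (at 0)"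
        using bounded_bilinear.has_vector_derivative[OF bounded_bilinear_inner v v]
        by (simp add: has_real_derivative_iff_has_vector_derivative inner_commute[of "F' z"])
      have "(f' z) = (- 2 * X z * gaussian_weight z) * (\<eta> (X z) * (F z \<bullet> F z))
          + (\<eta>' (X z) * (F z \<bullet> F z) + 2 * (F z \<bullet> F' z) * \<eta> (X z)) * gaussian_weight z"
        unfolding f'_def power2_norm_eq_inner x\<eta>[symmetric] by (simp add: algebra_simps)
      then show "((\<lambda>s. f (z + s *\<^sub>R e)) has_real_derivative f' z) (at 0)"
        unfolding f_def using DERIV_mult[OF 1 DERIV_mult[OF 2 3]] by simp
    qed
    then have "(LINT z|fock_measure. h z - 2 * q z) = 0"
      using hqm by (simp add: integral_fock_measure f'eq)
    then have eq: "2 * (LINT z|fock_measure. q z) = (LINT z|fock_measure. h z)"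
      using hi qi by simp
    have "(LINT z|fock_measure. h z) \<le> (LINT z|fock_measure. (cmod (F z))\<^sup>2 + (q z + (cmod (F' z))\<^sup>2))"
    proof (rule integral_mono[OF hi])
      show "integrable fock_measure (\<lambda>z. (cmod (F z))\<^sup>2 + (q z + (cmod (F' z))\<^sup>2))"
        by (intro Bochner_Integration.integrable_add Fi F'i qi)
      fix z
      have a: "\<eta>' (X z) * (cmod (F z))\<^sup>2 \<le> 1 * (cmod (F z))\<^sup>2"
        by (intro mult_right_mono \<eta>'b) auto
      have "2 * \<eta> (X z) * (F z \<bullet> F' z) \<le> 2 * (\<bar>\<eta> (X z)\<bar> * cmod (F z)) * cmod (F' z)"
        using mult_left_mono[OF Cauchy_Schwarz_ineq2[of "F z" "F' z"], of "2 * \<bar>\<eta> (X z)\<bar>"]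
          abs_ge_self[of "2 * \<eta> (X z) * (F z \<bullet> F' z)"] by (simp add: abs_mult mult_ac)
      also have "\<dots> \<le> (\<bar>\<eta> (X z)\<bar> * cmod (F z))\<^sup>2 + (cmod (F' z))\<^sup>2"
        by (rule sum_squares_bound)
      also have "\<dots> \<le> q z + (cmod (F' z))\<^sup>2"
        using mult_right_mono[OF \<eta>sq[of "X z"], of "(cmod (F z))\<^sup>2"] by (simp add: q_def power_mult_distrib)
      finally show "h z \<le> (cmod (F z))\<^sup>2 + (q z + (cmod (F' z))\<^sup>2)"
        using a by (simp add: h_def)
    qed
    also have "\<dots> = S + (LINT z|fock_measure. q z)"
      using Fi F'i qi by (simp add: S_def)
    finally show ?thesis
      using eq qi unfolding q_def[abs_def] d_def by simp
  qed
  define u where "u k z = (X z)\<^sup>2 / (1 + 1 / real (Suc k) * (X z)\<^sup>2) * (cmod (F z))\<^sup>2" for k z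
  have u_lim: "(\<lambda>k. u k z) \<longlonglongrightarrow> (X z)\<^sup>2 * (cmod (F z))\<^sup>2" for z
  proof -
    have "(\<lambda>k. u k z) \<longlonglongrightarrow> (X z)\<^sup>2 / (1 + 0 * (X z)\<^sup>2) * (cmod (F z))\<^sup>2"
      unfolding u_def by (intro tendsto_intros LIMSEQ_Suc[OF lim_1_over_n]) simp
    then show ?thesis by simp
  qed
  have u_int: "integrable fock_measure (u k)" and u_le: "(LINT z|fock_measure. u k z) \<le> S" for k
    using reg[of "1 / real (Suc k)"] unfolding u_def[abs_def] by simp_all
  have u0: "0 \<le> u k z" for k z
    unfolding u_def by (intro mult_nonneg_nonneg divide_nonneg_nonneg add_nonneg_nonneg) auto
  have S0: "0 \<le> S" by (simp add: S_def)
  have m: "(\<lambda>z. (X z)\<^sup>2 * (cmod (F z))\<^sup>2) \<in> borel_measurable borel"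
    by (intro borel_measurable_continuous_onI continuous_intros)
  have "(\<integral>\<^sup>+z. ennreal ((X z)\<^sup>2 * (cmod (F z))\<^sup>2) \<partial>fock_measure) = (\<integral>\<^sup>+z. liminf (\<lambda>k. ennreal (u k z)) \<partial>fock_measure)"
    by (intro nn_integral_cong lim_imp_Liminf[symmetric] tendsto_ennrealI u_lim) auto
  also have "\<dots> \<le> liminf (\<lambda>k. \<integral>\<^sup>+z. ennreal (u k z) \<partial>fock_measure)"
    by (intro nn_integral_liminf measurable_compose[OF borel_measurable_integrable[OF u_int] measurable_ennreal])
  also have "\<dots> \<le> liminf (\<lambda>k :: nat. ennreal S)"
  proof (intro Liminf_mono always_eventually allI)
    fix k
    have "(\<integral>\<^sup>+z. ennreal (u k z) \<partial>fock_measure) = ennreal (LINT z|fock_measure. u k z)"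
      by (intro nn_integral_eq_integral u_int) (auto simp: u0)
    also have "\<dots> \<le> ennreal S"
      by (intro ennreal_leI u_le)
    finally show "(\<integral>\<^sup>+z. ennreal (u k z) \<partial>fock_measure) \<le> ennreal S" .
  qed
  also have "\<dots> = ennreal S"
    by (simp add: Liminf_const)
  finally have nn: "(\<integral>\<^sup>+z. ennreal ((X z)\<^sup>2 * (cmod (F z))\<^sup>2) \<partial>fock_measure) \<le> ennreal S" .
  have int: "integrable fock_measure (\<lambda>z. (X z)\<^sup>2 * (cmod (F z))\<^sup>2)"
    using m nn by (intro integrableI_nonneg) (auto simp: less_top[symmetric] top_unique)
  then show "integrable fock_measure (\<lambda>z. (z \<bullet> axis j c)\<^sup>2 * (cmod (F z))\<^sup>2)"
    by (simp add: X_def e_def)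
  have "ennreal (LINT z|fock_measure. (X z)\<^sup>2 * (cmod (F z))\<^sup>2) \<le> ennreal S"
    using nn by (subst nn_integral_eq_integral[OF int, symmetric]) auto
  then show "(LINT z|fock_measure. (z \<bullet> axis j c)\<^sup>2 * (cmod (F z))\<^sup>2) \<le> (fock_norm F)\<^sup>2 + (fock_norm (complex_partial j F))\<^sup>2"
    unfolding ennreal_le_iff[OF S0] unfolding X_def e_def S_def .
qed

text \<open>
  \<open>|z\<^sub>j|\<^sup>2\<close> is the sum of the squares of the coordinates in the real directions \<open>axis j 1\<close> and
  \<open>axis j \<i>\<close>.
\<close>

lemma fock_multiply_coordinate:
  fixes F :: "complex ^ 'n \<Rightarrow> complex"
  assumes F: "F \<in> fock" and dF: "complex_partial j F \<in> fock"
  shows "(\<lambda>z. z $ j * F z) \<in> fock"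
    and "fock_norm (\<lambda>z. z $ j * F z) \<le> 2 * (fock_norm F + fock_norm (complex_partial j F))"
proof -
  have ent: "entire F" using F by (simp add: fock_iff)
  have eq: "(cmod (z $ j * F z))\<^sup>2 = (z \<bullet> axis j 1)\<^sup>2 * (cmod (F z))\<^sup>2 + (z \<bullet> axis j \<i>)\<^sup>2 * (cmod (F z))\<^sup>2" for z
    by (simp add: norm_mult power_mult_distrib cmod_power2[of "z $ j"] inner_axis inner_complex_def distrib_right)
  note 1 = fock_weighted_bound[OF F dF, of 1] and 2 = fock_weighted_bound[OF F dF, of \<i>]
  have zent: "entire (\<lambda>z. z $ j * F z)"
    by (intro entire_mult entire_component ent)
  show "(\<lambda>z. z $ j * F z) \<in> fock"
    unfolding fock_iff l2_def
    using zent 1(1) 2(1) entire_measurable[OF zent] by (simp add: eq)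
  let ?a = "fock_norm F" and ?b = "fock_norm (complex_partial j F)"
  have a: "0 \<le> ?a" "0 \<le> ?b" by (simp_all add: fock_norm_eq l2_norm_nonneg)
  have "(fock_norm (\<lambda>z. z $ j * F z))\<^sup>2 \<le> 2 * (?a\<^sup>2 + ?b\<^sup>2)"
    unfolding fock_norm_eq l2_norm_power2[of _ "\<lambda>z. z $ j * F z"] eq
    using 1 2 by (simp add: fock_norm_eq)
  also have "\<dots> \<le> (2 * (?a + ?b))\<^sup>2"
    using a by (simp add: power2_eq_square algebra_simps)
  finally show "fock_norm (\<lambda>z. z $ j * F z) \<le> 2 * (?a + ?b)"
    by (rule power2_le_imp_le) (use a in simp)
qed

lemma fock_add: "F \<in> fock \<Longrightarrow> G \<in> fock \<Longrightarrow> (\<lambda>z. F z + G z) \<in> fock"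
  and fock_cmult: "F \<in> fock \<Longrightarrow> (\<lambda>z. c * F z) \<in> fock"
  by (auto simp: fock_iff entire_add entire_cmult l2_add l2_cmult)

lemma fock_norm_add: "F \<in> fock \<Longrightarrow> G \<in> fock \<Longrightarrow> fock_norm (\<lambda>z. F z + G z) \<le> fock_norm F + fock_norm G"
  unfolding fock_norm_eq fock_iff by (intro l2_add(2)) auto

subsection \<open>The orders of differentiability\<close>

text \<open>The Fock-Sobolev condition without a chosen order of differentiation, in a form suited to
  induction on the order.\<close>

definition fock_bounded :: "nat \<Rightarrow> real \<Rightarrow> (complex ^ 'n \<Rightarrow> complex) \<Rightarrow> bool"
  where "fock_bounded k b F \<longleftrightarrow> (\<forall>is. length is \<le> k \<longrightarrow>
    foldr complex_partial is F \<in> fock \<and> fock_norm (foldr complex_partial is F) \<le> b)"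

lemma fock_bounded_fock: "fock_bounded k b F \<Longrightarrow> F \<in> fock"
  and fock_bounded_norm: "fock_bounded k b F \<Longrightarrow> fock_norm F \<le> b"
  unfolding fock_bounded_def by (metis foldr_Nil id_apply le0 list.size(3))+

lemma fock_bounded_nonneg: "fock_bounded k b F \<Longrightarrow> 0 \<le> b"
  using order_trans[OF l2_norm_nonneg, of fock_measure F b] fock_bounded_norm[of k b F] by (simp add: fock_norm_eq)

lemma fock_bounded_mono: "fock_bounded l b F \<Longrightarrow> k \<le> l \<Longrightarrow> b \<le> c \<Longrightarrow> fock_bounded k c F"
  unfolding fock_bounded_def by (meson order_trans)

lemma fock_bounded_partial:
  fixes F :: "complex ^ 'n \<Rightarrow> complex"
  assumes "fock_bounded (Suc k) b F"
  shows "fock_bounded k b (complex_partial i F)"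
  unfolding fock_bounded_def
proof (intro allI impI)
  fix "is" :: "'n list" assume "length is \<le> k"
  then show "foldr complex_partial is (complex_partial i F) \<in> fock
      \<and> fock_norm (foldr complex_partial is (complex_partial i F)) \<le> b"
    using assms[unfolded fock_bounded_def, rule_format, of "is @ [i]"] by simp
qed

lemma fock_boundedI:
  fixes F :: "complex ^ 'n \<Rightarrow> complex"
  assumes "F \<in> fock" "fock_norm F \<le> b" "\<And>i. fock_bounded k b (complex_partial i F)"
  shows "fock_bounded (Suc k) b F"
  unfolding fock_bounded_def
proof (intro allI impI)
  fix "is" :: "'n list" assume "length is \<le> Suc k"
  then show "foldr complex_partial is F \<in> fock \<and> fock_norm (foldr complex_partial is F) \<le> b"
    using assms assms(3)[unfolded fock_bounded_def]
    by (cases "is" rule: rev_cases) auto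
qed

lemma fock_bounded_0: "fock_bounded 0 b F \<longleftrightarrow> F \<in> fock \<and> fock_norm F \<le> b"
  by (simp add: fock_bounded_def)

lemma fock_bounded_cmult:
  "fock_bounded k b F \<Longrightarrow> fock_bounded k (cmod c * b) (\<lambda>z. c * F z)"
proof (induction k arbitrary: F)
  case 0
  then show ?case
    by (auto simp: fock_bounded_0 fock_cmult fock_norm_eq l2_norm_cmult intro: mult_left_mono)
next
  case (Suc k)
  have F: "F \<in> fock" "fock_norm F \<le> b"
    using Suc.prems by (auto intro: fock_bounded_fock fock_bounded_norm)
  show ?case
  proof (rule fock_boundedI)
    show "fock_norm (\<lambda>z. c * F z) \<le> cmod c * b"
      using F(2) by (auto simp: fock_norm_eq l2_norm_cmult intro: mult_left_mono)
    show "fock_bounded k (cmod c * b) (complex_partial i (\<lambda>z. c * F z))" for i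
      using Suc.IH[OF fock_bounded_partial[OF Suc.prems, of i]] F(1)
      by (simp add: entire_cmult fock_iff)
  qed (use F fock_cmult in auto)
qed

lemma fock_bounded_add:
  "fock_bounded k a F \<Longrightarrow> fock_bounded k b G \<Longrightarrow> fock_bounded k (a + b) (\<lambda>z. F z + G z)"
proof (induction k arbitrary: F G)
  case 0
  then show ?case
    using fock_norm_add[of F G] by (auto simp: fock_bounded_0 fock_add)
next
  case (Suc k)
  have F: "F \<in> fock" "fock_norm F \<le> a" and G: "G \<in> fock" "fock_norm G \<le> b"
    using Suc.prems by (auto intro: fock_bounded_fock fock_bounded_norm)
  show ?case
  proof (rule fock_boundedI)
    show "fock_norm (\<lambda>z. F z + G z) \<le> a + b"
      using fock_norm_add[OF F(1) G(1)] F(2) G(2) by simp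
    show "fock_bounded k (a + b) (complex_partial i (\<lambda>z. F z + G z))" for i
      using Suc.IH[OF fock_bounded_partial[OF Suc.prems(1), of i] fock_bounded_partial[OF Suc.prems(2), of i]] F(1) G(1)
      by (simp add: entire_add fock_iff)
  qed (use F G fock_add in auto)
qed

text \<open>
  By the Leibniz rule, each order of differentiation adds at most one derivative of \<open>F\<close> without the
  factor \<open>z\<^sub>j\<close>, which accounts for the growth of the constant from \<open>4\<close> by \<open>1\<close> per order.
\<close>

lemma fock_bounded_multiply_coordinate:
  fixes F :: "complex ^ 'n \<Rightarrow> complex"
  assumes "fock_bounded (Suc k) b F"
  shows "fock_bounded k ((4 + real k) * b) (\<lambda>z. z $ j * F z)"
  using assms
proof (induction k arbitrary: F)
  case 0
  have "F \<in> fock" "fock_norm F \<le> b" "complex_partial j F \<in> fock" "fock_norm (complex_partial j F) \<le> b"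
    using fock_bounded_partial[OF 0, of j] 0 by (auto intro: fock_bounded_fock fock_bounded_norm)
  then show ?case
    using fock_multiply_coordinate[of F j] by (simp add: fock_bounded_0)
next
  case (Suc k)
  note D = fock_bounded_partial[OF Suc.prems]
  have F: "F \<in> fock" "fock_norm F \<le> b" "complex_partial j F \<in> fock" "fock_norm (complex_partial j F) \<le> b"
    using D[of j] Suc.prems by (auto intro: fock_bounded_fock fock_bounded_norm)
  have b0: "0 \<le> b" by (rule fock_bounded_nonneg[OF Suc.prems])
  show ?case
  proof (rule fock_boundedI)
    show "(\<lambda>z. z $ j * F z) \<in> fock"
      by (rule fock_multiply_coordinate[OF F(1,3)])
    have "fock_norm (\<lambda>z. z $ j * F z) \<le> 2 * (b + b)"
      by (rule order_trans[OF fock_multiply_coordinate(2)[OF F(1,3)]]) (intro mult_left_mono add_mono F, simp)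
    also have "2 * (b + b) = 4 * b" by simp
    also have "\<dots> \<le> (4 + real (Suc k)) * b"
      using b0 by (intro mult_right_mono) auto
    finally show "fock_norm (\<lambda>z. z $ j * F z) \<le> (4 + real (Suc k)) * b" .
    fix i
    have "complex_partial i (\<lambda>z. z $ j * F z) = (\<lambda>z. z $ j * complex_partial i F z + (if i = j then 1 else 0) * F z)"
      using F(1) by (subst entire_mult(2)) (auto simp: entire_component fock_iff)
    moreover have "fock_bounded k (cmod (if i = j then 1 else 0) * b) (\<lambda>z. (if i = j then 1 else 0) * F z)"
      by (intro fock_bounded_cmult fock_bounded_mono[OF Suc.prems]) auto
    then have "fock_bounded k b (\<lambda>z. (if i = j then 1 else 0) * F z)"
      by (rule fock_bounded_mono) (use b0 in auto)
    ultimately have "fock_bounded k ((4 + real k) * b + b) (complex_partial i (\<lambda>z. z $ j * F z))"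
      using fock_bounded_add[OF Suc.IH[OF D[of i]], of b "\<lambda>z. (if i = j then 1 else 0) * F z"] by simp
    then show "fock_bounded k ((4 + real (Suc k)) * b) (complex_partial i (\<lambda>z. z $ j * F z))"
      by (simp add: algebra_simps)
  qed
qed

text \<open>
  The generator of the Weyl operators along the \<open>j\<close>-th axis; it corresponds to the partial
  derivative on \<open>\<real>\<^sup>n\<close>.
\<close>

definition derivative_operator :: "'n::finite \<Rightarrow> (complex ^ 'n \<Rightarrow> complex) \<Rightarrow> complex ^ 'n \<Rightarrow> complex"
  where "derivative_operator j F z = complex_partial j F z - z $ j * F z"

lemma fock_bounded_derivative_operator:
  assumes "fock_bounded (Suc k) b F"
  shows "fock_bounded k ((5 + real k) * b) (derivative_operator j F)"
proof -
  have "fock_bounded k (b + cmod (-1) * ((4 + real k) * b)) (\<lambda>z. complex_partial j F z + (-1) * (z $ j * F z))"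
    by (intro fock_bounded_add fock_bounded_cmult fock_bounded_partial fock_bounded_multiply_coordinate assms)
  then show ?thesis
    by (simp add: derivative_operator_def[abs_def] algebra_simps)
qed

section \<open>Weak derivatives and the Bargmann transform\<close>

text \<open>
  A translation on the real side becomes a Weyl operator on the Fock side, because the kernel
  depends on \<open>x\<close> and \<open>z\<close> through \<open>exp (- (x - z)\<^sup>2 + z\<^sup>2/2)\<close>.
\<close>

lemma bargmann_translation:
  fixes f :: "real ^ 'n \<Rightarrow> complex"
  assumes f: "f \<in> l2 lborel"
  shows "(\<lambda>x. f (x + t *\<^sub>R axis j 1)) \<in> l2 lborel"
    and "l2_norm lborel (\<lambda>x. f (x + t *\<^sub>R axis j 1)) = l2_norm lborel f"
    and "bargmann (\<lambda>x. f (x + t *\<^sub>R axis j 1)) z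
      = bargmann f (z + of_real t *s axis j 1) * exp (- of_real t * z $ j - of_real t ^ 2 / 2)"
proof -
  let ?e = "axis j 1 :: real ^ 'n"
  have [measurable]: "f \<in> borel_measurable borel"
    using l2_measurable[OF f] by simp
  show "(\<lambda>x. f (x + t *\<^sub>R ?e)) \<in> l2 lborel"
    using integrable_translation[OF l2_integrable[OF f], of "t *\<^sub>R ?e"] by (simp add: l2_def)
  show "l2_norm lborel (\<lambda>x. f (x + t *\<^sub>R ?e)) = l2_norm lborel f"
    unfolding l2_norm_def by (subst integral_translation[of "\<lambda>x. (cmod (f x))\<^sup>2"]) auto
  have cx: "complexify ?e = axis j 1"
    by (simp add: complexify_def axis_def vec_eq_iff)
  have dj: "dot (axis j 1) w = w $ j" for w :: "complex ^ 'n"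
    by (simp add: dot_def axis_def if_distrib if_distribR sum.delta cong: if_cong)
  have K: "bkernel (x - t *\<^sub>R ?e) z = bkernel x (z + of_real t *s axis j 1) * exp (- of_real t * z $ j - of_real t ^ 2 / 2)" for x
  proof -
    have n: "(norm (x - t *\<^sub>R ?e))\<^sup>2 = (norm x)\<^sup>2 - 2 * t * x $ j + t\<^sup>2"
    proof -
      have xe: "x \<bullet> ?e = x $ j" by (simp add: inner_axis)
      have ee: "?e \<bullet> ?e = 1" by (simp add: inner_axis_axis)
      show ?thesis
        unfolding power2_norm_eq_inner inner_diff_left inner_diff_right inner_scaleR_left inner_scaleR_right
          inner_commute[of ?e x] xe ee by (simp add: power2_eq_square algebra_simps)
    qed
    have "2 * dot (complexify (x - t *\<^sub>R ?e)) z - of_real ((norm (x - t *\<^sub>R ?e))\<^sup>2) - dot z z / 2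
      = (2 * dot (complexify x) (z + of_real t *s axis j 1) - of_real ((norm x)\<^sup>2) - dot (z + of_real t *s axis j 1) (z + of_real t *s axis j 1) / 2)
        + (- of_real t * z $ j - of_real t ^ 2 / 2)"
    proof -
      have dj': "dot w (axis j 1) = w $ j" for w :: "complex ^ 'n"
        by (subst dot_commute) (rule dj)
      have aj: "(axis j 1 :: complex ^ 'n) $ j = 1" by (simp add: axis_def)
      have cxx: "complexify (x - t *\<^sub>R ?e) = complexify x - of_real t *s axis j 1"
        by (simp add: cx)
      show ?thesis
        unfolding n cxx dot_simps dj dj' aj by (simp add: power2_eq_square field_simps)
    qed
    then show ?thesis
      by (simp only: bkernel_def exp_add[symmetric])
  qed
  have "(LINT x|lborel. f (x + t *\<^sub>R ?e) * bkernel x z) = (LINT x|lborel. f (x + t *\<^sub>R ?e) * bkernel ((x + t *\<^sub>R ?e) - t *\<^sub>R ?e) z)"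
    by simp
  also have "\<dots> = (LINT x|lborel. f x * bkernel (x - t *\<^sub>R ?e) z)"
    by (rule integral_translation[of "\<lambda>x. f x * bkernel (x - t *\<^sub>R ?e) z"])
      (intro borel_measurable_times \<open>f \<in> borel_measurable borel\<close> borel_measurable_continuous_onI continuous_intros)
  also have "\<dots> = (LINT x|lborel. f x * bkernel x (z + of_real t *s axis j 1)) * exp (- of_real t * z $ j - of_real t ^ 2 / 2)"
    unfolding K by (simp add: mult.assoc[symmetric])
  finally show "bargmann (\<lambda>x. f (x + t *\<^sub>R ?e)) z
      = bargmann f (z + of_real t *s axis j 1) * exp (- of_real t * z $ j - of_real t ^ 2 / 2)"
    by (simp add: bargmann_eq_bkernel)
qed

text \<open>
  Cauchy-Schwarz in \<open>s\<close> bounds \<open>|h|\<^sup>2\<close> by the integral of \<open>|g|\<^sup>2\<close> over the segment, times \<open>t\<close>. The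
  pairing formula will be applied to the Bargmann kernel and to test functions.
\<close>

lemma segment_integral:
  fixes g :: "real ^ 'n \<Rightarrow> complex" and e :: "real ^ 'n"
  assumes g: "g \<in> l2 lborel" and t: "0 \<le> t"
  defines "h \<equiv> \<lambda>x. LINT s|lborel. indicator {0..t} s *\<^sub>R g (x + s *\<^sub>R e)"
  shows "h \<in> l2 lborel"
    and "\<And>k. k \<in> l2 lborel \<Longrightarrow> (LINT x|lborel. h x * k x)
      = (LINT s|lborel. indicator {0..t} s *\<^sub>R (LINT x|lborel. g (x + s *\<^sub>R e) * k x))"
proof -
  have gm: "g \<in> borel_measurable borel"
    using l2_measurable[OF g] by simp
  have Tm: "(\<lambda>p :: real \<times> (real ^ 'n). snd p + fst p *\<^sub>R e) \<in> borel_measurable borel"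
    by (rule translation_orbit)
  have gTm: "(\<lambda>p :: real \<times> (real ^ 'n). g (snd p + fst p *\<^sub>R e)) \<in> borel_measurable (lborel \<Otimes>\<^sub>M lborel)"
    unfolding lborel_prod using measurable_compose[OF Tm gm] by simp
  have im: "(\<lambda>p :: real \<times> (real ^ 'n). indicator {0..t} (fst p) :: real) \<in> borel_measurable (lborel \<Otimes>\<^sub>M lborel)"
    by measurable
  have gi: "integrable (lborel \<Otimes>\<^sub>M lborel) (\<lambda>(s, x). indicator {0..t} s *\<^sub>R (cmod (g (x + s *\<^sub>R e)))\<^sup>2)"
    by (rule integrable_orbit[OF l2_integrable[OF g] translation_orbit])
  have hm: "h \<in> borel_measurable borel"
  proof -
    have "(\<lambda>(x, s). indicator {0..t} s *\<^sub>R g (x + s *\<^sub>R e)) \<in> borel_measurable (lborel \<Otimes>\<^sub>M lborel)"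
      using measurable_compose[OF measurable_pair_swap' borel_measurable_scaleR[OF im gTm]]
      by (simp add: case_prod_beta)
    then have "(\<lambda>x. LINT s|lborel. indicator {0..t} s *\<^sub>R g (x + s *\<^sub>R e)) \<in> borel_measurable lborel"
      by (rule lborel.borel_measurable_lebesgue_integral)
    then show ?thesis by (simp add: h_def)
  qed
  have bound: "AE x in lborel. (cmod (h x))\<^sup>2 \<le> t * (LINT s|lborel. indicator {0..t} s *\<^sub>R (cmod (g (x + s *\<^sub>R e)))\<^sup>2)"
    using lborel_pair.AE_integrable_snd[OF gi]
  proof eventually_elim
    case (elim x)
    let ?i = "\<lambda>s. of_real (indicator {0..t} s) :: complex"
    let ?u = "\<lambda>s. ?i s * g (x + s *\<^sub>R e)"
    have "integrable lborel (indicator {0..t} :: real \<Rightarrow> real)"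
      by (simp add: integrable_indicator_iff emeasure_lborel_Icc_eq)
    moreover have isq: "(cmod (?i s))\<^sup>2 = indicator {0..t} s" for s
      by (simp add: indicator_def)
    ultimately have i: "?i \<in> l2 lborel"
      by (simp add: l2_def)
    have "(\<lambda>s. g (x + s *\<^sub>R e)) \<in> borel_measurable borel"
      by (rule measurable_compose[OF _ gm]) (intro borel_measurable_continuous_onI continuous_intros)
    then have um: "?u \<in> borel_measurable lborel"
      by measurable
    have usq: "(cmod (?u s))\<^sup>2 = indicator {0..t} s *\<^sub>R (cmod (g (x + s *\<^sub>R e)))\<^sup>2" for s
      by (simp add: indicator_def)
    have u: "?u \<in> l2 lborel"
      using um elim by (simp only: l2_def usq mem_Collect_eq simp_thms)
    have "h x = (LINT s|lborel. ?i s * ?u s)"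
      unfolding h_def by (intro Bochner_Integration.integral_cong) (auto simp: indicator_def)
    then have "cmod (h x) \<le> l2_norm lborel ?i * l2_norm lborel ?u"
      using l2_Cauchy_Schwarz[OF i u] by simp
    then have "(cmod (h x))\<^sup>2 \<le> (l2_norm lborel ?i * l2_norm lborel ?u)\<^sup>2"
      by (intro power_mono) auto
    also have "\<dots> = t * (LINT s|lborel. indicator {0..t} s *\<^sub>R (cmod (g (x + s *\<^sub>R e)))\<^sup>2)"
      unfolding power_mult_distrib l2_norm_power2 isq usq using t by simp
    finally show ?case .
  qed
  show "h \<in> l2 lborel"
    unfolding l2_def
  proof (intro CollectI conjI)
    show "integrable lborel (\<lambda>x. (cmod (h x))\<^sup>2)"
    proof (rule Bochner_Integration.integrable_bound)
      show "integrable lborel (\<lambda>x. t * (LINT s|lborel. indicator {0..t} s *\<^sub>R (cmod (g (x + s *\<^sub>R e)))\<^sup>2))"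
        by (intro integrable_mult_right lborel_pair.integrable_snd[OF gi])
      show "AE x in lborel. norm ((cmod (h x))\<^sup>2) \<le> norm (t * (LINT s|lborel. indicator {0..t} s *\<^sub>R (cmod (g (x + s *\<^sub>R e)))\<^sup>2))"
        using bound by eventually_elim (auto intro: order_trans[OF _ abs_ge_self])
    qed (use hm in measurable)
  qed (use hm in simp)
  fix k :: "real ^ 'n \<Rightarrow> complex" assume k: "k \<in> l2 lborel"
  have km: "k \<in> borel_measurable borel"
    using l2_measurable[OF k] by simp
  have ki: "integrable (lborel \<Otimes>\<^sub>M lborel) (\<lambda>(s, x). indicator {0..t} s *\<^sub>R (cmod (k x))\<^sup>2)"
  proof (rule integrable_orbit[OF l2_integrable[OF k], of "\<lambda>s x. x"])
    show "distr lborel borel (\<lambda>x. x) = (lborel :: (real ^ 'n) measure)"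
      using translation_orbit(1)[of 0 e] by simp
    show "(\<lambda>p :: real \<times> (real ^ 'n). snd p) \<in> borel_measurable borel"
      by (intro borel_measurable_continuous_onI continuous_intros)
  qed
  have prod: "integrable (lborel \<Otimes>\<^sub>M lborel) (\<lambda>(s, x). indicator {0..t} s *\<^sub>R (g (x + s *\<^sub>R e) * k x))"
  proof (rule Bochner_Integration.integrable_bound[OF Bochner_Integration.integrable_add[OF gi ki]])
    have k2: "(\<lambda>p :: real \<times> (real ^ 'n). k (snd p)) \<in> borel_measurable (lborel \<Otimes>\<^sub>M lborel)"
    proof -
      have "(\<lambda>p :: real \<times> (real ^ 'n). snd p) \<in> borel_measurable borel"
        by (intro borel_measurable_continuous_onI continuous_intros)
      from measurable_compose[OF this km] show ?thesis
        unfolding lborel_prod by simp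
    qed
    show "(\<lambda>(s, x). indicator {0..t} s *\<^sub>R (g (x + s *\<^sub>R e) * k x)) \<in> borel_measurable (lborel \<Otimes>\<^sub>M lborel)"
      using borel_measurable_scaleR[OF im borel_measurable_times[OF gTm k2]] by (simp add: case_prod_beta)
    have "cmod (indicator {0..t} s *\<^sub>R (g (x + s *\<^sub>R e) * k x))
        \<le> indicator {0..t} s *\<^sub>R (cmod (g (x + s *\<^sub>R e)))\<^sup>2 + indicator {0..t} s *\<^sub>R (cmod (k x))\<^sup>2" for s x
    proof -
      have "cmod (g (x + s *\<^sub>R e) * k x) \<le> (cmod (g (x + s *\<^sub>R e)))\<^sup>2 + (cmod (k x))\<^sup>2"
        by (rule order_trans[OF cmod_mult_le]) simp
      then show ?thesis
        by (auto simp: indicator_def)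
    qed
    then show "AE p in lborel \<Otimes>\<^sub>M lborel. norm (case p of (s, x) \<Rightarrow> indicator {0..t} s *\<^sub>R (g (x + s *\<^sub>R e) * k x))
        \<le> norm ((case p of (s, x) \<Rightarrow> indicator {0..t} s *\<^sub>R (cmod (g (x + s *\<^sub>R e)))\<^sup>2) + (case p of (s, x) \<Rightarrow> indicator {0..t} s *\<^sub>R (cmod (k x))\<^sup>2))"
      by (auto intro!: AE_I2 order_trans[OF _ abs_ge_self] simp del: norm_scaleR)
  qed
  have "(LINT x|lborel. h x * k x) = (LINT x|lborel. (LINT s|lborel. indicator {0..t} s *\<^sub>R (g (x + s *\<^sub>R e) * k x)))"
    unfolding h_def integral_mult_left_zero[symmetric] by simp
  also have "\<dots> = (LINT s|lborel. (LINT x|lborel. indicator {0..t} s *\<^sub>R (g (x + s *\<^sub>R e) * k x)))"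
    by (rule lborel_pair.Fubini_integral[OF prod])
  finally show "(LINT x|lborel. h x * k x)
      = (LINT s|lborel. indicator {0..t} s *\<^sub>R (LINT x|lborel. g (x + s *\<^sub>R e) * k x))"
    by simp
qed

text \<open>
  If \<open>g\<close> is the preimage of \<open>\<partial>\<^sub>j F - z\<^sub>j F\<close>, then the transforms of both sides of
  \<open>f (x + t e) - f x = \<integral>\<^sub>0\<^sup>t g (x + s e) ds\<close> agree: the derivative in \<open>t\<close> of the Weyl operator
  applied to \<open>F\<close> is the Weyl operator applied to \<open>\<partial>\<^sub>j F - z\<^sub>j F\<close>.
\<close>

lemma translation_difference:
  fixes f g :: "real ^ 'n \<Rightarrow> complex"
  assumes f: "f \<in> l2 lborel" and g: "g \<in> l2 lborel"
    and ent: "entire (bargmann f)" "entire (complex_partial j (bargmann f))"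
    and D: "bargmann g = derivative_operator j (bargmann f)" and t: "0 \<le> t"
  shows "AE x in lborel. f (x + t *\<^sub>R axis j 1) - f x = (LINT s|lborel. indicator {0..t} s *\<^sub>R g (x + s *\<^sub>R axis j 1))"
proof -
  let ?e = "axis j 1 :: real ^ 'n" and ?c = "axis j 1 :: complex ^ 'n"
  define F where "F = bargmann f"
  define h where "h x = (LINT s|lborel. indicator {0..t} s *\<^sub>R g (x + s *\<^sub>R ?e))" for x
  have h: "h \<in> l2 lborel"
    unfolding h_def by (rule segment_integral[OF g t])
  have "AE x in lborel. f (x + t *\<^sub>R ?e) - f x = h x"
  proof (rule bargmann_eq_AE[OF l2_diff(1)[OF bargmann_translation(1)[OF f] f] h], rule ext)
    fix z :: "complex ^ 'n"
    define E where "E s = exp (- of_real s * z $ j - of_real s ^ 2 / 2)" for s :: real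
    define W where "W s = F (z + of_real s *s ?c) * E s" for s
    define W' where "W' s = derivative_operator j F (z + of_real s *s ?c) * E s" for s
    have line: "z + of_real s *s ?c = z + s *\<^sub>R ?c" for s
      by (simp add: vec_eq_iff axis_def scaleR_conv_of_real[symmetric])
    have cj: "(z + s *\<^sub>R ?c) $ j = z $ j + of_real s" for s
      by (simp add: axis_def of_real_def)
    have dW: "(W has_vector_derivative W' s) (at s)" for s
    proof -
      have 1: "((\<lambda>r. F (z + r *\<^sub>R ?c)) has_vector_derivative complex_partial j F (z + s *\<^sub>R ?c)) (at s)"
      proof -
        have "((\<lambda>r. F ((z + s *\<^sub>R ?c) + r *\<^sub>R ?c)) has_vector_derivative 1 * complex_partial j F (z + s *\<^sub>R ?c)) (at (s - s))"
          using entire_has_vector_derivative_axis[OF ent(1)[folded F_def], of "z + s *\<^sub>R ?c" j 1] by simp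
        moreover have "((\<lambda>r. r - s) has_vector_derivative 1) (at s)"
          by (auto intro!: derivative_eq_intros)
        ultimately have "((\<lambda>r. F ((z + s *\<^sub>R ?c) + r *\<^sub>R ?c)) \<circ> (\<lambda>r. r - s) has_vector_derivative 1 *\<^sub>R (1 * complex_partial j F (z + s *\<^sub>R ?c))) (at s)"
          by (intro vector_diff_chain_at)
        then show ?thesis
          by (simp add: o_def algebra_simps)
      qed
      have 2: "(E has_vector_derivative - (z $ j + of_real s) * E s) (at s)"
      proof -
        have "((\<lambda>w. exp (- w * z $ j - w ^ 2 / 2)) has_field_derivative - (z $ j + of_real s) * E s) (at (of_real s))"
          unfolding E_def by (auto intro!: derivative_eq_intros simp: algebra_simps)
        from has_vector_derivative_real_field[OF this] show ?thesis
          by (simp add: E_def[abs_def])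
      qed
      have "W' s = F (z + s *\<^sub>R ?c) * (- (z $ j + of_real s) * E s) + complex_partial j F (z + s *\<^sub>R ?c) * E s"
        by (simp only: W'_def line derivative_operator_def cj) algebra
      then show ?thesis
        using has_vector_derivative_mult[OF 1 2] by (simp add: W_def[abs_def] line)
    qed
    have W'c: "continuous_on {0..t} W'"
    proof -
      have "continuous_on UNIV (derivative_operator j F)"
        unfolding derivative_operator_def[abs_def] F_def by (intro continuous_intros entire_continuous ent)
      then have "continuous_on {0..t} (\<lambda>s. derivative_operator j F (z + s *\<^sub>R ?c))"
        by (rule continuous_on_compose2) (auto intro!: continuous_intros)
      moreover have "continuous_on {0..t} E"
        unfolding E_def[abs_def] by (intro continuous_intros) auto
      ultimately show ?thesis
        unfolding W'_def[abs_def] line by (rule continuous_on_mult)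
    qed
    have Bg: "bargmann (\<lambda>x. g (x + s *\<^sub>R ?e)) z = W' s" for s
      unfolding bargmann_translation(3)[OF g] D W'_def E_def F_def ..
    have "bargmann h z = of_real ((2 / pi) powr (real CARD('n) / 4)) * (LINT s|lborel. indicator {0..t} s *\<^sub>R (LINT x|lborel. g (x + s *\<^sub>R ?e) * bkernel x z))"
      unfolding bargmann_eq_bkernel h_def segment_integral(2)[OF g t bkernel_l2(1)] ..
    also have "\<dots> = (LINT s|lborel. indicator {0..t} s *\<^sub>R W' s)"
      unfolding Bg[symmetric] bargmann_eq_bkernel integral_mult_right_zero[symmetric] by simp
    also have "\<dots> = W t - W 0"
      by (rule integral_FTC_atLeastAtMost[OF t _ W'c]) (rule has_vector_derivative_at_within[OF dW])
    also have "\<dots> = bargmann (\<lambda>x. f (x + t *\<^sub>R ?e)) z - bargmann f z"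
      unfolding bargmann_translation(3)[OF f] W_def E_def F_def by simp
    also have "\<dots> = bargmann (\<lambda>x. f (x + t *\<^sub>R ?e) - f x) z"
      unfolding bargmann_eq_bkernel
      using l2_mult_integrable[OF bargmann_translation(1)[OF f] bkernel_l2(1)] l2_mult_integrable[OF f bkernel_l2(1)]
      by (simp add: left_diff_distrib right_diff_distrib)
    finally show "bargmann (\<lambda>x. f (x + t *\<^sub>R ?e) - f x) z = bargmann h z" by simp
  qed
  then show ?thesis by (simp add: h_def)
qed

lemma difference_quotient_tendsto:
  fixes h :: "real \<Rightarrow> complex"
  assumes d: "(h has_vector_derivative D) (at 0)" and r: "r \<longlonglongrightarrow> 0" "\<And>k. r k \<noteq> 0"
  shows "(\<lambda>k. (h (r k) - h 0) /\<^sub>R r k) \<longlonglongrightarrow> D"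
proof -
  have "((\<lambda>s. norm (h (0 + s) - h 0 - s *\<^sub>R D) / norm s) \<longlongrightarrow> 0) (at 0)"
    using d unfolding has_vector_derivative_def has_derivative_at by simp
  moreover have "filterlim r (at 0) sequentially"
    using r by (simp add: filterlim_at)
  ultimately have "(\<lambda>k. norm (h (0 + r k) - h 0 - r k *\<^sub>R D) / norm (r k)) \<longlonglongrightarrow> 0"
    by (rule filterlim_compose)
  moreover have "norm (h (0 + r k) - h 0 - r k *\<^sub>R D) / norm (r k) = norm ((h (r k) - h 0) /\<^sub>R r k - D)" for k
  proof -
    have "(h (r k) - h 0) /\<^sub>R r k - D = (h (r k) - h 0 - r k *\<^sub>R D) /\<^sub>R r k"
      using r(2)[of k] by (simp add: scaleR_diff_right)
    then show ?thesis
      by (simp add: divide_inverse mult.commute)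
  qed
  ultimately have "(\<lambda>k. (h (r k) - h 0) /\<^sub>R r k - D) \<longlonglongrightarrow> 0"
    by (simp add: tendsto_norm_zero_iff)
  then show ?thesis
    by (simp add: LIM_zero_iff)
qed

lemma test_function_increment:
  assumes "\<phi> \<in> test_functions"
  obtains M R where "0 < M" "0 < R"
    "\<And>x t. \<bar>t\<bar> \<le> 1 \<Longrightarrow> cmod (\<phi> (x + t *\<^sub>R axis j 1) - \<phi> x) \<le> \<bar>t\<bar> * (M * indicator (cball 0 R) x)"
proof -
  obtain M where M: "0 < M" "\<And>x t. cmod (\<phi> (x + t *\<^sub>R axis j 1) - \<phi> x) \<le> M * \<bar>t\<bar>"
    using test_function_Lipschitz_along_axis[OF assms, of j] by metis
  obtain R where R: "0 < R" "\<And>x. R < norm x \<Longrightarrow> \<phi> x = 0"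
    using test_function_bounded[OF assms] by metis
  show thesis
  proof (rule that[of M "R + 1"])
    fix x t assume t: "\<bar>t :: real\<bar> \<le> 1"
    show "cmod (\<phi> (x + t *\<^sub>R axis j 1) - \<phi> x) \<le> \<bar>t\<bar> * (M * indicator (cball 0 (R + 1)) x)"
    proof (cases "x \<in> cball 0 (R + 1)")
      case True
      then show ?thesis using M(2)[of x t] by (simp add: mult.commute)
    next
      case False
      then have x: "R + 1 < norm x" by simp
      have "norm x \<le> norm (x + t *\<^sub>R axis j 1) + norm (t *\<^sub>R (axis j 1 :: real ^ 'a))"
        using norm_triangle_sub[of x "- (t *\<^sub>R axis j 1)"] by (simp add: algebra_simps)
      also have "norm (t *\<^sub>R (axis j 1 :: real ^ 'a)) \<le> 1"
        using t by simp
      finally have "R < norm (x + t *\<^sub>R axis j 1)" using x by linarith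
      then have "\<phi> (x + t *\<^sub>R axis j 1) = 0" "\<phi> x = 0"
        using R x by auto
      then show ?thesis using False by simp
    qed
  qed (use M R in auto)
qed

text \<open>
  Pair \<open>f (x + t e\<^sub>j) - f x = \<integral>\<^sub>0\<^sup>t g (x + s e\<^sub>j) ds\<close> with a test function, shift the translations onto it,
  divide by \<open>t\<close> and let \<open>t\<close> tend to \<open>0\<close>.
\<close>

lemma weak_derivative_bargmann:
  fixes f g :: "real ^ 'n \<Rightarrow> complex"
  assumes f: "f \<in> l2 lborel" and g: "g \<in> l2 lborel"
    and ent: "entire (bargmann f)" "entire (complex_partial j (bargmann f))"
    and D: "bargmann g = derivative_operator j (bargmann f)"
    and \<phi>: "\<phi> \<in> test_functions"
  shows "(LINT x|lborel. f x * real_partial j \<phi> x) = - (LINT x|lborel. g x * \<phi> x)"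
proof -
  let ?e = "axis j 1 :: real ^ 'n"
  obtain M R where MR: "0 < M" "0 < R"
    "\<And>x t. \<bar>t\<bar> \<le> 1 \<Longrightarrow> cmod (\<phi> (x + t *\<^sub>R ?e) - \<phi> x) \<le> \<bar>t\<bar> * (M * indicator (cball 0 R) x)"
    using test_function_increment[OF \<phi>] by blast
  have \<phi>l2: "(\<lambda>x. \<phi> (x + t *\<^sub>R ?e)) \<in> l2 lborel" for t
    by (intro test_function_l2 test_function_translation \<phi>)
  have \<phi>l2': "\<phi> \<in> l2 lborel" by (rule test_function_l2[OF \<phi>])
  note cut = indicator_cball_l2[of M R, where 'a="real ^ 'n"]
  define t where "t k = 1 / real (Suc k)" for k
  have t: "0 < t k" "t k \<le> 1" for k by (auto simp: t_def)
  have t_lim: "t \<longlonglongrightarrow> 0"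
    unfolding t_def[abs_def] by (rule LIMSEQ_Suc[OF lim_1_over_n])
  have shift: "(LINT x|lborel. u (x + s *\<^sub>R ?e) * \<phi> x) = (LINT x|lborel. u x * \<phi> (x + (- s) *\<^sub>R ?e))"
    if u: "u \<in> l2 lborel" for u s
  proof -
    have "(\<lambda>x. u x * \<phi> (x + (- s) *\<^sub>R ?e)) \<in> borel_measurable borel"
      using l2_measurable[OF u] l2_measurable[OF \<phi>l2[of "- s"]] by (intro borel_measurable_times) auto
    from integral_translation[OF this, of "s *\<^sub>R ?e"] show ?thesis by simp
  qed
  define v where "v s = (LINT x|lborel. g (x + s *\<^sub>R ?e) * \<phi> x)" for s
  have v_eq: "v s = (LINT x|lborel. g x * \<phi> (x + (- s) *\<^sub>R ?e))" for s
    unfolding v_def by (rule shift[OF g])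
  define L where "L = (LINT x|lborel. cmod (g x) * cmod (of_real (M * indicator (cball 0 R) x)))"
  have v_Lip: "cmod (v s - v 0) \<le> \<bar>s\<bar> * L" if "\<bar>s\<bar> \<le> 1" for s
  proof -
    have "v s - v 0 = (LINT x|lborel. g x * (\<phi> (x + (- s) *\<^sub>R ?e) - \<phi> x))"
      unfolding v_eq using l2_mult_integrable[OF g \<phi>l2[of "- s"]] l2_mult_integrable[OF g \<phi>l2']
      by (simp add: right_diff_distrib)
    also have "cmod \<dots> \<le> (LINT x|lborel. cmod (g x * (\<phi> (x + (- s) *\<^sub>R ?e) - \<phi> x)))"
      by (rule integral_norm_bound)
    also have "\<dots> \<le> (LINT x|lborel. \<bar>s\<bar> * (cmod (g x) * cmod (of_real (M * indicator (cball 0 R) x))))"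
    proof (rule integral_mono)
      show "integrable lborel (\<lambda>x. cmod (g x * (\<phi> (x + (- s) *\<^sub>R ?e) - \<phi> x)))"
        by (intro integrable_norm l2_mult_integrable g l2_diff \<phi>l2 \<phi>l2')
      show "integrable lborel (\<lambda>x. \<bar>s\<bar> * (cmod (g x) * cmod (of_real (M * indicator (cball 0 R) x))))"
        by (intro integrable_mult_right l2_hoelder(1)[OF g cut])
      show "cmod (g x * (\<phi> (x + (- s) *\<^sub>R ?e) - \<phi> x)) \<le> \<bar>s\<bar> * (cmod (g x) * cmod (of_real (M * indicator (cball 0 R) x)))" for x
        using mult_left_mono[OF MR(3)[of "- s" x], of "cmod (g x)"] that MR(1)
        by (simp add: norm_mult abs_mult mult_ac)
    qed
    also have "\<dots> = \<bar>s\<bar> * L" by (simp add: L_def)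
    finally show ?thesis .
  qed
  have vm: "v \<in> borel_measurable borel"
  proof -
    have gm: "g \<in> borel_measurable borel" and pm: "\<phi> \<in> borel_measurable borel"
      using l2_measurable[OF g] l2_measurable[OF \<phi>l2'] by auto
    have 1: "(\<lambda>p :: real \<times> (real ^ 'n). g (snd p + fst p *\<^sub>R ?e)) \<in> borel_measurable borel"
      by (rule measurable_compose[OF translation_orbit(2) gm])
    have 2: "(\<lambda>p :: real \<times> (real ^ 'n). \<phi> (snd p)) \<in> borel_measurable borel"
      by (rule measurable_compose[OF _ pm]) (intro borel_measurable_continuous_onI continuous_intros)
    have "(\<lambda>(s, x). g (x + s *\<^sub>R ?e) * \<phi> x) \<in> borel_measurable (lborel \<Otimes>\<^sub>M lborel)"
      using borel_measurable_times[OF 1 2] by (simp add: lborel_prod case_prod_beta)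
    then have "(\<lambda>s. LINT x|lborel. g (x + s *\<^sub>R ?e) * \<phi> x) \<in> borel_measurable lborel"
      by (rule lborel.borel_measurable_lebesgue_integral)
    then show ?thesis by (simp add: v_def[abs_def])
  qed
  have L0: "0 \<le> L" unfolding L_def by (intro integral_nonneg_AE) auto
  have eq: "(LINT x|lborel. f x * (\<phi> (x + (- t k) *\<^sub>R ?e) - \<phi> x)) = (LINT s|lborel. indicator {0..t k} s *\<^sub>R v s)" for k
  proof -
    let ?h = "\<lambda>x. LINT s|lborel. indicator {0..t k} s *\<^sub>R g (x + s *\<^sub>R ?e)"
    have t0: "0 \<le> t k" using t(1)[of k] by simp
    note ft = bargmann_translation(1)[OF f, of "t k" j]
    have "(LINT x|lborel. f x * (\<phi> (x + (- t k) *\<^sub>R ?e) - \<phi> x)) = (LINT x|lborel. f x * \<phi> (x + (- t k) *\<^sub>R ?e)) - (LINT x|lborel. f x * \<phi> x)"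
      using l2_mult_integrable[OF f \<phi>l2[of "- t k"]] l2_mult_integrable[OF f \<phi>l2'] by (simp add: right_diff_distrib)
    also have "\<dots> = (LINT x|lborel. (f (x + t k *\<^sub>R ?e) - f x) * \<phi> x)"
      unfolding shift[OF f, symmetric]
      using l2_mult_integrable[OF ft \<phi>l2'] l2_mult_integrable[OF f \<phi>l2'] by (simp add: left_diff_distrib)
    also have "\<dots> = (LINT x|lborel. ?h x * \<phi> x)"
    proof (rule integral_cong_AE)
      show "AE x in lborel. (f (x + t k *\<^sub>R ?e) - f x) * \<phi> x = ?h x * \<phi> x"
        using translation_difference[OF f g ent D t0] by eventually_elim simp
      show "(\<lambda>x. (f (x + t k *\<^sub>R ?e) - f x) * \<phi> x) \<in> borel_measurable lborel"
        using l2_measurable[OF l2_diff(1)[OF ft f]] l2_measurable[OF \<phi>l2'] by (rule borel_measurable_times)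
      show "(\<lambda>x. ?h x * \<phi> x) \<in> borel_measurable lborel"
        using l2_measurable[OF segment_integral(1)[OF g t0]] l2_measurable[OF \<phi>l2'] by (rule borel_measurable_times)
    qed
    also have "\<dots> = (LINT s|lborel. indicator {0..t k} s *\<^sub>R v s)"
      unfolding v_def by (rule segment_integral(2)[OF g t0 \<phi>l2'])
    finally show ?thesis .
  qed
  \<comment> \<open>divide by \<open>t k\<close> and let \<open>k\<close> tend to infinity on both sides\<close>
  have left: "(\<lambda>k. (LINT x|lborel. f x * (\<phi> (x + (- t k) *\<^sub>R ?e) - \<phi> x)) /\<^sub>R (- t k)) \<longlonglongrightarrow> (LINT x|lborel. f x * real_partial j \<phi> x)"
  proof -
    have "(\<lambda>k. LINT x|lborel. f x * ((\<phi> (x + (- t k) *\<^sub>R ?e) - \<phi> x) /\<^sub>R (- t k))) \<longlonglongrightarrow> (LINT x|lborel. f x * real_partial j \<phi> x)"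
    proof (rule integral_dominated_convergence)
      show "integrable lborel (\<lambda>x. cmod (f x) * cmod (of_real (M * indicator (cball 0 R) x)))"
        by (rule l2_hoelder(1)[OF f cut])
      show "(\<lambda>x. f x * real_partial j \<phi> x) \<in> borel_measurable lborel"
        using l2_measurable[OF f] l2_measurable[OF test_function_l2[OF test_function_real_partial[OF \<phi>]]]
        by (rule borel_measurable_times)
      show "(\<lambda>x. f x * ((\<phi> (x + (- t k) *\<^sub>R ?e) - \<phi> x) /\<^sub>R (- t k))) \<in> borel_measurable lborel" for k
        by (intro borel_measurable_times borel_measurable_scaleR borel_measurable_const borel_measurable_diff
            l2_measurable[OF f] l2_measurable[OF \<phi>l2] l2_measurable[OF \<phi>l2'])
      show "AE x in lborel. (\<lambda>k. f x * ((\<phi> (x + (- t k) *\<^sub>R ?e) - \<phi> x) /\<^sub>R (- t k))) \<longlonglongrightarrow> f x * real_partial j \<phi> x"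
      proof (rule AE_I2)
        fix x
        have "((\<lambda>s. \<phi> (x + s *\<^sub>R ?e)) has_vector_derivative real_partial j \<phi> x) (at 0)"
          using has_vector_derivative_real_partial[OF test_function_differentiable[OF \<phi>], of x j 0] by simp
        moreover have "(\<lambda>k. - t k) \<longlonglongrightarrow> 0" using tendsto_minus[OF t_lim] by simp
        moreover have "- t k \<noteq> 0" for k using t(1)[of k] by simp
        ultimately have "(\<lambda>k. (\<phi> (x + (- t k) *\<^sub>R ?e) - \<phi> (x + 0 *\<^sub>R ?e)) /\<^sub>R (- t k)) \<longlonglongrightarrow> real_partial j \<phi> x"
          by (rule difference_quotient_tendsto)
        then show "(\<lambda>k. f x * ((\<phi> (x + (- t k) *\<^sub>R ?e) - \<phi> x) /\<^sub>R (- t k))) \<longlonglongrightarrow> f x * real_partial j \<phi> x"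
          by (intro tendsto_mult tendsto_const) simp
      qed
      show "AE x in lborel. cmod (f x * ((\<phi> (x + (- t k) *\<^sub>R ?e) - \<phi> x) /\<^sub>R (- t k))) \<le> cmod (f x) * cmod (of_real (M * indicator (cball 0 R) x))" for k
      proof (rule AE_I2)
        fix x
        have "cmod ((\<phi> (x + (- t k) *\<^sub>R ?e) - \<phi> x) /\<^sub>R (- t k)) = cmod (\<phi> (x + (- t k) *\<^sub>R ?e) - \<phi> x) / t k"
          unfolding norm_scaleR using t(1)[of k] by (simp add: divide_inverse mult.commute)
        also have "\<dots> \<le> (\<bar>- t k\<bar> * (M * indicator (cball 0 R) x)) / t k"
          using t[of k] by (intro divide_right_mono MR(3)) auto
        also have "\<dots> = cmod (of_real (M * indicator (cball 0 R) x))"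
          using t(1)[of k] MR(1) by (simp add: norm_mult indicator_def)
        finally show "cmod (f x * ((\<phi> (x + (- t k) *\<^sub>R ?e) - \<phi> x) /\<^sub>R (- t k))) \<le> cmod (f x) * cmod (of_real (M * indicator (cball 0 R) x))"
          unfolding norm_mult[of "f x"] by (intro mult_left_mono) auto
      qed
    qed
    moreover have "(LINT x|lborel. f x * ((\<phi> (x + (- t k) *\<^sub>R ?e) - \<phi> x) /\<^sub>R (- t k)))
        = (LINT x|lborel. f x * (\<phi> (x + (- t k) *\<^sub>R ?e) - \<phi> x)) /\<^sub>R (- t k)" for k
      unfolding mult_scaleR_right by (rule integral_scaleR_right)
    ultimately show ?thesis by simp
  qed
  have right: "(\<lambda>k. (LINT s|lborel. indicator {0..t k} s *\<^sub>R v s) /\<^sub>R (- t k)) \<longlonglongrightarrow> - v 0"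
  proof -
    have bound: "cmod ((LINT s|lborel. indicator {0..t k} s *\<^sub>R v s) /\<^sub>R (- t k) - (- v 0)) \<le> t k * L" for k
    proof -
      have t0: "0 \<le> t k" using t(1)[of k] by simp
      have ind: "integrable lborel (\<lambda>s. indicator {0..t k} s *\<^sub>R c)" for c :: "'b::{banach,second_countable_topology}"
        by (intro integrable_scaleR_left) (simp add: integrable_indicator_iff emeasure_lborel_Icc_eq)
      have le: "cmod (indicator {0..t k} s *\<^sub>R (v s - v 0)) \<le> indicator {0..t k} s *\<^sub>R (t k * L)" for s
      proof (cases "s \<in> {0..t k}")
        case True
        then have "cmod (v s - v 0) \<le> \<bar>s\<bar> * L" using t(2)[of k] by (intro v_Lip) auto
        also have "\<dots> \<le> t k * L" using True L0 by (intro mult_right_mono) auto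
        finally show ?thesis using True by simp
      qed simp
      have dint: "integrable lborel (\<lambda>s. indicator {0..t k} s *\<^sub>R (v s - v 0))"
      proof (rule Bochner_Integration.integrable_bound[OF ind[of "t k * L"]])
        show "(\<lambda>s. indicator {0..t k} s *\<^sub>R (v s - v 0)) \<in> borel_measurable lborel"
          using vm by measurable
        show "AE s in lborel. norm (indicator {0..t k} s *\<^sub>R (v s - v 0)) \<le> norm (indicator {0..t k} s *\<^sub>R (t k * L))"
          using le by (intro AE_I2 order_trans[OF le]) (simp del: norm_scaleR)
      qed
      have "(LINT s|lborel. indicator {0..t k} s *\<^sub>R v s) = (LINT s|lborel. indicator {0..t k} s *\<^sub>R (v s - v 0) + indicator {0..t k} s *\<^sub>R v 0)"
        by (simp add: algebra_simps)
      also have "\<dots> = (LINT s|lborel. indicator {0..t k} s *\<^sub>R (v s - v 0)) + t k *\<^sub>R v 0"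
        using dint ind[of "v 0"] t0 by simp
      finally have "(LINT s|lborel. indicator {0..t k} s *\<^sub>R v s) /\<^sub>R (- t k) - (- v 0) = (LINT s|lborel. indicator {0..t k} s *\<^sub>R (v s - v 0)) /\<^sub>R (- t k)"
        using t(1)[of k] by (simp add: scaleR_add_right)
      also have "cmod \<dots> = cmod (LINT s|lborel. indicator {0..t k} s *\<^sub>R (v s - v 0)) / t k"
        unfolding norm_scaleR using t(1)[of k] by (simp add: divide_inverse mult.commute)
      also have "\<dots> \<le> (LINT s|lborel. indicator {0..t k} s *\<^sub>R (t k * L)) / t k"
        using t0 by (intro divide_right_mono order_trans[OF integral_norm_bound] integral_mono integrable_norm dint ind le) auto
      also have "\<dots> = t k * L"
        using t(1)[of k] by simp
      finally show ?thesis .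
    qed
    have "(\<lambda>k. t k * L) \<longlonglongrightarrow> 0"
      using tendsto_mult_left_zero[OF t_lim] .
    then have "(\<lambda>k. (LINT s|lborel. indicator {0..t k} s *\<^sub>R v s) /\<^sub>R (- t k) - (- v 0)) \<longlonglongrightarrow> 0"
      by (rule Lim_null_comparison[rotated]) (use bound in \<open>auto intro!: always_eventually\<close>)
    then show ?thesis by (rule LIM_zero_cancel)
  qed
  have "(LINT x|lborel. f x * real_partial j \<phi> x) = - v 0"
    using LIMSEQ_unique[OF left] right unfolding eq by blast
  then show ?thesis by (simp add: v_def)
qed

section \<open>The inverse transform on the Fock-Sobolev space\<close>

lemma inverse_bound_nonneg: "0 \<le> inverse_bound TYPE('n::finite)"
  using fock_mass_pos[where 'n='n] gaussian_integral_pos[of 2, where 'n='n]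
  unfolding inverse_bound_def adjoint_bound_def
  by (intro divide_nonneg_nonneg mult_nonneg_nonneg real_sqrt_ge_zero integral_nonneg_AE) auto

text \<open>
  A weak derivative of the preimage of \<open>F\<close> is itself the preimage of \<open>\<partial>\<^sub>j F - z\<^sub>j F\<close>, a function of
  the same kind with one order less and a norm that is larger by a factor of at most \<open>5 + m\<close>.
\<close>

lemma weak_derivatives_of_preimage:
  fixes f :: "real ^ 'n \<Rightarrow> complex"
  assumes "fock_bounded k b (bargmann f)" "f \<in> l2 lborel" "l2_norm lborel f \<le> inverse_bound TYPE('n) * b"
    "length is \<le> k" "k \<le> m"
  shows "\<exists>g\<in>l2 lborel. l2_norm lborel g \<le> inverse_bound TYPE('n) * ((5 + real m) ^ length is * b) \<and>
    (\<forall>\<phi>\<in>test_functions. (LINT x|lborel. f x * foldr real_partial is \<phi> x) = (-1) ^ length is * (LINT x|lborel. g x * \<phi> x))"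
  using assms
proof (induction "is" arbitrary: k b f)
  case Nil
  then show ?case by (intro bexI[of _ f]) auto
next
  case (Cons i "is")
  obtain l where k: "k = Suc l" and l: "length is \<le> l" "l \<le> m"
    using Cons.prems(4,5) by (cases k) auto
  have b0: "0 \<le> b" by (rule fock_bounded_nonneg[OF Cons.prems(1)])
  let ?F = "bargmann f"
  have bd: "fock_bounded l ((5 + real m) * b) (derivative_operator i ?F)"
    by (rule fock_bounded_mono[OF fock_bounded_derivative_operator[OF Cons.prems(1)[unfolded k]] order_refl])
      (use b0 l in \<open>auto intro!: mult_right_mono\<close>)
  have "?F \<in> fock" "complex_partial i ?F \<in> fock"
    using fock_bounded_fock[OF Cons.prems(1)] fock_bounded_fock[OF fock_bounded_partial[OF Cons.prems(1)[unfolded k]]] by auto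
  then have ent: "entire ?F" "entire (complex_partial i ?F)"
    by (auto simp: fock_iff)
  obtain g1 where g1: "g1 \<in> l2 lborel" "bargmann g1 = derivative_operator i ?F"
    "l2_norm lborel g1 \<le> inverse_bound TYPE('n) * fock_norm (derivative_operator i ?F)"
    using bargmann_surjective[OF fock_bounded_fock[OF bd]] by blast
  have g1n: "l2_norm lborel g1 \<le> inverse_bound TYPE('n) * ((5 + real m) * b)"
    by (rule order_trans[OF g1(3)]) (intro mult_left_mono fock_bounded_norm[OF bd] inverse_bound_nonneg)
  obtain g where g: "g \<in> l2 lborel" "l2_norm lborel g \<le> inverse_bound TYPE('n) * ((5 + real m) ^ length is * ((5 + real m) * b))"
    "\<And>\<phi>. \<phi> \<in> test_functions \<Longrightarrow> (LINT x|lborel. g1 x * foldr real_partial is \<phi> x) = (-1) ^ length is * (LINT x|lborel. g x * \<phi> x)"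
    using Cons.IH[of l "(5 + real m) * b" g1] bd g1 g1n l by auto
  show ?case
  proof (intro bexI[OF _ g(1)] conjI ballI)
    show "l2_norm lborel g \<le> inverse_bound TYPE('n) * ((5 + real m) ^ length (i # is) * b)"
      using g(2) by (simp add: mult_ac)
    fix \<phi> :: "real ^ 'n \<Rightarrow> complex" assume \<phi>: "\<phi> \<in> test_functions"
    have "(LINT x|lborel. f x * foldr real_partial (i # is) \<phi> x) = - (LINT x|lborel. g1 x * foldr real_partial is \<phi> x)"
      using weak_derivative_bargmann[OF Cons.prems(2) g1(1) ent g1(2) test_function_foldr_real_partial[OF \<phi>]] by simp
    then show "(LINT x|lborel. f x * foldr real_partial (i # is) \<phi> x) = (-1) ^ length (i # is) * (LINT x|lborel. g x * \<phi> x)"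
      using g(3)[OF \<phi>] by simp
  qed
qed

text \<open>
  The choice in \<open>weak_deriv\<close> is immaterial: two weak derivatives agree almost everywhere, as their
  difference annihilates all test functions.
\<close>

lemma L2_norm_weak_deriv:
  fixes f g :: "real ^ 'n \<Rightarrow> complex"
  assumes g: "g \<in> L2" "has_weak_deriv \<alpha> f g"
  shows "L2_norm (weak_deriv \<alpha> f) = L2_norm g"
proof -
  let ?h = "weak_deriv \<alpha> f"
  have h: "?h \<in> L2" "has_weak_deriv \<alpha> f ?h"
    unfolding weak_deriv_def by (rule someI2[where Q="\<lambda>h. h \<in> L2"], use g in auto)
      (rule someI2[where Q="\<lambda>h. has_weak_deriv \<alpha> f h"], use g in auto)
  have l2: "g \<in> l2 lborel" "?h \<in> l2 lborel"
    using g(1) h(1) by (simp_all add: L2_eq_l2)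
  have "AE x in lborel. ?h x - g x = 0"
  proof (rule l2_AE_eq_0_if_test_integrals_eq_0[OF l2_diff(1)[OF l2(2,1)]])
    fix \<phi> :: "real ^ 'n \<Rightarrow> complex" assume \<phi>: "\<phi> \<in> test_functions"
    have "(LINT x|lborel. ?h x * \<phi> x) = (LINT x|lborel. g x * \<phi> x)"
      using g(2) h(2) \<phi> by (auto simp: has_weak_deriv_def)
    then show "(LINT x|lborel. (?h x - g x) * \<phi> x) = 0"
      using l2_mult_integrable[OF l2(2) test_function_l2[OF \<phi>]] l2_mult_integrable[OF l2(1) test_function_l2[OF \<phi>]]
      by (simp add: left_diff_distrib)
  qed
  then have "(LINT x|lborel. (cmod (?h x))\<^sup>2) = (LINT x|lborel. (cmod (g x))\<^sup>2)"
    using borel_measurable_integrable[OF l2_integrable[OF l2(1)]] borel_measurable_integrable[OF l2_integrable[OF l2(2)]]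
    by (intro integral_cong_AE) (auto elim: eventually_mono)
  then show ?thesis by (simp add: L2_norm_def)
qed

theorem fock_sobolev_preimage:
  fixes F :: "complex ^ 'n \<Rightarrow> complex"
  assumes F: "F \<in> fock_sobolev m"
  shows "\<exists>f\<in>sobolev m. bargmann_inv F = L2_class f \<and>
    sobolev_norm m f \<le> real (card (multi_indices m :: ('n \<Rightarrow> nat) set)) * (inverse_bound TYPE('n) * (5 + real m) ^ m) * fock_sobolev_norm m F"
proof -
  define b where "b = fock_sobolev_norm m F"
  have bd: "fock_bounded m b F"
    using fock_sobolev_words[OF F] by (auto simp: fock_bounded_def b_def)
  have b0: "0 \<le> b" by (rule fock_bounded_nonneg[OF bd])
  obtain f where f: "f \<in> l2 lborel" "bargmann f = F" "l2_norm lborel f \<le> inverse_bound TYPE('n) * fock_norm F"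
    using bargmann_surjective[OF fock_bounded_fock[OF bd]] by blast
  have fb: "l2_norm lborel f \<le> inverse_bound TYPE('n) * b"
    by (rule order_trans[OF f(3)]) (intro mult_left_mono fock_bounded_norm[OF bd] inverse_bound_nonneg)
  define K where "K = inverse_bound TYPE('n) * ((5 + real m) ^ m * b)"
  have wd: "\<exists>g\<in>L2. has_weak_deriv \<alpha> f g \<and> L2_norm g \<le> K" if \<alpha>: "\<alpha> \<in> multi_indices m" for \<alpha>
  proof -
    obtain js where js: "length js = (\<Sum>i\<in>UNIV. \<alpha> i)"
      "multi_deriv real_partial \<alpha> = (foldr real_partial js :: (real ^ 'n \<Rightarrow> complex) \<Rightarrow> _)"
      by (rule multi_deriv_word[of \<alpha>]) blast
    have len: "length js \<le> m" using \<alpha> js(1) by (simp add: multi_indices_def)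
    obtain g where g: "g \<in> l2 lborel" "l2_norm lborel g \<le> inverse_bound TYPE('n) * ((5 + real m) ^ length js * b)"
      "\<And>\<phi>. \<phi> \<in> test_functions \<Longrightarrow> (LINT x|lborel. f x * foldr real_partial js \<phi> x) = (-1) ^ length js * (LINT x|lborel. g x * \<phi> x)"
      using weak_derivatives_of_preimage[of m b f js m] bd f fb len by auto
    have "(5 + real m) ^ length js * b \<le> (5 + real m) ^ m * b"
      using b0 len by (intro mult_right_mono power_increasing) auto
    then have "l2_norm lborel g \<le> K"
      unfolding K_def by (rule order_trans[OF g(2) mult_left_mono[OF _ inverse_bound_nonneg]])
    then show ?thesis
      using g(1,3) js by (intro bexI[of _ g]) (auto simp: has_weak_deriv_def L2_eq_l2)
  qed
  show ?thesis
  proof (intro bexI conjI)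
    show "f \<in> sobolev m"
      using f(1) wd by (auto simp: sobolev_def L2_eq_l2)
    show "bargmann_inv F = L2_class f"
    proof (rule set_eqI)
      fix g
      show "g \<in> bargmann_inv F \<longleftrightarrow> g \<in> L2_class f"
        using bargmann_eq_AE[of g f] bargmann_cong_AE[of g f] f(1,2)
        by (auto simp: bargmann_inv_def L2_class_def L2_eq_l2)
    qed
    have "sobolev_norm m f = L2_set (\<lambda>\<alpha>. L2_norm (weak_deriv \<alpha> f)) (multi_indices m)"
      by (simp add: sobolev_norm_def L2_set_def)
    also have "\<dots> \<le> (\<Sum>\<alpha>\<in>multi_indices m. L2_norm (weak_deriv \<alpha> f))"
      by (rule L2_set_le_sum) (simp add: L2_eq_l2 l2_norm_nonneg)
    also have "\<dots> \<le> (\<Sum>\<alpha>\<in>(multi_indices m :: ('n \<Rightarrow> nat) set). K)"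
    proof (rule sum_mono)
      fix \<alpha> :: "'n \<Rightarrow> nat" assume "\<alpha> \<in> multi_indices m"
      then obtain g where "g \<in> L2" "has_weak_deriv \<alpha> f g" "L2_norm g \<le> K"
        using wd by blast
      then show "L2_norm (weak_deriv \<alpha> f) \<le> K"
        by (simp add: L2_norm_weak_deriv)
    qed
    finally show "sobolev_norm m f \<le> real (card (multi_indices m :: ('n \<Rightarrow> nat) set)) * (inverse_bound TYPE('n) * (5 + real m) ^ m) * fock_sobolev_norm m F"
      by (simp add: K_def b_def mult.assoc)
  qed
qed

section \<open>Sobolev functions whose transform is not a Fock-Sobolev function\<close>

lemma constant_fock_sobolev: "(\<lambda>z :: complex ^ 'n. c) \<in> fock_sobolev m"
proof -
  have const: "(\<lambda>z :: complex ^ 'n. d) \<in> fock" for d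
    by (simp add: fock_iff entire_const l2_def)
  have "foldr complex_partial is (\<lambda>z :: complex ^ 'n. c) = (\<lambda>z. if is = [] then c else 0)" for "is" :: "'n list"
    by (induction "is") (auto simp: entire_const)
  then have "foldr complex_partial is (\<lambda>z :: complex ^ 'n. c) \<in> fock" for "is" :: "'n list"
    using const by simp
  moreover have "\<exists>is. multi_deriv complex_partial \<alpha> = (foldr complex_partial is :: (complex ^ 'n \<Rightarrow> complex) \<Rightarrow> _)" for \<alpha> :: "'n \<Rightarrow> nat"
    by (rule multi_deriv_word[of \<alpha>]) blast
  ultimately show ?thesis
    unfolding fock_sobolev_def by (auto simp: entire_const) (metis)
qed

text \<open>
  Translates by \<open>4\<^sup>k\<close> of the preimage \<open>f\<^sub>0\<close> of the constant function \<open>1\<close>, with weights \<open>2\<^sup>-\<^sup>k\<close>, have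
  a sum in every Sobolev space that contains \<open>f\<^sub>0\<close>. Its transform is
  \<open>\<Sum>k. 2\<^sup>-\<^sup>k exp (a\<^sub>k z\<^sub>j - a\<^sub>k\<^sup>2 / 2)\<close> with \<open>a\<^sub>k = 4\<^sup>k\<close>.
\<close>

lemma sparse_translates_sobolev:
  fixes j :: "'n::finite" and m :: nat
  obtains f :: "real ^ 'n \<Rightarrow> complex" where "f \<in> sobolev m"
    "\<And>z. (\<lambda>k. (1/2)^k * exp (of_real (4^k) * z $ j - of_real (4^k) ^ 2 / 2)) sums bargmann f z"
proof -
  let ?e = "axis j 1 :: real ^ 'n"
  obtain f0 :: "real ^ 'n \<Rightarrow> complex" where f0: "f0 \<in> sobolev m" "bargmann_inv (\<lambda>z :: complex ^ 'n. 1) = L2_class f0"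
    using fock_sobolev_preimage[OF constant_fock_sobolev[of 1 m, where 'n='n]] by blast
  have f0l: "f0 \<in> l2 lborel" using f0(1) by (simp add: sobolev_def L2_eq_l2)
  then have "f0 \<in> L2_class f0" by (simp add: L2_class_def L2_eq_l2)
  then have Bf0: "bargmann f0 = (\<lambda>z. 1)"
    using f0(2) by (auto simp: bargmann_inv_def)
  define a where "a k = (4::real)^k" for k :: nat
  define shift where "shift u k x = u (x + (- a k) *\<^sub>R ?e)" for u :: "real ^ 'n \<Rightarrow> complex" and k x
  have sl: "shift u k \<in> l2 lborel" "l2_norm lborel (shift u k) \<le> l2_norm lborel u" if "u \<in> l2 lborel" for u k
    using bargmann_translation(1,2)[OF that, of "- a k" j] by (simp_all add: shift_def[abs_def])
  have move: "(LINT x|lborel. shift u k x * \<psi> x) = (LINT x|lborel. u x * \<psi> (x + a k *\<^sub>R ?e))"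
    if u: "u \<in> l2 lborel" and \<psi>: "\<psi> \<in> test_functions" for u k \<psi>
  proof -
    have "(\<lambda>x. u x * \<psi> (x + a k *\<^sub>R ?e)) \<in> borel_measurable borel"
      using l2_measurable[OF u] test_function_measurable[OF test_function_translation[OF \<psi>]]
      by (intro borel_measurable_times) auto
    from integral_translation[OF this, of "(- a k) *\<^sub>R ?e"] show ?thesis
      by (simp add: shift_def)
  qed
  obtain f where f: "f \<in> l2 lborel"
    "\<And>h. h \<in> l2 lborel \<Longrightarrow> (\<lambda>k. (1/2)^k * (LINT x|lborel. shift f0 k x * h x)) sums (LINT x|lborel. f x * h x)"
    by (rule l2_weighted_series[where v="shift f0" and M=lborel, OF sl[OF f0l]]) blast
  have wd: "\<exists>g\<in>L2. has_weak_deriv \<alpha> f g" if \<alpha>: "\<alpha> \<in> multi_indices m" for \<alpha>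
  proof -
    obtain g0 where "g0 \<in> L2" and g0: "has_weak_deriv \<alpha> f0 g0"
      using f0(1) \<alpha> by (auto simp: sobolev_def)
    then have g0l: "g0 \<in> l2 lborel" by (simp add: L2_eq_l2)
    obtain g where g: "g \<in> l2 lborel"
      "\<And>h. h \<in> l2 lborel \<Longrightarrow> (\<lambda>k. (1/2)^k * (LINT x|lborel. shift g0 k x * h x)) sums (LINT x|lborel. g x * h x)"
      by (rule l2_weighted_series[where v="shift g0" and M=lborel, OF sl[OF g0l]]) blast
    obtain js where js: "multi_deriv real_partial \<alpha> = (foldr real_partial js :: (real ^ 'n \<Rightarrow> complex) \<Rightarrow> _)"
      by (rule multi_deriv_word[of \<alpha>]) blast
    let ?s = "(-1) ^ (\<Sum>i\<in>UNIV. \<alpha> i) :: complex"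
    have "(LINT x|lborel. f x * multi_deriv real_partial \<alpha> \<phi> x) = ?s * (LINT x|lborel. g x * \<phi> x)" if \<phi>: "\<phi> \<in> test_functions" for \<phi>
    proof -
      let ?\<psi> = "multi_deriv real_partial \<alpha> \<phi>"
      have \<psi>: "?\<psi> \<in> test_functions"
        unfolding js by (rule test_function_foldr_real_partial[OF \<phi>])
      have "(LINT x|lborel. shift f0 k x * ?\<psi> x) = ?s * (LINT x|lborel. shift g0 k x * \<phi> x)" for k
      proof -
        have "(LINT x|lborel. shift f0 k x * ?\<psi> x) = (LINT x|lborel. f0 x * multi_deriv real_partial \<alpha> (\<lambda>x. \<phi> (x + a k *\<^sub>R ?e)) x)"
          unfolding move[OF f0l \<psi>] unfolding js foldr_real_partial_translation ..
        also have "\<dots> = ?s * (LINT x|lborel. g0 x * \<phi> (x + a k *\<^sub>R ?e))"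
          using g0 test_function_translation[OF \<phi>] by (auto simp: has_weak_deriv_def)
        finally show ?thesis
          by (simp add: move[OF g0l \<phi>])
      qed
      then have "(\<lambda>k. ?s * ((1/2)^k * (LINT x|lborel. shift g0 k x * \<phi> x))) sums (LINT x|lborel. f x * ?\<psi> x)"
        using f(2)[OF test_function_l2[OF \<psi>]] by (simp add: mult_ac)
      moreover have "(\<lambda>k. ?s * ((1/2)^k * (LINT x|lborel. shift g0 k x * \<phi> x))) sums (?s * (LINT x|lborel. g x * \<phi> x))"
        by (rule sums_mult[OF g(2)[OF test_function_l2[OF \<phi>]]])
      ultimately show ?thesis by (rule sums_unique2)
    qed
    then show ?thesis
      using g(1) by (intro bexI[of _ g]) (auto simp: has_weak_deriv_def L2_eq_l2)
  qed
  show thesis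
  proof
    show "f \<in> sobolev m"
      using f(1) wd by (simp add: sobolev_def L2_eq_l2)
    fix z :: "complex ^ 'n"
    let ?c = "of_real ((2 / pi) powr (real CARD('n) / 4)) :: complex"
    have "bargmann (shift f0 k) z = exp (of_real (4^k) * z $ j - of_real (4^k) ^ 2 / 2)" for k
      unfolding shift_def[abs_def] bargmann_translation(3)[OF f0l] Bf0 by (simp add: a_def)
    then have summand: "?c * ((1/2)^k * (LINT x|lborel. shift f0 k x * bkernel x z)) = (1/2)^k * exp (of_real (4^k) * z $ j - of_real (4^k) ^ 2 / 2)" for k
      unfolding bargmann_eq_bkernel by (subst mult.left_commute) (rule arg_cong)
    show "(\<lambda>k. (1/2)^k * exp (of_real (4^k) * z $ j - of_real (4^k) ^ 2 / 2)) sums bargmann f z"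
      using sums_mult[OF f(2)[OF bkernel_l2(1)[of z]], of ?c] unfolding summand bargmann_eq_bkernel .
  qed
qed

text \<open>
  On the real line in direction \<open>j\<close> all terms of that series increase, so its derivative at \<open>a\<^sub>k\<close>
  is at least the derivative of the \<open>k\<close>-th term, \<open>2\<^sup>k exp (a\<^sub>k\<^sup>2 / 2)\<close>. No Fock function grows that fast.
\<close>

theorem sobolev_image_not_fock_sobolev:
  assumes m: "m \<ge> 1"
  shows "\<not> bargmann ` (sobolev m :: (real ^ 'n \<Rightarrow> complex) set) \<subseteq> fock_sobolev m"
proof
  assume sub: "bargmann ` (sobolev m :: (real ^ 'n \<Rightarrow> complex) set) \<subseteq> fock_sobolev m"
  define j :: 'n where "j = undefined"
  obtain f :: "real ^ 'n \<Rightarrow> complex" where f: "f \<in> sobolev m"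
    "\<And>z. (\<lambda>k. (1/2)^k * exp (of_real (4^k) * z $ j - of_real (4^k) ^ 2 / 2)) sums bargmann f z"
    by (rule sparse_translates_sobolev[of m j]) blast
  let ?e = "axis j 1 :: complex ^ 'n"
  define F where "F = bargmann f"
  define G where "G = complex_partial j F"
  have FS: "F \<in> fock_sobolev m"
    using sub f(1) by (auto simp: F_def)
  have "F \<in> fock" and "G \<in> fock"
    using fock_sobolev_words(1)[OF FS, of "[]"] fock_sobolev_words(1)[OF FS, of "[j]"] m by (simp_all add: G_def)
  then have ent: "entire F" by (simp add: fock_iff)
  obtain g where g: "g \<in> l2 lborel" "bargmann g = G"
    using bargmann_surjective[OF \<open>G \<in> fock\<close>] by blast
  define C where "C = (2 / pi) powr (real CARD('n) / 4) * gaussian_l2_norm TYPE('n) * l2_norm lborel g"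
  have growth: "cmod (G z) \<le> C * exp ((norm z)\<^sup>2 / 2)" for z
    using bargmann_growth[OF g(1), of z] by (simp add: g(2) C_def)
  define q where "q k t = (1/2)^k * exp (4^k * t - (4^k)\<^sup>2 / 2)" for k and t :: real
  have qs: "(\<lambda>k. q k t) sums Re (F (t *\<^sub>R ?e))" for t
  proof -
    have "(1/2)^k * exp (of_real (4^k) * (t *\<^sub>R ?e) $ j - of_real (4^k) ^ 2 / 2) = complex_of_real (q k t)" for k
    proof -
      have "(t *\<^sub>R ?e) $ j = complex_of_real t"
        by (simp add: axis_def of_real_def)
      then have "of_real (4^k) * (t *\<^sub>R ?e) $ j - of_real (4^k) ^ 2 / 2 = complex_of_real (4^k * t - (4^k)\<^sup>2 / 2)"
        by simp
      then show ?thesis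
        by (simp only: q_def exp_of_real of_real_mult of_real_power of_real_divide of_real_1 of_real_numeral)
    qed
    then have "(\<lambda>k. complex_of_real (q k t)) sums F (t *\<^sub>R ?e)"
      using f(2)[of "t *\<^sub>R ?e"] by (simp add: F_def)
    from sums_Re[OF this] show ?thesis by simp
  qed
  have "2^k \<le> C" for k
  proof -
    define a where "a = (4::real)^k"
    have a0: "0 < a" by (simp add: a_def)
    define r where "r s = Re (F ((a + s) *\<^sub>R ?e)) - q k (a + s)" for s
    have "mono_on UNIV r"
    proof (rule mono_onI)
      fix s t :: real assume st: "s \<le> t"
      have inc: "0 \<le> q i (a + t) - q i (a + s)" for i
        using st by (auto simp: q_def intro!: mult_left_mono)
      have d: "(\<lambda>i. q i (a + t) - q i (a + s)) sums (Re (F ((a + t) *\<^sub>R ?e)) - Re (F ((a + s) *\<^sub>R ?e)))"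
        by (intro sums_diff qs)
      have "(\<Sum>i\<in>{k}. q i (a + t) - q i (a + s)) \<le> (\<Sum>i. q i (a + t) - q i (a + s))"
        by (rule sum_le_suminf) (use d inc in \<open>auto simp: sums_iff\<close>)
      then show "r s \<le> r t"
        using d by (simp add: r_def sums_iff)
    qed
    moreover have "(r has_real_derivative (Re (G (a *\<^sub>R ?e)) - 2^k * exp (a\<^sup>2 / 2))) (at 0)"
    proof -
      have "((\<lambda>s. F (a *\<^sub>R ?e + s *\<^sub>R ?e)) has_vector_derivative 1 * G (a *\<^sub>R ?e)) (at 0)"
        unfolding G_def by (rule entire_has_vector_derivative_axis[OF ent])
      then have "((\<lambda>s. Re (F ((a + s) *\<^sub>R ?e))) has_vector_derivative Re (G (a *\<^sub>R ?e))) (at 0)"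
        using bounded_linear.has_vector_derivative[OF bounded_linear_Re] by (simp add: scaleR_add_left)
      moreover have "((\<lambda>s. q k (a + s)) has_real_derivative 2^k * exp (a\<^sup>2 / 2)) (at 0)"
      proof -
        have "((\<lambda>s. q k (a + s)) has_real_derivative (1/2)^k * (exp (4^k * (a + 0) - (4^k)\<^sup>2 / 2) * 4^k)) (at 0)"
          unfolding q_def by (auto intro!: derivative_eq_intros)
        also have "4^k * (a + 0) - (4^k)\<^sup>2 / 2 = a\<^sup>2 / 2"
          by (simp add: a_def power2_eq_square)
        also have "(1/2)^k * (exp (a\<^sup>2 / 2) * 4^k) = 2^k * exp (a\<^sup>2 / 2)"
          by (simp flip: power_mult_distrib mult.assoc add: mult.commute)
        finally show ?thesis .
      qed
      ultimately show ?thesis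
        unfolding r_def by (intro DERIV_diff) (simp_all add: has_real_derivative_iff_has_vector_derivative)
    qed
    ultimately have "0 \<le> Re (G (a *\<^sub>R ?e)) - 2^k * exp (a\<^sup>2 / 2)"
      by (rule mono_on_imp_deriv_nonneg) simp
    then have "2^k * exp (a\<^sup>2 / 2) \<le> cmod (G (a *\<^sub>R ?e))"
      using complex_Re_le_cmod[of "G (a *\<^sub>R ?e)"] by linarith
    also have "\<dots> \<le> C * exp (a\<^sup>2 / 2)"
      using growth[of "a *\<^sub>R ?e"] a0 by simp
    finally show ?thesis by simp
  qed
  moreover obtain k where "C < 2^k"
    using real_arch_pow[of 2 C] by auto
  ultimately show False
    using not_less by blast
qed

theorem proposition2p5:
  fixes m :: nat
  assumes "m \<ge> 1"
  shows "(\<exists>C. \<forall>F \<in> (fock_sobolev m :: (complex ^ 'n \<Rightarrow> complex) set).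
            \<exists>f \<in> sobolev m. bargmann_inv F = L2_class f \<and>
              sobolev_norm m f \<le> C * fock_sobolev_norm m F)
       \<and> \<not> bargmann ` (sobolev m :: (real ^ 'n \<Rightarrow> complex) set) \<subseteq> fock_sobolev m"
  by (rule conjI[OF exI[of _ "real (card (multi_indices m :: ('n \<Rightarrow> nat) set)) * (inverse_bound TYPE('n) * (5 + real m) ^ m)"]])
    (intro ballI fock_sobolev_preimage, assumption, rule sobolev_image_not_fock_sobolev[OF assms])

end
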